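(* Fix any integers $n\geq 30$ and $p\geq 3n$, and any real $\sigma\geq 0$. Then there exist a $2$-sparse $\beta^*\in\mathbb{R}^p$ with $\frac12\leq\|\beta^*\|_2\leq\|\beta^*\|_1\leq 1$, and a positive semi-definite $\Sigma\in\mathbb{R}^{p\times p}$ with $\|\Sigma\|_{sp}\leq 2$ and $\Sigma_{\mathrm{Support}(\beta^* )}=\mathbf{I}_{\mathrm{Support}(\beta^* )}$, such that the following holds. Let $(x^{(i)},y^{(i)})$, $i=1,\dots,n$, be i.i.d. samples from the distribution on $\mathbb{R}^p\times\mathbb{R}$ defined by drawing $x^{(i)}\sim N(0,\Sigma)$ and $y^{(i)}\sim N\left(x^{(i)T}\beta^*,\sigma^2\right)$ (conditionally on $x^{(i)}$), and let $(x,y)$ be a new draw from the same distribution, independent of the training sample. (a) For any sample, for all $B\geq 0$, there is a choice of $$\hat\beta^B\in\arg\min_{\|\beta\|_1\leq B}\sum_{i=1}^n\left(y^{(i)}-x^{(i)T}\beta\right)^2$$ such that $$\mathbb{E}\left[\left(y-x^T\hat\beta^B\right)^2\right]\geq\sigma^2+\frac{1}{288\,n\log^2(3n)}.$$ (b) Additionally, if $100\leq\frac{\sqrt n}{\sigma}\leq p-3$, then with probability at least $\frac12$ over the sample, for all $B\geq 0$, there is a choice of $\hat\beta^B\in\arg\min_{\|\beta\|_1\leq B}\sum_{i=1}^n\left(y^{(i)}-x^{(i)T}\beta\right)^2$ such that $$\mathbb{E}\left[\left(y-x^T\hat\beta^B\right)^2\right]\geq\sigma^2+\frac{\sigma}{409600\,\sqrt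 n\,\log^2\left(\max\left\{3n,\left\lceil\frac{\sqrt n}{\sigma}\right\rceil\right\}\right)}.$$ In both parts the expectation is taken over the new sample $(x,y)$ only, with the training sample (and hence $\hat\beta^B$) held fixed.
   Context: A vector is $2$-sparse if it has at most two nonzero entries; $\mathrm{Support}(\beta^* )=\{j:\beta^*_j\neq 0\}$; for an index set $J\subset\{1,\dots,p\}$, $\Sigma_J$ is the principal submatrix of $\Sigma$ with rows and columns indexed by $J$, and $\mathbf{I}_J$ is the identity matrix indexed by $J$. $\|\Sigma\|_{sp}$ is the spectral (operator) norm; $\|\cdot\|_1$ and $\|\cdot\|_2$ are the $\ell_1$ and Euclidean norms on $\mathbb{R}^p$; $\log$ is the natural logarithm and $\log^2(t)=(\log t)^2$. $N(0,\Sigma)$ is the (possibly degenerate) centered Gaussian distribution with covariance $\Sigma$. When $\sigma=0$, $N(m,0)$ is the point mass at $m$; the condition $100\leq\sqrt n/\sigma\leq p-3$ in part (b) is understood to include $\sigma>0$. The vector $\hat\beta^B$ is the $\ell_1$-regularized least-squares predictor with $\ell_1$-norm bound $B$. The minimizer need not be unique; when it is unique, the inequality is asserted for that minimizer, and when it is not unique, the inequality is asserted for some choice of minimizer (for each $B\ge 0$). The same pair $(\beta^*,\Sigma)$ serves for both parts. *)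

theory Defs
  imports "HOL-Probability.Probability"
begin

definition pos_semidef :: "real ^ 'p ^ 'p \<Rightarrow> bool" where
  "pos_semidef \<Sigma> \<longleftrightarrow> transpose \<Sigma> = \<Sigma> \<and> (\<forall>v. 0 \<le> v \<bullet> (\<Sigma> *v v))"

definition l1_norm :: "real ^ 'p \<Rightarrow> real" where
  "l1_norm \<beta> = (\<Sum>j\<in>UNIV. \<bar>\<beta> $ j\<bar>)"

definition Support :: "real ^ 'p \<Rightarrow> 'p set" where
  "Support \<beta> = {j. \<beta> $ j \<noteq> 0}"

(* The law N(m, s^2) of m + s * Z with Z standard normal; for s = 0 it is the point mass at m. *)
definition normal_measure :: "real \<Rightarrow> real \<Rightarrow> real measure" where
  "normal_measure m s = distr (density lborel std_normal_density) borel (\<lambda>z. m + s * z)"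

definition std_gaussian :: "(real ^ 'p) measure" where
  "std_gaussian = density lborel (\<lambda>z. ennreal (\<Prod>j\<in>UNIV. std_normal_density (z $ j)))"

(* The possibly degenerate law N(0, \<Sigma>), as the law of S Z with Z standard Gaussian and
   S S^T = \<Sigma>. Such an S exists for every positive semi-definite \<Sigma>, and the law
   does not depend on the choice of S, by the rotation invariance of std_gaussian. *)
definition centered_gaussian :: "real ^ 'p ^ 'p \<Rightarrow> (real ^ 'p) measure" where
  "centered_gaussian \<Sigma> =
     distr std_gaussian borel ((*v) (SOME S :: real ^ 'p ^ 'p. S ** transpose S = \<Sigma>))"

definition regression_measure ::
    "real ^ 'p ^ 'p \<Rightarrow> real ^ 'p \<Rightarrow> real \<Rightarrow> ((real ^ 'p) \<times> real) measure" where
  "regression_measure \<Sigma> \<beta> \<sigma> =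
     centered_gaussian \<Sigma> \<bind> (\<lambda>x. distr (normal_measure (x \<bullet> \<beta>) \<sigma>) borel (\<lambda>y. (x, y)))"

(* Topological support. For a Borel probability measure on a second countable space it is the
   smallest closed set of full measure, so what holds on it pointwise holds almost surely. *)
definition measure_support :: "'a::topological_space measure \<Rightarrow> 'a set" where
  "measure_support M = {z. \<forall>U. open U \<longrightarrow> z \<in> U \<longrightarrow> 0 < emeasure M U}"

definition rss :: "nat \<Rightarrow> (nat \<Rightarrow> (real ^ 'p) \<times> real) \<Rightarrow> real ^ 'p \<Rightarrow> real" where
  "rss n s \<beta> = (\<Sum>i<n. (snd (s i) - fst (s i) \<bullet> \<beta>)\<^sup>2)"

definition lasso_minimizers ::
    "nat \<Rightarrow> (nat \<Rightarrow> (real ^ 'p) \<times> real) \<Rightarrow> real \<Rightarrow> (real ^ 'p) set" where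
  "lasso_minimizers n s B = {\<beta>. is_arg_min (rss n s) (\<lambda>\<beta>. l1_norm \<beta> \<le> B) \<beta>}"

definition prediction_risk :: "((real ^ 'p) \<times> real) measure \<Rightarrow> real ^ 'p \<Rightarrow> real" where
  "prediction_risk D \<beta> = (\<integral>z. (snd z - fst z \<bullet> \<beta>)\<^sup>2 \<partial>D)"

end

theory Submission
  imports Defs
begin

text \<open>
  Why the theorem is true. The design lives on latent independent standard normal features \<open>x\<^sub>k\<close>,
  \<open>k \<in> U = {j1, j2} \<union> K\<close> with \<open>|K| = 3n - 3\<close>, together with one redundant feature, the composite
  \<open>x\<^sub>j\<^sub>3 = 7/10 (x\<^sub>j\<^sub>1 + x\<^sub>j\<^sub>2) - (\<Sum>k\<in>K. c\<^sub>k x\<^sub>k)\<close>; the true vector is \<open>1/2\<close> on \<open>j1\<close> and \<open>j2\<close>. With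
  \<open>\<Sum>c \<le> 2/5\<close>, one unit of the composite, corrected by \<open>c\<^sub>k\<close> units of each \<open>x\<^sub>k\<close>, costs at most \<open>7/5\<close>
  and replaces \<open>7/10\<close> units each of \<open>x\<^sub>j\<^sub>1\<close> and \<open>x\<^sub>j\<^sub>2\<close>, which cost \<open>7/5\<close> as well. So every
  predictor close to the truth can be rewritten, at no larger \<open>\<ell>\<^sub>1\<close> norm, with composite weight at
  least \<open>1/2\<close> (lemma \<open>shift_weight_to_composite\<close>), and then closeness forces each coefficient on \<open>K\<close>
  to be nearly \<open>c\<^sub>k/2\<close> or larger: it is spread over many small coordinates. The excess risk is
  the squared Euclidean error in the latent coordinates (lemma \<open>prediction_risk_eq\<close>).

  Part (a). Suppose that among all minimizers for the bound \<open>B\<close> one with the largest risk has latent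
  error below \<open>1/\<surd>(4608 n)\<close>. Since \<open>c\<^sub>k \<ge> 1/(10n)\<close>, its rewritten form has at least \<open>n + 2\<close> nonzero
  coefficients in \<open>K\<close>. There are only \<open>n\<close> samples, so some nonzero direction on these
  coordinates is invisible to all samples and keeps the \<open>\<ell>\<^sub>1\<close> norm under small steps. Small steps in both
  directions lead to minimizers, and by the parallelogram law one of them has larger risk: a
  contradiction (lemma \<open>extremal_minimizer_is_far\<close>). As \<open>ln (3n) \<ge> 4\<close>, an excess risk of
  \<open>1/(4608 n)\<close> is enough.

  Part (b). Put \<open>M = \<surd>n/\<sigma>\<close>. If \<open>M > 3n\<close>, the bound of part (a) is the stronger one, and samples lie in
  the support almost surely. Otherwise \<open>c\<close> carries a second scale: \<open>c\<^sub>k \<ge> 1/(10m)\<close> on a set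
  \<open>T \<subseteq> K\<close> of \<open>m \<approx> M\<close> coordinates. Suppose a minimizer has latent error below \<open>1/\<surd>(6000000 m)\<close>.
  Its rewritten form has weights of order \<open>1/m\<close> on most of \<open>T\<close>, so it can be moved freely
  there, and moving it along the correlations of the features in \<open>T\<close> with the noise, plus a small
  constant decrease that pays for the few coordinates that change sign, is feasible and
  lowers the training error by order \<open>n/m\<close>. Hence no minimizer is close to the truth
  (lemma \<open>minimizer_is_far_if_typical\<close>). The direction of the move depends only on the sample and not
  on the minimizer, so only six fixed statistics of the sample have to be controlled
  (definition \<open>typical\<close>) instead of an operator norm; their expectations are polynomial
  moments of Gaussians, and one application of Markov's inequality gives probability \<open>1/2\<close>
  (lemma \<open>typical_prob\<close>).
\<close>

section \<open>Linear functionals of Gaussian vectors\<close>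


abbreviation std_normal :: "real measure" where
  "std_normal \<equiv> density lborel std_normal_density"

lemma prob_space_std_normal: "prob_space std_normal"
  using real_dist_normal_dist real_distribution_def by blast

lemma real_distribution_normal: "real_distribution (normal_measure m s)"
  unfolding normal_measure_def
  by (rule prob_space.real_distribution_distr[OF prob_space_std_normal]) simp

lemma char_normal:
  "char (normal_measure 0 a) t = complex_of_real (exp (- (a * t)\<^sup>2 / 2))"
proof -
  have "char (normal_measure 0 a) t = char std_normal (a * t)"
    unfolding normal_measure_def char_def by (subst integral_distr) (auto simp: ac_simps)
  then show ?thesis by (simp add: char_std_normal_distribution)
qed

text \<open>
  Characteristic functions multiply. Unlike an argument with densities, this also covers
  degenerate summands, so no coefficient has to be nonzero.
\<close>
lemma distr_sum_normal:
  fixes f :: "'i \<Rightarrow> 'a \<Rightarrow> real"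
  assumes I: "finite I" and P: "\<And>i. prob_space (M i)"
    and f: "\<And>i. f i \<in> borel_measurable (M i)"
    and d: "\<And>i. i \<in> I \<Longrightarrow> distr (M i) borel (f i) = normal_measure 0 (a i)"
  shows "distr (Pi\<^sub>M I M) borel (\<lambda>x. \<Sum>i\<in>I. f i (x i)) = normal_measure 0 (sqrt (\<Sum>i\<in>I. (a i)\<^sup>2))"
proof (rule Levy_uniqueness)
  note f[measurable]
  interpret product_sigma_finite M
    using P by (auto simp: product_sigma_finite_def prob_space_imp_sigma_finite)
  interpret PP: prob_space "Pi\<^sub>M I M" by (rule prob_space_PiM) (rule P)
  show "real_distribution (distr (Pi\<^sub>M I M) borel (\<lambda>x. \<Sum>i\<in>I. f i (x i)))"
    by (rule PP.real_distribution_distr) measurable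
  show "real_distribution (normal_measure 0 (sqrt (\<Sum>i\<in>I. (a i)\<^sup>2)))"
    by (rule real_distribution_normal)
  show "char (distr (Pi\<^sub>M I M) borel (\<lambda>x. \<Sum>i\<in>I. f i (x i))) = char (normal_measure 0 (sqrt (\<Sum>i\<in>I. (a i)\<^sup>2)))"
  proof
    fix t
    have "char (distr (Pi\<^sub>M I M) borel (\<lambda>x. \<Sum>i\<in>I. f i (x i))) t
        = (\<integral>x. (\<Prod>i\<in>I. iexp (t * f i (x i))) \<partial>Pi\<^sub>M I M)"
      unfolding char_def
      by (subst integral_distr) (auto simp: sum_distrib_left exp_sum[OF I] intro!: Bochner_Integration.integral_cong)
    also have "\<dots> = (\<Prod>i\<in>I. \<integral>y. iexp (t * f i y) \<partial>M i)"
    proof (rule product_integral_prod[OF I])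
      fix i
      interpret prob_space "M i" by (rule P)
      show "integrable (M i) (\<lambda>y. iexp (t * f i y))"
        by (rule integrable_const_bound[of _ 1]) auto
    qed
    also have "\<dots> = (\<Prod>i\<in>I. char (normal_measure 0 (a i)) t)"
    proof (rule prod.cong)
      fix i assume "i \<in> I"
      then show "(\<integral>y. iexp (t * f i y) \<partial>M i) = char (normal_measure 0 (a i)) t"
        unfolding d[symmetric, OF \<open>i\<in>I\<close>] char_def by (subst integral_distr) auto
    qed simp
    also have "\<dots> = char (normal_measure 0 (sqrt (\<Sum>i\<in>I. (a i)\<^sup>2))) t"
      by (simp add: char_normal power_mult_distrib sum_nonneg sum_distrib_right sum_divide_distrib
          flip: exp_sum[OF I] of_real_prod sum_negf)
    finally show "char (distr (Pi\<^sub>M I M) borel (\<lambda>x. \<Sum>i\<in>I. f i (x i))) t = char (normal_measure 0 (sqrt (\<Sum>i\<in>I. (a i)\<^sup>2))) t" .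
  qed
qed

lemma measurable_vec_lambda:
  "(\<lambda>f::'p::finite\<Rightarrow>real. \<chi> j. f j) \<in> borel_measurable (Pi\<^sub>M UNIV (\<lambda>_. borel))"
  by (subst borel_measurable_euclidean_space) (auto simp: Basis_vec_def inner_axis)

lemma lborel_vec_eq_PiM:
  "(lborel :: (real^'p) measure) = distr (Pi\<^sub>M UNIV (\<lambda>_. lborel)) borel (\<lambda>f. \<chi> j. f j)"
proof (rule lborel_eqI)
  interpret product_sigma_finite "\<lambda>_::'p. lborel :: real measure"
    by (auto simp: product_sigma_finite_def sigma_finite_lborel)
  have mv: "(\<lambda>f::'p\<Rightarrow>real. \<chi> j. f j) \<in> borel_measurable (Pi\<^sub>M UNIV (\<lambda>_. lborel))"
    using measurable_vec_lambda by (simp cong: measurable_cong_sets sets_PiM_cong)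
  fix l u :: "real^'p"
  assume le: "\<And>b. b \<in> Basis \<Longrightarrow> l \<bullet> b \<le> u \<bullet> b"
  have le': "l $ j \<le> u $ j" for j
    using le[of "axis j 1"] by (simp add: inner_axis axis_in_Basis_iff)
  have inj: "inj (\<lambda>j::'p. axis j (1::real))" by (auto simp: inj_on_def axis_eq_axis)
  have B: "(Basis :: (real^'p) set) = range (\<lambda>j. axis j 1)" by (auto simp: Basis_vec_def)
  have "(\<lambda>f. \<chi> j. f j) -` box l u \<inter> space (Pi\<^sub>M UNIV (\<lambda>_::'p. lborel :: real measure))
      = (\<Pi>\<^sub>E j\<in>UNIV. {l $ j <..< u $ j})"
    by (auto simp: space_PiM PiE_def Pi_iff mem_box_cart)
  then show "emeasure (distr (Pi\<^sub>M UNIV (\<lambda>_. lborel)) borel (\<lambda>f. \<chi> j. f j)) (box l u) = (\<Prod>b\<in>Basis. (u - l) \<bullet> b)"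
    using le' unfolding B
    by (subst emeasure_distr[OF mv])
      (auto simp: emeasure_PiM prod.reindex[OF inj] inner_axis inner_diff_left prod_ennreal)
qed simp

lemma std_gaussian_eq_PiM:
  "(std_gaussian :: (real^'p) measure) =
     distr (Pi\<^sub>M UNIV (\<lambda>_. std_normal)) borel (\<lambda>f. \<chi> j. f j)"
proof -
  interpret N: product_sigma_finite "\<lambda>_::'p. std_normal"
    using prob_space_std_normal by (auto simp: product_sigma_finite_def prob_space_imp_sigma_finite)
  interpret L: product_sigma_finite "\<lambda>_::'p. lborel :: real measure"
    by (auto simp: product_sigma_finite_def sigma_finite_lborel)
  have mv: "(\<lambda>f::'p\<Rightarrow>real. \<chi> j. f j) \<in> borel_measurable (Pi\<^sub>M UNIV (\<lambda>_. lborel))"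
    using measurable_vec_lambda by (simp cong: measurable_cong_sets sets_PiM_cong)
  let ?F = "\<lambda>z::real^'p. ennreal (\<Prod>j\<in>UNIV. std_normal_density (z $ j))"
  have mF: "?F \<in> borel_measurable borel"
    by (intro measurable_compose[OF _ measurable_ennreal] borel_measurable_prod measurable_compose[OF _ borel_measurable_normal_density]) 
       (simp add: borel_measurable_continuous_onI continuous_on_component)
  have "std_gaussian = density (distr (Pi\<^sub>M UNIV (\<lambda>_. lborel)) borel (\<lambda>f. \<chi> j. f j)) ?F"
    unfolding std_gaussian_def by (subst lborel_vec_eq_PiM) simp
  also have "\<dots> = distr (density (Pi\<^sub>M UNIV (\<lambda>_. lborel)) (\<lambda>f. ?F (\<chi> j. f j))) borel (\<lambda>f. \<chi> j. f j)"
    by (rule density_distr[OF mF mv])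
  also have "density (Pi\<^sub>M UNIV (\<lambda>_. lborel)) (\<lambda>f. ?F (\<chi> j. f j)) = Pi\<^sub>M UNIV (\<lambda>_::'p. std_normal)"
  proof (rule N.PiM_eqI)
    fix A :: "'p \<Rightarrow> real set" assume A: "\<And>i. i \<in> UNIV \<Longrightarrow> A i \<in> sets std_normal"
    then have A'[measurable]: "\<And>i. A i \<in> sets borel" by auto
    have "emeasure (density (Pi\<^sub>M UNIV (\<lambda>_. lborel)) (\<lambda>f. ?F (\<chi> j. f j))) (Pi\<^sub>E UNIV A)
        = (\<integral>\<^sup>+ f. ?F (\<chi> j. f j) * indicator (Pi\<^sub>E UNIV A) f \<partial>Pi\<^sub>M UNIV (\<lambda>_. lborel))"
      using measurable_compose[OF mv mF] A' by (subst emeasure_density) (auto intro!: sets_PiM_I_finite)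
    also have "\<dots> = (\<integral>\<^sup>+ f. (\<Prod>j\<in>UNIV. ennreal (std_normal_density (f j)) * indicator (A j) (f j)) \<partial>Pi\<^sub>M UNIV (\<lambda>_. lborel))"
    proof (intro nn_integral_cong)
      fix f :: "'p \<Rightarrow> real"
      have "indicator (Pi\<^sub>E UNIV A) f = (\<Prod>j\<in>UNIV. indicator (A j) (f j) :: ennreal)"
      proof (cases "\<forall>j. f j \<in> A j")
        case False
        then obtain j where "f j \<notin> A j" by auto
        then show ?thesis by (auto simp: PiE_def Pi_iff indicator_def intro!: prod_zero[symmetric])
      qed (auto simp: PiE_def)
      then show "?F (\<chi> j. f j) * indicator (Pi\<^sub>E UNIV A) f
          = (\<Prod>j\<in>UNIV. ennreal (std_normal_density (f j)) * indicator (A j) (f j))"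
        by (simp add: prod.distrib prod_ennreal)
    qed
    also have "\<dots> = (\<Prod>j\<in>UNIV. \<integral>\<^sup>+ x. ennreal (std_normal_density x) * indicator (A j) x \<partial>lborel)"
      by (subst L.product_nn_integral_prod) auto
    also have "\<dots> = (\<Prod>i\<in>UNIV. emeasure std_normal (A i))"
      by (simp add: emeasure_density A')
    finally show "emeasure (density (Pi\<^sub>M UNIV (\<lambda>_. lborel)) (\<lambda>f. ?F (\<chi> j. f j))) (Pi\<^sub>E UNIV A)
        = (\<Prod>i\<in>UNIV. emeasure std_normal (A i))" .
  qed (auto cong: sets_PiM_cong)
  finally show ?thesis .
qed

lemma prob_space_std_gaussian: "prob_space (std_gaussian :: (real^'p) measure)"
  and sets_std_gaussian [simp, measurable_cong]: "sets (std_gaussian :: (real^'p) measure) = sets borel"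
proof -
  have mv: "(\<lambda>f::'p\<Rightarrow>real. \<chi> j. f j) \<in> borel_measurable (Pi\<^sub>M UNIV (\<lambda>_. std_normal))"
    using measurable_vec_lambda by (simp cong: measurable_cong_sets sets_PiM_cong)
  show "prob_space (std_gaussian :: (real^'p) measure)"
    unfolding std_gaussian_eq_PiM
    by (rule prob_space.prob_space_distr[OF prob_space_PiM mv]) (rule prob_space_std_normal)
qed (simp add: std_gaussian_def)

lemma distr_std_gaussian_inner:
  "distr (std_gaussian :: (real^'p) measure) borel (\<lambda>z. v \<bullet> z) = normal_measure 0 (norm v)"
proof -
  have mv: "(\<lambda>f::'p\<Rightarrow>real. \<chi> j. f j) \<in> borel_measurable (Pi\<^sub>M UNIV (\<lambda>_. std_normal))"
    using measurable_vec_lambda by (simp cong: measurable_cong_sets sets_PiM_cong)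
  have "distr (std_gaussian :: (real^'p) measure) borel (\<lambda>z. v \<bullet> z)
      = distr (Pi\<^sub>M UNIV (\<lambda>_. std_normal)) borel (\<lambda>f. \<Sum>j\<in>UNIV. v $ j * f j)"
    unfolding std_gaussian_eq_PiM
    by (subst distr_distr[OF _ mv]) (auto simp: comp_def inner_vec_def)
  also have "\<dots> = normal_measure 0 (sqrt (\<Sum>j\<in>UNIV. (v $ j)\<^sup>2))"
    by (rule distr_sum_normal[OF _ prob_space_std_normal]) (auto simp: normal_measure_def)
  finally show ?thesis by (simp add: norm_vec_def L2_set_def)
qed

lemma std_normal_moments:
  shows "integrable std_normal (\<lambda>z. z ^ k)"
    and "(\<integral>z. z \<partial>std_normal) = 0" and "(\<integral>z. z\<^sup>2 \<partial>std_normal) = 1"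
    and "(\<integral>z. z ^ 4 \<partial>std_normal) = 3" and "(\<integral>z. z ^ 6 \<partial>std_normal) = 15"
proof -
  show "integrable std_normal (\<lambda>z. z ^ k)"
    using integrable_std_normal_moment[of k] by (subst integrable_density) auto
  show "(\<integral>z. z \<partial>std_normal) = 0" 
    using integral_std_normal_moment_odd[of 0] by (subst integral_density) auto
  show "(\<integral>z. z\<^sup>2 \<partial>std_normal) = 1" 
    using integral_std_normal_moment_even[of 1] by (subst integral_density) auto
  show "(\<integral>z. z ^ 4 \<partial>std_normal) = 3" 
    using integral_std_normal_moment_even[of 2] by (subst integral_density) (auto simp: fact_numeral)
  show "(\<integral>z. z ^ 6 \<partial>std_normal) = 15" 
    using integral_std_normal_moment_even[of 3] by (subst integral_density) (auto simp: fact_numeral)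
qed

text \<open>
  All Gaussian estimates below reduce to the moments of order two, four and six of
  one-dimensional marginals.
\<close>
lemma moments_of_normal:
  assumes "X \<in> borel_measurable M" "distr M borel X = normal_measure 0 a"
  shows "integrable M (\<lambda>w. (X w) ^ k)"
    and "(\<integral>w. X w \<partial>M) = 0" and "(\<integral>w. (X w)\<^sup>2 \<partial>M) = a\<^sup>2"
    and "(\<integral>w. (X w) ^ 4 \<partial>M) = 3 * a ^ 4" and "(\<integral>w. (X w) ^ 6 \<partial>M) = 15 * a ^ 6"
proof -
  note assms(1)[measurable]
  have 1: "(\<integral>w. (X w) ^ k \<partial>M) = a ^ k * (\<integral>z. z ^ k \<partial>std_normal)" for k
  proof -
    have "(\<integral>w. (X w) ^ k \<partial>M) = (\<integral>x. x ^ k \<partial>distr M borel X)"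
      by (subst integral_distr) auto
    also have "\<dots> = (\<integral>z. (a * z) ^ k \<partial>std_normal)"
      unfolding assms(2) normal_measure_def by (subst integral_distr) auto
    finally show ?thesis by (simp add: power_mult_distrib del: integral_density)
  qed
  have "integrable (distr M borel X) (\<lambda>x. x ^ k)"
    unfolding assms(2) normal_measure_def using std_normal_moments(1)[of k]
    by (subst integrable_distr_eq) (auto simp: power_mult_distrib)
  then show "integrable M (\<lambda>w. (X w) ^ k)"
    by (subst (asm) integrable_distr_eq) auto
  show "(\<integral>w. X w \<partial>M) = 0" "(\<integral>w. (X w)\<^sup>2 \<partial>M) = a\<^sup>2"
    "(\<integral>w. (X w) ^ 4 \<partial>M) = 3 * a ^ 4" "(\<integral>w. (X w) ^ 6 \<partial>M) = 15 * a ^ 6"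
    using 1[of 1] 1[of 2] 1[of 4] 1[of 6] by (simp_all only: std_normal_moments power_one_right mult_1_right mult_zero_right mult.commute)
qed

section \<open>The regression distribution\<close>

lemma prob_space_centered_gaussian: "prob_space (centered_gaussian S :: (real^'p) measure)"
  and sets_centered_gaussian [simp, measurable_cong]: "sets (centered_gaussian S :: (real^'p) measure) = sets borel"
proof -
  have "(*v) A \<in> borel_measurable (std_gaussian :: (real^'p) measure)" for A :: "real^'p^'p"
    by (intro borel_measurable_continuous_onI[THEN measurable_cong_sets[THEN equalityD1, THEN subsetD, rotated 2]])
      (auto intro!: linear_continuous_on matrix_vector_mul_bounded_linear)
  then show "prob_space (centered_gaussian S :: (real^'p) measure)"
    unfolding centered_gaussian_def
    by (intro prob_space.prob_space_distr[OF prob_space_std_gaussian])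
qed (simp add: centered_gaussian_def)

text \<open>
  The law is built from an unspecified square root \<open>S\<close> of the covariance. The
  marginal in direction \<open>v\<close> sees only \<open>|S\<^sup>T v|\<^sup>2 = v \<bullet> S
  S\<^sup>T v\<close>, which does not depend on the choice of \<open>S\<close>.
\<close>
lemma distr_centered_gaussian_inner:
  fixes V :: "real^'p^'p"
  shows "distr (centered_gaussian (V ** transpose V)) borel (\<lambda>x. v \<bullet> x)
    = normal_measure 0 (norm (transpose V *v v))"
proof -
  define S where "S = (SOME S :: real^'p^'p. S ** transpose S = V ** transpose V)"
  have S: "S ** transpose S = V ** transpose V"
    unfolding S_def by (rule someI) simp
  have *: "(norm (transpose A *v v))\<^sup>2 = v \<bullet> ((A ** transpose A) *v v)" for A :: "real^'p^'p"
    by (metis dot_lmul_matrix inner_commute matrix_vector_mul_assoc power2_norm_eq_inner vector_transpose_matrix)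
  have "norm (transpose S *v v) = norm (transpose V *v v)"
    using *[of S] *[of V] S by (metis norm_ge_zero power2_eq_imp_eq)
  moreover have m: "(*v) S \<in> borel_measurable (std_gaussian :: (real^'p) measure)"
    by (intro borel_measurable_continuous_onI[THEN measurable_cong_sets[THEN equalityD1, THEN subsetD, rotated 2]])
      (auto intro!: linear_continuous_on matrix_vector_mul_bounded_linear)
  moreover have "v \<bullet> (S *v z) = (transpose S *v v) \<bullet> z" for z
    by (simp add: dot_lmul_matrix)
  ultimately show ?thesis
    unfolding centered_gaussian_def S_def[symmetric]
    by (subst distr_distr) (auto simp: comp_def distr_std_gaussian_inner)
qed

text \<open>
  A sample of \<open>n\<close> independent pairs is distributed as a sample of \<open>n\<close>
  first components zipped with an independent sample of \<open>n\<close> second components. This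
  lets design rows and noise be integrated one after the other. On boxes both sides factor over
  the coordinates.
\<close>
lemma distr_PiM_pair:
  assumes I: "finite I" and M: "prob_space M" and N: "prob_space N"
    and \<phi>[measurable]: "\<phi> \<in> M \<Otimes>\<^sub>M N \<rightarrow>\<^sub>M L"
  shows "distr (Pi\<^sub>M I (\<lambda>_. M) \<Otimes>\<^sub>M Pi\<^sub>M I (\<lambda>_. N)) (Pi\<^sub>M I (\<lambda>_. L)) (\<lambda>(X, Z). \<lambda>i\<in>I. \<phi> (X i, Z i))
     = Pi\<^sub>M I (\<lambda>_. distr (M \<Otimes>\<^sub>M N) L \<phi>)" (is "?P = _")
proof -
  interpret M: prob_space M by fact
  interpret N: prob_space N by fact
  interpret MN: pair_prob_space M N ..
  interpret D: prob_space "distr (M \<Otimes>\<^sub>M N) L \<phi>"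
    by (rule MN.prob_space_distr) simp
  interpret PM: product_sigma_finite "\<lambda>_. M"
    by (simp add: product_sigma_finite_def M.sigma_finite_measure_axioms)
  interpret PN: product_sigma_finite "\<lambda>_. N"
    by (simp add: product_sigma_finite_def N.sigma_finite_measure_axioms)
  interpret PD: product_sigma_finite "\<lambda>_. distr (M \<Otimes>\<^sub>M N) L \<phi>"
    by (simp add: product_sigma_finite_def D.sigma_finite_measure_axioms)
  interpret QN: prob_space "Pi\<^sub>M I (\<lambda>_. N)" by (rule prob_space_PiM) (rule N)
  have z: "(\<lambda>(X, Z). \<lambda>i\<in>I. \<phi> (X i, Z i)) \<in> Pi\<^sub>M I (\<lambda>_. M) \<Otimes>\<^sub>M Pi\<^sub>M I (\<lambda>_. N) \<rightarrow>\<^sub>M Pi\<^sub>M I (\<lambda>_. L)"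
    unfolding split_beta' by (intro measurable_restrict) measurable
  show ?thesis
  proof (rule PD.PiM_eqI[OF I])
    fix A assume "\<And>i. i \<in> I \<Longrightarrow> A i \<in> sets (distr (M \<Otimes>\<^sub>M N) L \<phi>)"
    then have A[measurable]: "\<And>i. i \<in> I \<Longrightarrow> A i \<in> sets L" by simp
    let ?g = "\<lambda>X Z. \<Prod>i\<in>I. indicator (A i) (\<phi> (X i, Z i)) :: ennreal"
    have "emeasure ?P (Pi\<^sub>E I A) = (\<integral>\<^sup>+ w. indicator (Pi\<^sub>E I A) w \<partial>?P)"
      using A I by (intro nn_integral_indicator[symmetric]) (auto intro!: sets_PiM_I_finite)
    also have "\<dots> = (\<integral>\<^sup>+ w. indicator (Pi\<^sub>E I A) (case w of (X, Z) \<Rightarrow> \<lambda>i\<in>I. \<phi> (X i, Z i))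
        \<partial>(Pi\<^sub>M I (\<lambda>_. M) \<Otimes>\<^sub>M Pi\<^sub>M I (\<lambda>_. N)))"
      using A I by (intro nn_integral_distr z borel_measurable_indicator) (auto intro!: sets_PiM_I_finite)
    also have "\<dots> = (\<integral>\<^sup>+ w. ?g (fst w) (snd w) \<partial>(Pi\<^sub>M I (\<lambda>_. M) \<Otimes>\<^sub>M Pi\<^sub>M I (\<lambda>_. N)))"
    proof (intro nn_integral_cong)
      fix w :: "('a \<Rightarrow> 'b) \<times> ('a \<Rightarrow> 'c)"
      show "indicator (Pi\<^sub>E I A) (case w of (X, Z) \<Rightarrow> \<lambda>i\<in>I. \<phi> (X i, Z i)) = ?g (fst w) (snd w)"
      proof (cases "\<forall>i\<in>I. \<phi> (fst w i, snd w i) \<in> A i")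
        case False
        then show ?thesis using I
          by (auto simp: split_beta' PiE_def Pi_iff indicator_def intro!: prod_zero[symmetric])
      qed (auto simp: split_beta' PiE_def Pi_iff)
    qed
    also have "\<dots> = (\<integral>\<^sup>+ X. \<integral>\<^sup>+ Z. ?g X Z \<partial>Pi\<^sub>M I (\<lambda>_. N) \<partial>Pi\<^sub>M I (\<lambda>_. M))"
      using A by (subst QN.nn_integral_fst[symmetric]) (auto simp: )
    also have "\<dots> = (\<integral>\<^sup>+ X. (\<Prod>i\<in>I. \<integral>\<^sup>+ z. indicator (A i) (\<phi> (X i, z)) \<partial>N) \<partial>Pi\<^sub>M I (\<lambda>_. M))"
    proof (intro nn_integral_cong)
      fix X assume X: "X \<in> space (Pi\<^sub>M I (\<lambda>_. M))"
      have "(\<lambda>z. indicator (A i) (\<phi> (X i, z)) :: ennreal) \<in> borel_measurable N" if "i \<in> I" for i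
      proof -
        have "X i \<in> space M" using X that by (auto simp: space_PiM)
        then show ?thesis using A[OF that] by measurable
      qed
      then show "(\<integral>\<^sup>+ Z. ?g X Z \<partial>Pi\<^sub>M I (\<lambda>_. N)) = (\<Prod>i\<in>I. \<integral>\<^sup>+ z. indicator (A i) (\<phi> (X i, z)) \<partial>N)"
        using PN.product_nn_integral_prod[OF I, of "\<lambda>i z. indicator (A i) (\<phi> (X i, z))"] by simp
    qed
    also have "\<dots> = (\<Prod>i\<in>I. \<integral>\<^sup>+ x. \<integral>\<^sup>+ z. indicator (A i) (\<phi> (x, z)) \<partial>N \<partial>M)"
      using A by (intro PM.product_nn_integral_prod[OF I]) measurable
    also have "\<dots> = (\<Prod>i\<in>I. emeasure (distr (M \<Otimes>\<^sub>M N) L \<phi>) (A i))"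
    proof (rule prod.cong)
      fix i assume [simp]: "i \<in> I"
      have "(\<integral>\<^sup>+ x. \<integral>\<^sup>+ z. indicator (A i) (\<phi> (x, z)) \<partial>N \<partial>M) = (\<integral>\<^sup>+ w. indicator (A i) (\<phi> w) \<partial>(M \<Otimes>\<^sub>M N))"
        using A by (subst N.nn_integral_fst) auto
      also have "\<dots> = (\<integral>\<^sup>+ w. indicator (A i) w \<partial>distr (M \<Otimes>\<^sub>M N) L \<phi>)"
        using A by (subst nn_integral_distr) auto
      finally show "(\<integral>\<^sup>+ x. \<integral>\<^sup>+ z. indicator (A i) (\<phi> (x, z)) \<partial>N \<partial>M) = emeasure (distr (M \<Otimes>\<^sub>M N) L \<phi>) (A i)"
        using A by (subst (asm) nn_integral_indicator) auto
    qed simp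
    finally show "emeasure ?P (Pi\<^sub>E I A) = (\<Prod>i\<in>I. emeasure (distr (M \<Otimes>\<^sub>M N) L \<phi>) (A i))" .
  qed (auto cong: sets_PiM_cong)
qed

lemma regression_measure_eq_distr:
  fixes \<beta> :: "real^'p"
  shows "regression_measure \<Sigma> \<beta> \<sigma> =
    distr (centered_gaussian \<Sigma> \<Otimes>\<^sub>M std_normal) borel (\<lambda>(x, z). (x, x \<bullet> \<beta> + \<sigma> * z))"
proof (rule measure_eqI)
  interpret G: prob_space "centered_gaussian \<Sigma> :: (real^'p) measure" by (rule prob_space_centered_gaussian)
  interpret N: prob_space std_normal by (rule prob_space_std_normal)
  have m: "(\<lambda>(x, z). (x, x \<bullet> \<beta> + \<sigma> * z)) \<in> borel_measurable (centered_gaussian \<Sigma> \<Otimes>\<^sub>M std_normal)"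
    unfolding borel_prod[symmetric] by measurable
  have eq: "distr (normal_measure (x \<bullet> \<beta>) \<sigma>) borel (\<lambda>y. (x, y)) = distr std_normal borel (\<lambda>z. (x, x \<bullet> \<beta> + \<sigma> * z))" for x
    unfolding normal_measure_def borel_prod[symmetric] by (subst distr_distr) (auto simp: comp_def)
  have k: "(\<lambda>x. distr (normal_measure (x \<bullet> \<beta>) \<sigma>) borel (\<lambda>y. (x, y))) \<in> centered_gaussian \<Sigma> \<rightarrow>\<^sub>M subprob_algebra borel"
    unfolding eq using m
    by (intro measurable_distr2 measurable_const) (auto simp: space_subprob_algebra N.subprob_space_axioms)
  show "sets (regression_measure \<Sigma> \<beta> \<sigma>) = sets (distr (centered_gaussian \<Sigma> \<Otimes>\<^sub>M std_normal) borel (\<lambda>(x, z). (x, x \<bullet> \<beta> + \<sigma> * z)))"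
    unfolding regression_measure_def using k G.not_empty by (subst sets_bind[where N=borel]) auto
  fix A assume "A \<in> sets (regression_measure \<Sigma> \<beta> \<sigma>)"
  then have A[measurable]: "A \<in> sets borel"
    unfolding regression_measure_def using k G.not_empty by (subst (asm) sets_bind[where N=borel]) auto
  have "emeasure (regression_measure \<Sigma> \<beta> \<sigma>) A = (\<integral>\<^sup>+ x. emeasure (distr std_normal borel (\<lambda>z. (x, x \<bullet> \<beta> + \<sigma> * z))) A \<partial>centered_gaussian \<Sigma>)"
    unfolding regression_measure_def using k G.not_empty A by (subst emeasure_bind[where N=borel]) (auto simp: eq)
  also have "\<dots> = (\<integral>\<^sup>+ x. \<integral>\<^sup>+ z. indicator A (x, x \<bullet> \<beta> + \<sigma> * z) \<partial>std_normal \<partial>centered_gaussian \<Sigma>)"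
  proof (intro nn_integral_cong)
    fix x :: "real^'p"
    have mx: "(\<lambda>z. (x, x \<bullet> \<beta> + \<sigma> * z)) \<in> borel_measurable std_normal"
      unfolding borel_prod[symmetric] by measurable
    show "emeasure (distr std_normal borel (\<lambda>z. (x, x \<bullet> \<beta> + \<sigma> * z))) A = (\<integral>\<^sup>+ z. indicator A (x, x \<bullet> \<beta> + \<sigma> * z) \<partial>std_normal)"
      using mx A by (subst nn_integral_indicator[symmetric]) (auto simp: nn_integral_distr simp del: nn_integral_indicator)
  qed
  also have "\<dots> = (\<integral>\<^sup>+ w. indicator A (case w of (x, z) \<Rightarrow> (x, x \<bullet> \<beta> + \<sigma> * z)) \<partial>(centered_gaussian \<Sigma> \<Otimes>\<^sub>M std_normal))"
    using measurable_compose[OF m borel_measurable_indicator[OF A]]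
    by (subst N.nn_integral_fst[symmetric]) (auto simp: split_beta')
  also have "\<dots> = emeasure (distr (centered_gaussian \<Sigma> \<Otimes>\<^sub>M std_normal) borel (\<lambda>(x, z). (x, x \<bullet> \<beta> + \<sigma> * z))) A"
  proof -
    have "emeasure (distr (centered_gaussian \<Sigma> \<Otimes>\<^sub>M std_normal) borel (\<lambda>(x, z). (x, x \<bullet> \<beta> + \<sigma> * z))) A
      = (\<integral>\<^sup>+ w. indicator A w \<partial>distr (centered_gaussian \<Sigma> \<Otimes>\<^sub>M std_normal) borel (\<lambda>(x, z). (x, x \<bullet> \<beta> + \<sigma> * z)))"
      using A by (intro nn_integral_indicator[symmetric]) auto
    also have "\<dots> = (\<integral>\<^sup>+ w. indicator A (case w of (x, z) \<Rightarrow> (x, x \<bullet> \<beta> + \<sigma> * z)) \<partial>(centered_gaussian \<Sigma> \<Otimes>\<^sub>M std_normal))"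
      using A by (intro nn_integral_distr[OF m]) auto
    finally show ?thesis ..
  qed
  finally show "emeasure (regression_measure \<Sigma> \<beta> \<sigma>) A = emeasure (distr (centered_gaussian \<Sigma> \<Otimes>\<^sub>M std_normal) borel (\<lambda>(x, z). (x, x \<bullet> \<beta> + \<sigma> * z))) A" .
qed

text \<open>
  The residual at a fresh point is \<open>\<sigma> z\<close> minus an independent centered
  normal variable, and the variances add.
\<close>
lemma prediction_risk_eq:
  fixes V :: "real^'p^'p"
  shows "prediction_risk (regression_measure (V ** transpose V) \<beta>s \<sigma>) \<beta>
     = \<sigma>\<^sup>2 + (norm (transpose V *v (\<beta> - \<beta>s)))\<^sup>2"
proof -
  let ?G = "centered_gaussian (V ** transpose V)"
  interpret G: prob_space ?G by (rule prob_space_centered_gaussian)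
  interpret N: prob_space std_normal by (rule prob_space_std_normal)
  interpret P: pair_prob_space ?G std_normal ..
  have m: "(\<lambda>(x, z). (x, x \<bullet> \<beta>s + \<sigma> * z)) \<in> borel_measurable (?G \<Otimes>\<^sub>M std_normal)"
    unfolding borel_prod[symmetric] by measurable
  let ?v = "\<beta> - \<beta>s"
  have m2: "(\<lambda>z. (snd z - fst z \<bullet> \<beta>)\<^sup>2) \<in> borel_measurable (borel :: ((real^'p)\<times>real) measure)"
    by (intro borel_measurable_continuous_onI continuous_intros)
  have X: "integrable ?G (\<lambda>x. (?v \<bullet> x)\<^sup>2)" "(\<integral>x. (?v \<bullet> x)\<^sup>2 \<partial>?G) = (norm (transpose V *v ?v))\<^sup>2"
    using moments_of_normal[OF _ distr_centered_gaussian_inner[of V ?v]] by auto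
  have Z: "(\<integral>\<^sup>+ z. ennreal ((\<sigma> * z - c)\<^sup>2) \<partial>std_normal) = ennreal (\<sigma>\<^sup>2 + c\<^sup>2)" for c
  proof -
    have i: "integrable std_normal (\<lambda>z. z)" "integrable std_normal (\<lambda>z. z\<^sup>2)"
      using std_normal_moments(1)[of 1] std_normal_moments(1)[of 2] by auto
    have e: "(\<sigma> * z - c)\<^sup>2 = \<sigma>\<^sup>2 * z\<^sup>2 - 2 * \<sigma> * c * z + c\<^sup>2" for z
      by (simp add: power2_eq_square algebra_simps)
    have i2: "integrable std_normal (\<lambda>z. (\<sigma> * z - c)\<^sup>2)"
      unfolding e using i by (intro Bochner_Integration.integrable_add Bochner_Integration.integrable_diff integrable_mult_right N.integrable_const)
    have "(\<integral>z. (\<sigma> * z - c)\<^sup>2 \<partial>std_normal) = \<sigma>\<^sup>2 * (\<integral>z. z\<^sup>2 \<partial>std_normal) - 2 * \<sigma> * c * (\<integral>z. z \<partial>std_normal) + c\<^sup>2"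
      unfolding e using i N.prob_space by (simp del: integral_density)
    then show ?thesis
      using i2 by (subst nn_integral_eq_integral) (auto simp: std_normal_moments)
  qed
  have "(\<integral>\<^sup>+ z. ennreal ((snd z - fst z \<bullet> \<beta>)\<^sup>2) \<partial>regression_measure (V ** transpose V) \<beta>s \<sigma>)
      = (\<integral>\<^sup>+ w. ennreal ((\<sigma> * snd w - ?v \<bullet> fst w)\<^sup>2) \<partial>(?G \<Otimes>\<^sub>M std_normal))"
    unfolding regression_measure_eq_distr
    by (subst nn_integral_distr[OF m]) (use m2 in \<open>auto simp: split_beta' inner_diff_left inner_commute algebra_simps intro!: nn_integral_cong\<close>)
  also have "\<dots> = (\<integral>\<^sup>+ x. \<integral>\<^sup>+ z. ennreal ((\<sigma> * z - ?v \<bullet> x)\<^sup>2) \<partial>std_normal \<partial>?G)"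
    by (subst N.nn_integral_fst[symmetric]) auto
  also have "\<dots> = (\<integral>\<^sup>+ x. ennreal (\<sigma>\<^sup>2 + (?v \<bullet> x)\<^sup>2) \<partial>?G)"
    by (simp add: Z)
  also have "\<dots> = ennreal (\<sigma>\<^sup>2 + (norm (transpose V *v ?v))\<^sup>2)"
    using X G.prob_space by (subst nn_integral_eq_integral) auto
  finally have "(\<integral>\<^sup>+ z. ennreal ((snd z - fst z \<bullet> \<beta>)\<^sup>2) \<partial>regression_measure (V ** transpose V) \<beta>s \<sigma>)
      = ennreal (\<sigma>\<^sup>2 + (norm (transpose V *v ?v))\<^sup>2)" .
  then show ?thesis
    unfolding prediction_risk_def using m2
    by (subst integral_eq_nn_integral) (auto simp: regression_measure_eq_distr simp del: ennreal_plus)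
qed

lemma AE_centered_gaussian_null:
  fixes V :: "real^'p^'p"
  assumes "transpose V *v \<nu> = 0"
  shows "AE x in centered_gaussian (V ** transpose V). \<nu> \<bullet> x = 0"
proof -
  have "AE y in normal_measure 0 0. y = 0"
    unfolding normal_measure_def by (subst AE_distr_iff) auto
  then have "AE y in distr (centered_gaussian (V ** transpose V)) borel (\<lambda>x. \<nu> \<bullet> x). y = 0"
    unfolding distr_centered_gaussian_inner assms norm_zero .
  then show ?thesis
    by (subst (asm) AE_distr_iff) auto
qed

lemma emeasure_regression_null:
  fixes V :: "real^'p^'p"
  assumes "transpose V *v \<nu> = 0"
  shows "emeasure (regression_measure (V ** transpose V) \<beta>s \<sigma>) {z. \<nu> \<bullet> fst z \<noteq> 0} = 0"
proof -
  let ?G = "centered_gaussian (V ** transpose V)"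
  interpret N: prob_space std_normal by (rule prob_space_std_normal)
  let ?U = "{z :: (real^'p) \<times> real. \<nu> \<bullet> fst z \<noteq> 0}"
  have U: "open ?U"
    by (intro open_Collect_neq continuous_intros)
  have m: "(\<lambda>(x, z). (x, x \<bullet> \<beta>s + \<sigma> * z)) \<in> borel_measurable (?G \<Otimes>\<^sub>M std_normal)"
    unfolding borel_prod[symmetric] by measurable
  have "emeasure (regression_measure (V ** transpose V) \<beta>s \<sigma>) ?U
      = (\<integral>\<^sup>+ w. indicator ?U w \<partial>(regression_measure (V ** transpose V) \<beta>s \<sigma>))"
    using U by (intro nn_integral_indicator[symmetric]) (auto simp: regression_measure_eq_distr)
  also have "\<dots> = (\<integral>\<^sup>+ w. indicator ?U (case w of (x, z) \<Rightarrow> (x, x \<bullet> \<beta>s + \<sigma> * z)) \<partial>(?G \<Otimes>\<^sub>M std_normal))"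
    unfolding regression_measure_eq_distr using U
    by (intro nn_integral_distr[OF m]) auto
  also have "\<dots> = (\<integral>\<^sup>+ w. indicator {x. \<nu> \<bullet> x \<noteq> 0} (fst w) \<partial>(?G \<Otimes>\<^sub>M std_normal))"
    by (intro nn_integral_cong) (auto simp: indicator_def)
  also have "\<dots> = (\<integral>\<^sup>+ x. indicator {x. \<nu> \<bullet> x \<noteq> 0} x \<partial>?G)"
    by (subst N.nn_integral_fst[symmetric]) (use N.emeasure_space_1 in auto)
  also have "\<dots> = 0"
    using AE_centered_gaussian_null[OF assms(1)] by (subst nn_integral_0_iff_AE) auto
  finally show ?thesis .
qed

lemma sets_regression_measure [simp, measurable_cong]: "sets (regression_measure \<Sigma> \<beta>s \<sigma>) = sets borel"
  by (simp add: regression_measure_eq_distr)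

lemma prob_space_regression: "prob_space (regression_measure \<Sigma> \<beta>s \<sigma> :: ((real^'p) \<times> real) measure)"
proof -
  interpret G: prob_space "centered_gaussian \<Sigma> :: (real^'p) measure" by (rule prob_space_centered_gaussian)
  interpret N: prob_space std_normal by (rule prob_space_std_normal)
  interpret GN: pair_prob_space "centered_gaussian \<Sigma> :: (real^'p) measure" std_normal ..
  show ?thesis
    unfolding regression_measure_eq_distr
    by (rule GN.prob_space_distr) (unfold borel_prod[symmetric], measurable)
qed

lemma AE_regression_null:
  fixes V :: "real^'p^'p"
  assumes "transpose V *v \<nu> = 0"
  shows "AE z in regression_measure (V ** transpose V) \<beta>s \<sigma>. \<nu> \<bullet> fst z = 0"
proof (rule AE_I)
  have "space (regression_measure (V ** transpose V) \<beta>s \<sigma>) = UNIV"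
    using sets_eq_imp_space_eq[OF sets_regression_measure] by simp
  then show "{z \<in> space (regression_measure (V ** transpose V) \<beta>s \<sigma>). \<not> \<nu> \<bullet> fst z = 0} \<subseteq> {z. \<nu> \<bullet> fst z \<noteq> 0}"
    by auto
  show "{z. \<nu> \<bullet> fst z \<noteq> 0} \<in> sets (regression_measure (V ** transpose V) \<beta>s \<sigma>)"
    by (simp, intro borel_open open_Collect_neq continuous_intros)
qed (rule emeasure_regression_null[OF assms])

text \<open>
  A linear relation that holds almost surely holds on the whole support, because its failure is
  an open event.
\<close>
lemma measure_support_regression:
  fixes V :: "real^'p^'p"
  assumes "transpose V *v \<nu> = 0" "z \<in> measure_support (regression_measure (V ** transpose V) \<beta>s \<sigma>)"
  shows "\<nu> \<bullet> fst z = 0"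
proof (rule ccontr)
  assume z: "\<nu> \<bullet> fst z \<noteq> 0"
  have "open {z :: (real^'p) \<times> real. \<nu> \<bullet> fst z \<noteq> 0}"
    by (intro open_Collect_neq continuous_intros)
  then show False
    using assms(2) z emeasure_regression_null[OF assms(1), of \<beta>s \<sigma>] by (auto simp: measure_support_def)
qed

section \<open>Second moments of sums of independent variables\<close>

lemma integrable_of_square:
  fixes f :: "'a \<Rightarrow> real"
  assumes "prob_space M" "f \<in> borel_measurable M" "integrable M (\<lambda>x. (f x)\<^sup>2)"
  shows "integrable M f"
proof -
  interpret prob_space M by fact
  show ?thesis
  proof (rule Bochner_Integration.integrable_bound)
    show "integrable M (\<lambda>x. 1 + (f x)\<^sup>2)" using assms by auto
    show "AE x in M. norm (f x) \<le> norm (1 + (f x)\<^sup>2)"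
    proof (rule AE_I2)
      fix x
      have "0 \<le> (\<bar>f x\<bar> - 1)\<^sup>2" by simp
      then have "2 * \<bar>f x\<bar> \<le> 1 + (f x)\<^sup>2" by (simp add: power2_eq_square algebra_simps)
      then show "norm (f x) \<le> norm (1 + (f x)\<^sup>2)" by simp
    qed
  qed (use assms in auto)
qed

text \<open>
  The summands are independent, so the off-diagonal terms of the expanded square factor.
\<close>
lemma second_moment_sum:
  fixes f :: "'i \<Rightarrow> 'a \<Rightarrow> real"
  assumes I: "finite I" and M: "prob_space M"
    and m[measurable]: "\<And>i. f i \<in> borel_measurable M"
    and sq: "\<And>i. integrable M (\<lambda>x. (f i x)\<^sup>2)"
  shows "integrable (Pi\<^sub>M I (\<lambda>_. M)) (\<lambda>x. (\<Sum>i\<in>I. f i (x i))\<^sup>2)"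
    and "(\<integral>x. (\<Sum>i\<in>I. f i (x i))\<^sup>2 \<partial>Pi\<^sub>M I (\<lambda>_. M))
      = (\<Sum>i\<in>I. (\<integral>x. (f i x)\<^sup>2 \<partial>M) - (\<integral>x. f i x \<partial>M)\<^sup>2) + (\<Sum>i\<in>I. \<integral>x. f i x \<partial>M)\<^sup>2"
proof -
  interpret M: prob_space M by fact
  interpret product_sigma_finite "\<lambda>_. M"
    by (simp add: product_sigma_finite_def M.sigma_finite_measure_axioms)
  have f1: "integrable M (f i)" for i using integrable_of_square[OF M m sq] .
  \<comment> \<open>each product of two summands is written as a product over all indices, to which independence applies\<close>
  define h where "h i j k = (\<lambda>x. (if k = i then f i x else 1) * (if k = j then f j x else 1))" for i j k
  have hI: "integrable M (h i j k)" for i j k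
    unfolding h_def using f1 sq by (cases "k = i"; cases "k = j") (auto simp: power2_eq_square)
  have hp: "f i (x i) * f j (x j) = (\<Prod>k\<in>I. h i j k (x k))" if "i \<in> I" "j \<in> I" for i j x
  proof -
    have "(\<Prod>k\<in>I. h i j k (x k)) = (\<Prod>k\<in>I. if k = i then f i (x k) else 1) * (\<Prod>k\<in>I. if k = j then f j (x k) else 1)"
      by (simp add: h_def prod.distrib)
    then show ?thesis using that I by (simp add: prod.delta')
  qed
  have int: "integrable (Pi\<^sub>M I (\<lambda>_. M)) (\<lambda>x. f i (x i) * f j (x j))" if "i \<in> I" "j \<in> I" for i j
    unfolding hp[OF that] by (rule product_integrable_prod[OF I]) (rule hI)
  have ev: "(\<integral>x. f i (x i) * f j (x j) \<partial>Pi\<^sub>M I (\<lambda>_. M))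
      = (if i = j then (\<integral>x. (f i x)\<^sup>2 \<partial>M) - (\<integral>x. f i x \<partial>M)\<^sup>2 else 0) + (\<integral>x. f i x \<partial>M) * (\<integral>x. f j x \<partial>M)"
    if "i \<in> I" "j \<in> I" for i j
  proof -
    have "(\<integral>x. f i (x i) * f j (x j) \<partial>Pi\<^sub>M I (\<lambda>_. M)) = (\<Prod>k\<in>I. integral\<^sup>L M (h i j k))"
      unfolding hp[OF that] by (rule product_integral_prod[OF I]) (rule hI)
    also have "\<dots> = (if i = j then (\<integral>x. (f i x)\<^sup>2 \<partial>M) else (\<integral>x. f i x \<partial>M) * (\<integral>x. f j x \<partial>M))"
    proof (cases "i = j")
      case True
      have "(\<Prod>k\<in>I. integral\<^sup>L M (h i j k)) = (\<Prod>k\<in>I. if k = i then \<integral>x. (f i x)\<^sup>2 \<partial>M else 1)"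
        using True by (intro prod.cong) (auto simp: h_def power2_eq_square M.prob_space)
      then show ?thesis using True that I by (simp add: prod.delta')
    next
      case False
      have "(\<Prod>k\<in>I. integral\<^sup>L M (h i j k))
          = (\<Prod>k\<in>I. (if k = i then \<integral>x. f i x \<partial>M else 1) * (if k = j then \<integral>x. f j x \<partial>M else 1))"
        using False by (intro prod.cong) (auto simp: h_def M.prob_space)
      then show ?thesis using False that I by (simp add: prod.distrib prod.delta')
    qed
    finally show ?thesis by (simp add: power2_eq_square)
  qed
  have e: "(\<Sum>i\<in>I. f i (x i))\<^sup>2 = (\<Sum>i\<in>I. \<Sum>j\<in>I. f i (x i) * f j (x j))" for x
    by (simp add: power2_eq_square sum_product)
  show "integrable (Pi\<^sub>M I (\<lambda>_. M)) (\<lambda>x. (\<Sum>i\<in>I. f i (x i))\<^sup>2)"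
    unfolding e using int by auto
  show "(\<integral>x. (\<Sum>i\<in>I. f i (x i))\<^sup>2 \<partial>Pi\<^sub>M I (\<lambda>_. M))
      = (\<Sum>i\<in>I. (\<integral>x. (f i x)\<^sup>2 \<partial>M) - (\<integral>x. f i x \<partial>M)\<^sup>2) + (\<Sum>i\<in>I. \<integral>x. f i x \<partial>M)\<^sup>2"
  proof -
    have "(\<integral>x. (\<Sum>i\<in>I. f i (x i))\<^sup>2 \<partial>Pi\<^sub>M I (\<lambda>_. M))
       = (\<Sum>i\<in>I. \<Sum>j\<in>I. \<integral>x. f i (x i) * f j (x j) \<partial>Pi\<^sub>M I (\<lambda>_. M))"
      unfolding e using int by (simp add: Bochner_Integration.integral_sum)
    then show ?thesis
      using I by (simp add: ev sum.distrib power2_eq_square sum_product)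
  qed
qed

lemma nn_integral_le_of_integral:
  assumes "integrable M f" "\<And>x. 0 \<le> f x" "(\<integral>x. f x \<partial>M) \<le> b"
  shows "(\<integral>\<^sup>+ x. ennreal (f x) \<partial>M) \<le> ennreal b"
  using assms by (subst nn_integral_eq_integral) (auto intro!: ennreal_leI)

text \<open>
  The index set may be smaller than \<open>n\<close>: the lemma is applied after one sample has
  been frozen.
\<close>
lemma nn_second_moment_sum_le:
  fixes f :: "'a \<Rightarrow> real"
  assumes I: "finite I" "card I \<le> n" and M: "prob_space M"
    and m: "f \<in> borel_measurable M"
    and sq: "integrable M (\<lambda>x. (f x)\<^sup>2)"
    and b: "(\<integral>x. (f x)\<^sup>2 \<partial>M) \<le> v" "(\<integral>x. f x \<partial>M)\<^sup>2 \<le> u"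
  shows "(\<integral>\<^sup>+ x. ennreal ((\<Sum>i\<in>I. f (x i))\<^sup>2) \<partial>Pi\<^sub>M I (\<lambda>_. M)) \<le> ennreal (real n * v + (real n)\<^sup>2 * u)"
proof (rule nn_integral_le_of_integral)
  note s = second_moment_sum[of I M "\<lambda>_. f", OF I(1) M m sq]
  show "integrable (Pi\<^sub>M I (\<lambda>_. M)) (\<lambda>x. (\<Sum>i\<in>I. f (x i))\<^sup>2)" by (rule s)
  have "0 \<le> v" using b(1) by (meson Bochner_Integration.integral_nonneg order_trans zero_le_power2)
  have "real (card I) * ((\<integral>x. (f x)\<^sup>2 \<partial>M) - (\<integral>x. f x \<partial>M)\<^sup>2) \<le> real (card I) * v"
    using b by (intro mult_left_mono) (auto intro: order_trans[OF _ b(1)])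
  also have "\<dots> \<le> real n * v" using I(2) \<open>0 \<le> v\<close> by (intro mult_right_mono) auto
  finally have 1: "real (card I) * ((\<integral>x. (f x)\<^sup>2 \<partial>M) - (\<integral>x. f x \<partial>M)\<^sup>2) \<le> real n * v" .
  have 2: "(real (card I))\<^sup>2 * (\<integral>x. f x \<partial>M)\<^sup>2 \<le> (real n)\<^sup>2 * u"
    using I(2) b(2) by (intro mult_mono power_mono) auto
  show "(\<integral>x. (\<Sum>i\<in>I. f (x i))\<^sup>2 \<partial>Pi\<^sub>M I (\<lambda>_. M)) \<le> real n * v + (real n)\<^sup>2 * u"
    unfolding s(2) using 1 2 by (simp add: power_mult_distrib)
qed auto

text \<open>
  Polarization: \<open>12 A\<^sup>2 B\<^sup>2 = (A + B)\<^sup>4 + (A - B)\<^sup>4 - 2 A\<^sup>4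
  - 2 B\<^sup>4\<close>. The mixed moment thus follows from one-dimensional laws, without a
  joint density.
\<close>
lemma normal_pair_moments:
  assumes P: "prob_space M" and A: "A \<in> borel_measurable M" "distr M borel A = normal_measure 0 a"
    and B: "B \<in> borel_measurable M" "distr M borel B = normal_measure 0 a"
    and p: "distr M borel (\<lambda>x. A x + B x) = normal_measure 0 (sqrt 2 * a)"
    and q: "distr M borel (\<lambda>x. A x - B x) = normal_measure 0 (sqrt 2 * a)"
  shows "integrable M (\<lambda>x. (A x)\<^sup>2 * (B x)\<^sup>2)" "(\<integral>x. (A x)\<^sup>2 * (B x)\<^sup>2 \<partial>M) = a ^ 4"
proof -
  note A(1)[measurable] B(1)[measurable]
  have e: "(A x)\<^sup>2 * (B x)\<^sup>2 = ((A x + B x) ^ 4 + (A x - B x) ^ 4 - 2 * (A x) ^ 4 - 2 * (B x) ^ 4) / 12" for x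
    by (simp add: power4_eq_xxxx power2_eq_square algebra_simps)
  note i = moments_of_normal(1)[OF _ A(2), of 4] moments_of_normal(1)[OF _ B(2), of 4] 
    moments_of_normal(1)[OF _ p, of 4] moments_of_normal(1)[OF _ q, of 4]
  note v = moments_of_normal(4)[OF _ A(2)] moments_of_normal(4)[OF _ B(2)] 
    moments_of_normal(4)[OF _ p] moments_of_normal(4)[OF _ q]
  have s: "(sqrt 2 * a) ^ 4 = 4 * a ^ 4"
    by (simp add: power_mult_distrib) (simp add: power4_eq_xxxx)
  show "integrable M (\<lambda>x. (A x)\<^sup>2 * (B x)\<^sup>2)"
    unfolding e using i by simp
  show "(\<integral>x. (A x)\<^sup>2 * (B x)\<^sup>2 \<partial>M) = a ^ 4"
    unfolding e using i by (simp add: v s)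
qed

text \<open>
  Freezing the sample \<open>j\<close> turns expressions in which it meets all the others into
  sums of independent terms.
\<close>
lemma nn_integral_PiM_single_out:
  assumes I: "finite I" "j \<in> I" and M: "prob_space M"
    and f: "f \<in> borel_measurable (Pi\<^sub>M I (\<lambda>_. M))"
  shows "(\<integral>\<^sup>+ x. f x \<partial>Pi\<^sub>M I (\<lambda>_. M)) = (\<integral>\<^sup>+ y. \<integral>\<^sup>+ x. f (x(j := y)) \<partial>Pi\<^sub>M (I - {j}) (\<lambda>_. M) \<partial>M)"
proof -
  interpret M: prob_space M by fact
  interpret product_sigma_finite "\<lambda>_. M"
    by (simp add: product_sigma_finite_def M.sigma_finite_measure_axioms)
  have "I = insert j (I - {j})" using I by auto
  then show ?thesis
    using product_nn_integral_insert_rev[of "I - {j}" j f] f I by simp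
qed

lemma nn_integral_PiM_component:
  assumes I: "j \<in> I" and M: "prob_space M" and f: "f \<in> borel_measurable M"
  shows "(\<integral>\<^sup>+ x. f (x j) \<partial>Pi\<^sub>M I (\<lambda>_. M)) = (\<integral>\<^sup>+ y. f y \<partial>M)"
proof -
  have "(\<integral>\<^sup>+ y. f y \<partial>M) = (\<integral>\<^sup>+ y. f y \<partial>distr (Pi\<^sub>M I (\<lambda>_. M)) M (\<lambda>x. x j))"
    by (subst distr_PiM_component[OF M I]) simp
  also have "\<dots> = (\<integral>\<^sup>+ x. f (x j) \<partial>Pi\<^sub>M I (\<lambda>_. M))"
    using I f by (subst nn_integral_distr) auto
  finally show ?thesis ..
qed

lemma nn_integral_noise_square:
  assumes "finite I"
  shows "(\<integral>\<^sup>+ z. ennreal ((\<Sum>i\<in>I. z i * q i)\<^sup>2) \<partial>Pi\<^sub>M I (\<lambda>_. std_normal)) = ennreal (\<Sum>i\<in>I. (q i)\<^sup>2)"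
proof -
  have i: "integrable std_normal (\<lambda>x. (x * q i)\<^sup>2)" for i
    using std_normal_moments(1)[of 2] by (simp add: power_mult_distrib)
  have v: "(\<integral>x. (x * q i)\<^sup>2 \<partial>std_normal) = (q i)\<^sup>2" for i
    using std_normal_moments(3) by (simp add: power_mult_distrib del: integral_density)
  have w: "(\<integral>x. x * q i \<partial>std_normal) = 0" for i
    using std_normal_moments(2) by (simp del: integral_density)
  note s = second_moment_sum[of I std_normal "\<lambda>i x. x * q i", OF assms prob_space_std_normal _ i]
  have "(\<integral>z. (\<Sum>i\<in>I. z i * q i)\<^sup>2 \<partial>Pi\<^sub>M I (\<lambda>_. std_normal)) = (\<Sum>i\<in>I. (q i)\<^sup>2)"
    using s(2) by (simp add: v w std_normal_moments(2) del: integral_density)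
  then show ?thesis
    using s(1) by (subst nn_integral_eq_integral) auto
qed

section \<open>Moments of Gaussian design matrices\<close>

text \<open>
  A row distribution whose coordinates in \<open>U\<close> are independent standard normals,
  stated through linear functionals: this is the form in which a degenerate covariance delivers
  it. The coordinates in \<open>T\<close> are the ones along which the noise will be fitted, and
  \<open>n\<close> is the number of rows.
\<close>
locale gaussian_rows =
  fixes G :: "(real^'p) measure" and U T :: "'p::finite set" and n :: nat
  assumes prob_G: "prob_space G" and sets_G [simp, measurable_cong]: "sets G = sets borel"
    and T_sub: "T \<subseteq> U"
    and normal_G: "\<And>v. (\<And>j. j \<notin> U \<Longrightarrow> v $ j = 0) \<Longrightarrow> distr G borel (\<lambda>x. v \<bullet> x) = normal_measure 0 (norm v)"
begin

text \<open>
  The projection to the coordinates in \<open>T\<close>, so that \<open>restr y \<bullet>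
  x\<close> is the entry of the Gram matrix \<open>X\<^sub>T X\<^sub>T\<^sup>T\<close> that
  belongs to the rows \<open>y\<close> and \<open>x\<close>.
\<close>
definition restr :: "real^'p \<Rightarrow> real^'p" where
  "restr y = (\<chi> j. if j \<in> T then y $ j else 0)"

definition oneT :: "real^'p" where
  "oneT = (\<chi> j. if j \<in> T then 1 else 0)"

lemma restr_outside [simp]: "j \<notin> U \<Longrightarrow> restr y $ j = 0"
  and oneT_outside [simp]: "j \<notin> U \<Longrightarrow> oneT $ j = 0"
  using T_sub by (auto simp: restr_def oneT_def)

lemma norm_restr: "(norm (restr y))\<^sup>2 = (\<Sum>k\<in>T. (y $ k)\<^sup>2)"
  by (simp add: power2_norm_eq_inner inner_vec_def restr_def if_distrib[where f="\<lambda>x. x * _"] flip: power2_eq_square cong: if_cong)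
    (simp add: if_distrib[where f="\<lambda>x. x^2"] sum.If_cases cong: if_cong)

lemma norm_oneT: "(norm oneT)\<^sup>2 = card T"
  by (simp add: power2_norm_eq_inner inner_vec_def oneT_def if_distrib[where f="\<lambda>x. x * _"] sum.If_cases cong: if_cong)

lemma restr_inner: "restr y \<bullet> x = (\<Sum>k\<in>T. y $ k * x $ k)"
  by (simp add: inner_vec_def restr_def if_distrib[where f="\<lambda>x. x * _"] sum.If_cases cong: if_cong)

lemma oneT_inner: "oneT \<bullet> x = (\<Sum>k\<in>T. x $ k)"
  by (simp add: inner_vec_def oneT_def if_distrib[where f="\<lambda>x. x * _"] sum.If_cases cong: if_cong)

lemma linear_moments:
  assumes "\<And>j. j \<notin> U \<Longrightarrow> v $ j = 0"
  shows "integrable G (\<lambda>x. (v \<bullet> x) ^ k)" "(\<integral>x. v \<bullet> x \<partial>G) = 0" "(\<integral>x. (v \<bullet> x)\<^sup>2 \<partial>G) = (norm v)\<^sup>2"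
    "(\<integral>x. (v \<bullet> x) ^ 4 \<partial>G) = 3 * (norm v) ^ 4" "(\<integral>x. (v \<bullet> x) ^ 6 \<partial>G) = 15 * (norm v) ^ 6"
  using moments_of_normal[OF _ normal_G[OF assms]] by auto

lemma coord_moments:
  assumes "k \<in> U"
  shows "integrable G (\<lambda>x. (x $ k) ^ r)" "(\<integral>x. x $ k \<partial>G) = 0" "(\<integral>x. (x $ k)\<^sup>2 \<partial>G) = 1"
    "(\<integral>x. (x $ k) ^ 4 \<partial>G) = 3" "(\<integral>x. (x $ k) ^ 6 \<partial>G) = 15"
proof -
  have "axis k 1 $ j = (0::real)" if "j \<notin> U" for j using that assms by (auto simp: axis_def)
  note * = linear_moments[OF this, unfolded inner_axis']
  show "integrable G (\<lambda>x. (x $ k) ^ r)" "(\<integral>x. x $ k \<partial>G) = 0" "(\<integral>x. (x $ k)\<^sup>2 \<partial>G) = 1"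
    "(\<integral>x. (x $ k) ^ 4 \<partial>G) = 3" "(\<integral>x. (x $ k) ^ 6 \<partial>G) = 15"
    using * by auto
qed

text \<open>
  The mean is a polarized second moment. For the second moment, \<open>2 u\<^sup>2 v\<^sup>2
  \<le> A u\<^sup>4 + v\<^sup>4 / A\<close> with \<open>A = |w|\<^sup>2\<close> reduces to pure
  fourth moments; this choice of \<open>A\<close> balances the two terms.
\<close>
lemma coord_times_linear:
  assumes k: "k \<in> U" and w: "\<And>j. j \<notin> U \<Longrightarrow> w $ j = 0"
  shows "(\<integral>x. x $ k * (w \<bullet> x) \<partial>G) = w $ k"
    and "integrable G (\<lambda>x. (x $ k * (w \<bullet> x))\<^sup>2)"
    and "(\<integral>x. (x $ k * (w \<bullet> x))\<^sup>2 \<partial>G) \<le> 3 * (norm w)\<^sup>2"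
proof -
  have e: "x $ k * (w \<bullet> x) = (((axis k 1 + w) \<bullet> x)\<^sup>2 - (x $ k)\<^sup>2 - (w \<bullet> x)\<^sup>2) / 2" for x :: "real^'p"
    by (simp add: inner_add_left inner_axis' power2_eq_square algebra_simps)
  have kw: "(axis k 1 + w) $ j = 0" if "j \<notin> U" for j using that w[OF that] k by (auto simp: axis_def)
  have n: "(norm (axis k 1 + w))\<^sup>2 = 1 + (norm w)\<^sup>2 + 2 * w $ k"
    by (simp add: power2_norm_eq_inner inner_add_left inner_add_right inner_axis inner_axis')
  show "(\<integral>x. x $ k * (w \<bullet> x) \<partial>G) = w $ k"
    unfolding e using linear_moments(1)[OF kw] linear_moments(1)[OF w] coord_moments(1)[OF k]
    by (simp add: linear_moments(3)[OF kw] linear_moments(3)[OF w] coord_moments(3)[OF k] n)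
  define A where "A = (norm w)\<^sup>2"
  have "integrable G (\<lambda>x. (x $ k * (w \<bullet> x))\<^sup>2) \<and> (\<integral>x. (x $ k * (w \<bullet> x))\<^sup>2 \<partial>G) \<le> 3 * A"
  proof (cases "w = 0")
    case False
    then have A: "A > 0" by (simp add: A_def)
    have bd: "(x $ k * (w \<bullet> x))\<^sup>2 \<le> (A * (x $ k) ^ 4 + (w \<bullet> x) ^ 4 / A) / 2" for x :: "real^'p"
    proof -
      have "0 \<le> (A * (x $ k)\<^sup>2 - (w \<bullet> x)\<^sup>2)\<^sup>2 / A" using A by simp
      also have "\<dots> = A * (x $ k) ^ 4 + (w \<bullet> x) ^ 4 / A - 2 * (x $ k * (w \<bullet> x))\<^sup>2"
        using A by (simp add: power2_eq_square power4_eq_xxxx field_simps)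
      finally show ?thesis by simp
    qed
    have iR: "integrable G (\<lambda>x. (A * (x $ k) ^ 4 + (w \<bullet> x) ^ 4 / A) / 2)"
      using linear_moments(1)[OF w, of 4] coord_moments(1)[OF k, of 4] by auto
    have iL: "integrable G (\<lambda>x. (x $ k * (w \<bullet> x))\<^sup>2)"
      using bd by (intro Bochner_Integration.integrable_bound[OF iR]) (auto intro: order_trans[OF _ abs_ge_self])
    have "(\<integral>x. (x $ k * (w \<bullet> x))\<^sup>2 \<partial>G) \<le> (\<integral>x. (A * (x $ k) ^ 4 + (w \<bullet> x) ^ 4 / A) / 2 \<partial>G)"
      by (rule integral_mono[OF iL iR bd])
    also have "\<dots> = (A * 3 + 3 * (norm w) ^ 4 / A) / 2"
      using linear_moments(1)[OF w, of 4] coord_moments(1)[OF k, of 4]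
      by (simp add: linear_moments(4)[OF w] coord_moments(4)[OF k])
    also have "\<dots> = 3 * A"
      using A by (simp add: A_def power2_eq_square power4_eq_xxxx field_simps)
    finally show ?thesis using iL by simp
  qed (simp add: A_def)
  then show "integrable G (\<lambda>x. (x $ k * (w \<bullet> x))\<^sup>2)"
    and "(\<integral>x. (x $ k * (w \<bullet> x))\<^sup>2 \<partial>G) \<le> 3 * (norm w)\<^sup>2" by (auto simp: A_def)
qed

text \<open>
  The inequality of arithmetic and geometric means reduces the mixed moments of orders four and
  six to the pure moments \<open>3\<close> and \<open>15\<close>.
\<close>
lemma restr_norm_moments:
  assumes k: "k \<in> U"
  shows "integrable G (\<lambda>y. (norm (restr y))\<^sup>2)" "(\<integral>y. (norm (restr y))\<^sup>2 \<partial>G) = card T"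
    "integrable G (\<lambda>y. (norm (restr y)) ^ 4)" "(\<integral>y. (norm (restr y)) ^ 4 \<partial>G) \<le> 3 * (card T)\<^sup>2"
    "integrable G (\<lambda>y. (y $ k)\<^sup>2 * (norm (restr y)) ^ 4)" "(\<integral>y. (y $ k)\<^sup>2 * (norm (restr y)) ^ 4 \<partial>G) \<le> 15 * (card T)\<^sup>2"
proof -
  have T: "l \<in> U" if "l \<in> T" for l using that T_sub by auto
  note c = coord_moments[OF T]
  show "integrable G (\<lambda>y. (norm (restr y))\<^sup>2)" "(\<integral>y. (norm (restr y))\<^sup>2 \<partial>G) = card T"
    unfolding norm_restr using c(1) by (simp_all add: Bochner_Integration.integral_sum c)
  have n4: "(norm (restr y)) ^ 4 = (\<Sum>l\<in>T. \<Sum>r\<in>T. (y $ l)\<^sup>2 * (y $ r)\<^sup>2)" for y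
  proof -
    have "(norm (restr y)) ^ 4 = ((norm (restr y))\<^sup>2)\<^sup>2" by simp
    then show ?thesis unfolding norm_restr by (simp add: power2_eq_square sum_product)
  qed
  have m[measurable]: "(\<lambda>y. (norm (restr y))) \<in> borel_measurable G"
  proof -
    have "norm (restr y) = sqrt (\<Sum>l\<in>T. (y $ l)\<^sup>2)" for y 
      unfolding norm_restr[symmetric] by simp
    then show ?thesis by simp
  qed
  have b4: "(norm (restr y)) ^ 4 \<le> (\<Sum>l\<in>T. \<Sum>r\<in>T. ((y $ l) ^ 4 + (y $ r) ^ 4) / 2)" for y
    unfolding n4
  proof (intro sum_mono)
    fix l r
    have "0 \<le> ((y $ l)\<^sup>2 - (y $ r)\<^sup>2)\<^sup>2" by simp
    then show "(y $ l)\<^sup>2 * (y $ r)\<^sup>2 \<le> ((y $ l) ^ 4 + (y $ r) ^ 4) / 2"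
      by (simp add: power2_eq_square power4_eq_xxxx algebra_simps)
  qed
  have i4: "integrable G (\<lambda>y. \<Sum>l\<in>T. \<Sum>r\<in>T. ((y $ l) ^ 4 + (y $ r) ^ 4) / 2)"
    using c(1) by auto
  show I4: "integrable G (\<lambda>y. (norm (restr y)) ^ 4)"
    using b4 by (intro Bochner_Integration.integrable_bound[OF i4]) (auto intro: order_trans[OF _ abs_ge_self])
  have "(\<integral>y. (norm (restr y)) ^ 4 \<partial>G) \<le> (\<integral>y. (\<Sum>l\<in>T. \<Sum>r\<in>T. ((y $ l) ^ 4 + (y $ r) ^ 4) / 2) \<partial>G)"
    by (rule integral_mono[OF I4 i4 b4])
  also have "\<dots> = 3 * (card T)\<^sup>2"
    using c(1) by (simp add: Bochner_Integration.integral_sum c power2_eq_square)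
  finally show "(\<integral>y. (norm (restr y)) ^ 4 \<partial>G) \<le> 3 * (card T)\<^sup>2" .
  have amgm: "a * b * c \<le> (a ^ 3 + b ^ 3 + c ^ 3) / 3" if "0 \<le> a" "0 \<le> b" "0 \<le> c" for a b c :: real
  proof -
    have "0 \<le> (a + b + c) * ((a - b)\<^sup>2 + (b - c)\<^sup>2 + (c - a)\<^sup>2)" using that by auto
    also have "\<dots> = 2 * (a ^ 3 + b ^ 3 + c ^ 3 - 3 * (a * b * c))"
      by (simp add: power2_eq_square power3_eq_cube algebra_simps)
    finally show ?thesis by simp
  qed
  have b6: "(y $ k)\<^sup>2 * (norm (restr y)) ^ 4 \<le> (\<Sum>l\<in>T. \<Sum>r\<in>T. ((y $ k) ^ 6 + (y $ l) ^ 6 + (y $ r) ^ 6) / 3)" for y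
    unfolding n4 sum_distrib_left
  proof (intro sum_mono)
    fix l r
    show "(y $ k)\<^sup>2 * ((y $ l)\<^sup>2 * (y $ r)\<^sup>2) \<le> ((y $ k) ^ 6 + (y $ l) ^ 6 + (y $ r) ^ 6) / 3"
      using amgm[of "(y $ k)\<^sup>2" "(y $ l)\<^sup>2" "(y $ r)\<^sup>2"] by (simp add: mult.assoc flip: power_mult)
  qed
  have i6: "integrable G (\<lambda>y. \<Sum>l\<in>T. \<Sum>r\<in>T. ((y $ k) ^ 6 + (y $ l) ^ 6 + (y $ r) ^ 6) / 3)"
    using c(1) coord_moments(1)[OF k] by auto
  show I6: "integrable G (\<lambda>y. (y $ k)\<^sup>2 * (norm (restr y)) ^ 4)"
    using b6 by (intro Bochner_Integration.integrable_bound[OF i6]) (auto intro: order_trans[OF _ abs_ge_self])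
  have "(\<integral>y. (y $ k)\<^sup>2 * (norm (restr y)) ^ 4 \<partial>G) \<le> (\<integral>y. (\<Sum>l\<in>T. \<Sum>r\<in>T. ((y $ k) ^ 6 + (y $ l) ^ 6 + (y $ r) ^ 6) / 3) \<partial>G)"
    by (rule integral_mono[OF I6 i6 b6])
  also have "\<dots> = 15 * (card T)\<^sup>2"
    using c(1) coord_moments(1)[OF k] by (simp add: Bochner_Integration.integral_sum c coord_moments(5)[OF k] power2_eq_square)
  finally show "(\<integral>y. (y $ k)\<^sup>2 * (norm (restr y)) ^ 4 \<partial>G) \<le> 15 * (card T)\<^sup>2" .
qed

end

text \<open>
  In matrix notation, with \<open>X\<close> the matrix of rows \<open>x i\<close>,
  \<open>X\<^sub>T\<close> its columns in \<open>T\<close> and \<open>g = X\<^sub>T\<^sup>T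
  z\<close>, the six conditions bound \<open>| |g|\<^sup>2 - mn |\<close>, \<open>1 \<bullet>
  g\<close>, \<open>|X\<^sub>T 1|\<close>, \<open>|X\<^sub>U\<^sup>T X\<^sub>T 1|\<close>,
  \<open>|X\<^sub>T g|\<close> and \<open>|X\<^sub>U\<^sup>T X\<^sub>T g|\<close>. These are the
  statistics that occur when a predictor is moved by a combination of \<open>g\<close> and the
  constant vector on \<open>T\<close>: the first for the gain, the second for the
  \<open>\<ell>\<^sub>1\<close> norm, the others for the quadratic loss and for the interaction
  with an unknown error of the predictor. Each bound is a constant times the order of the
  expectation.
\<close>
definition typical :: "nat \<Rightarrow> 'p set \<Rightarrow> 'p set \<Rightarrow> (nat \<Rightarrow> real^'p) \<Rightarrow> (nat \<Rightarrow> real) \<Rightarrow> bool" where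
  "typical n U T x z \<longleftrightarrow>
    (let m = real (card T); N = real n; g = (\<lambda>k. \<Sum>i<n. z i * x i $ k) in
      ((\<Sum>k\<in>T. (g k)\<^sup>2) - m * N)\<^sup>2 \<le> (3 / 5 * m * N)\<^sup>2 \<and>
      (\<Sum>k\<in>T. g k)\<^sup>2 \<le> 16 * m * N \<and>
      (\<Sum>i<n. (\<Sum>k\<in>T. x i $ k)\<^sup>2) \<le> 25 * m * N \<and>
      (\<Sum>k\<in>U. (\<Sum>i<n. x i $ k * (\<Sum>l\<in>T. x i $ l))\<^sup>2) \<le> 250 * m * N\<^sup>2 \<and>
      (\<Sum>i<n. (\<Sum>l\<in>T. x i $ l * g l)\<^sup>2) \<le> 500 * m * N\<^sup>2 \<and>
      (\<Sum>k\<in>U. (\<Sum>i<n. x i $ k * (\<Sum>l\<in>T. x i $ l * g l))\<^sup>2) \<le> 7250 * m * N ^ 3)"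

context gaussian_rows
begin

abbreviation XX where "XX \<equiv> Pi\<^sub>M {..<n} (\<lambda>_. G)"
abbreviation ZZ where "ZZ \<equiv> Pi\<^sub>M {..<n} (\<lambda>_. std_normal)"
abbreviation m where "m \<equiv> real (card T)"

lemma restr_measurable [measurable]: "restr \<in> borel_measurable borel"
  by (subst borel_measurable_euclidean_space) (auto simp: Basis_vec_def inner_axis restr_def)

lemma vec_nth_measurable [measurable]: "(\<lambda>x :: real^'p. x $ k) \<in> borel_measurable borel"
  by (intro borel_measurable_continuous_onI continuous_intros)

lemma restr_nth: "restr y $ j = (if j \<in> T then y $ j else 0)"
  by (simp add: restr_def)

lemma restr_self: "restr y \<bullet> y = (norm (restr y))\<^sup>2"
  unfolding norm_restr restr_inner by (simp add: power2_eq_square)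

lemma column_sums_bound:
  "(\<integral>\<^sup>+ X. ennreal (\<Sum>i<n. (oneT \<bullet> X i)\<^sup>2) \<partial>XX) \<le> ennreal (m * n)"
proof -
  have "(\<integral>\<^sup>+ X. ennreal (\<Sum>i<n. (oneT \<bullet> X i)\<^sup>2) \<partial>XX) = (\<Sum>i<n. \<integral>\<^sup>+ X. ennreal ((oneT \<bullet> X i)\<^sup>2) \<partial>XX)"
    by (subst nn_integral_sum[symmetric]) auto
  also have "\<dots> = (\<Sum>i<n. \<integral>\<^sup>+ x. ennreal ((oneT \<bullet> x)\<^sup>2) \<partial>G)"
    using prob_G by (intro sum.cong nn_integral_PiM_component[where f="\<lambda>x. ennreal ((oneT \<bullet> x)\<^sup>2)"]) auto
  also have "\<dots> = (\<Sum>i<n. ennreal m)"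
    using linear_moments(1)[of oneT 2] linear_moments(3)[of oneT]
    by (subst nn_integral_eq_integral) (auto simp: norm_oneT)
  also have "\<dots> = ennreal (m * n)" by (simp add: ennreal_of_nat_eq_real_of_nat ennreal_mult'' mult.commute)
  finally show ?thesis by simp
qed

text \<open>
  For each \<open>k\<close> the inner sum has independent terms with mean \<open>1\<close> or
  \<open>0\<close> and second moment at most \<open>3m\<close>; the mean contributes
  \<open>n\<^sup>2\<close> only for \<open>k \<in> T\<close>.
\<close>
lemma gram_column_bound:
  assumes U: "card U \<le> 3 * n" "U \<noteq> {}" "n > 0"
  shows "(\<integral>\<^sup>+ X. ennreal (\<Sum>k\<in>U. (\<Sum>i<n. X i $ k * (oneT \<bullet> X i))\<^sup>2) \<partial>XX) \<le> ennreal (10 * m * (real n)\<^sup>2)"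
proof -
  have "(\<integral>\<^sup>+ X. ennreal (\<Sum>k\<in>U. (\<Sum>i<n. X i $ k * (oneT \<bullet> X i))\<^sup>2) \<partial>XX)
      = (\<Sum>k\<in>U. \<integral>\<^sup>+ X. ennreal ((\<Sum>i<n. X i $ k * (oneT \<bullet> X i))\<^sup>2) \<partial>XX)"
    by (subst nn_integral_sum[symmetric]) auto
  also have "\<dots> \<le> (\<Sum>k\<in>U. ennreal (real n * (3 * m) + (real n)\<^sup>2 * (if k \<in> T then 1 else 0)))"
  proof (rule sum_mono)
    fix k assume k: "k \<in> U"
    show "(\<integral>\<^sup>+ X. ennreal ((\<Sum>i<n. X i $ k * (oneT \<bullet> X i))\<^sup>2) \<partial>XX) \<le> ennreal (real n * (3 * m) + (real n)\<^sup>2 * (if k \<in> T then 1 else 0))"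
      using coord_times_linear[OF k, of oneT]
      by (intro nn_second_moment_sum_le[where f="\<lambda>x. x $ k * (oneT \<bullet> x)"] prob_G) (auto simp: norm_oneT, auto simp: oneT_def)
  qed
  also have "\<dots> = ennreal (\<Sum>k\<in>U. real n * (3 * m) + (real n)\<^sup>2 * (if k \<in> T then 1 else 0))"
    by (rule sum_ennreal) auto
  also have "(\<Sum>k\<in>U. real n * (3 * m) + (real n)\<^sup>2 * (if k \<in> T then 1 else 0)) = card U * (real n * (3 * m)) + (real n)\<^sup>2 * m"
    using T_sub by (simp add: sum.distrib sum.If_cases Int_absorb1 flip: sum_distrib_left)
  also have "\<dots> \<le> (3 * n) * (real n * (3 * m)) + (real n)\<^sup>2 * m"
    using U(1) by (intro add_right_mono mult_right_mono) auto
  also have "\<dots> = 10 * m * (real n)\<^sup>2" by (simp add: power2_eq_square algebra_simps)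
  finally show ?thesis by (simp add: ennreal_leI)
qed

lemma sum_upd_split:
  assumes "a < n"
  shows "(\<Sum>i<n. f ((X(a := y)) i)) = f y + (\<Sum>i\<in>{..<n} - {a}. f (X i))"
  using assms by (subst sum.remove[of _ a]) (auto intro!: sum.cong)

text \<open>
  Row \<open>a\<close> meets itself in \<open>|x\<^sub>a|\<^sup>4\<close>, of order
  \<open>m\<^sup>2\<close>; given row \<open>a\<close>, each other row contributes
  \<open>|x\<^sub>a|\<^sup>2\<close> on average.
\<close>
lemma gram_row_bound:
  assumes a: "a < n" and U: "U \<noteq> {}"
  shows "(\<integral>\<^sup>+ X. ennreal (\<Sum>i<n. (restr (X a) \<bullet> X i)\<^sup>2) \<partial>XX) \<le> ennreal (3 * m\<^sup>2 + n * m)"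
proof -
  obtain k where k: "k \<in> U" using U by auto
  interpret R: prob_space "Pi\<^sub>M ({..<n} - {a}) (\<lambda>_. G)" by (rule prob_space_PiM) (rule prob_G)
  have "(\<integral>\<^sup>+ X. ennreal (\<Sum>i<n. (restr (X a) \<bullet> X i)\<^sup>2) \<partial>XX)
     = (\<integral>\<^sup>+ y. \<integral>\<^sup>+ X. ennreal (\<Sum>i<n. (restr ((X(a := y)) a) \<bullet> (X(a := y)) i)\<^sup>2) \<partial>Pi\<^sub>M ({..<n} - {a}) (\<lambda>_. G) \<partial>G)"
    using a prob_G by (intro nn_integral_PiM_single_out) auto
  also have "\<dots> \<le> (\<integral>\<^sup>+ y. ennreal ((norm (restr y)) ^ 4 + n * (norm (restr y))\<^sup>2) \<partial>G)"
  proof (rule nn_integral_mono)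
    fix y
    let ?c = "(norm (restr y))\<^sup>2"
    have "(\<integral>\<^sup>+ X. ennreal (\<Sum>i<n. (restr ((X(a := y)) a) \<bullet> (X(a := y)) i)\<^sup>2) \<partial>Pi\<^sub>M ({..<n} - {a}) (\<lambda>_. G))
       = (\<integral>\<^sup>+ X. ennreal (?c\<^sup>2) + (\<Sum>i\<in>{..<n} - {a}. ennreal ((restr y \<bullet> X i)\<^sup>2)) \<partial>Pi\<^sub>M ({..<n} - {a}) (\<lambda>_. G))"
      using sum_upd_split[OF a, of "\<lambda>x. (restr y \<bullet> x)\<^sup>2" _ y]
      by (simp add: restr_self sum_ennreal sum_nonneg)
    also have "\<dots> = ennreal (?c\<^sup>2) + (\<Sum>i\<in>{..<n} - {a}. \<integral>\<^sup>+ X. ennreal ((restr y \<bullet> X i)\<^sup>2) \<partial>Pi\<^sub>M ({..<n} - {a}) (\<lambda>_. G))"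
      by (simp add: nn_integral_add nn_integral_sum R.emeasure_space_1 del: sum_ennreal)
    also have "\<dots> = ennreal (?c\<^sup>2) + (\<Sum>i\<in>{..<n} - {a}. \<integral>\<^sup>+ x. ennreal ((restr y \<bullet> x)\<^sup>2) \<partial>G)"
      using prob_G by (intro arg_cong2[where f=plus] sum.cong refl nn_integral_PiM_component[where f="\<lambda>x. ennreal ((restr y \<bullet> x)\<^sup>2)"]) auto
    also have "\<dots> = ennreal (?c\<^sup>2) + (\<Sum>i\<in>{..<n} - {a}. ennreal ?c)"
      using linear_moments(1)[of "restr y" 2] linear_moments(3)[of "restr y"]
      by (subst nn_integral_eq_integral) auto
    also have "\<dots> \<le> ennreal (?c\<^sup>2) + (\<Sum>i\<in>{..<n}. ennreal ?c)"
      by (intro add_left_mono sum_mono2) auto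
    also have "\<dots> = ennreal ((norm (restr y)) ^ 4 + n * (norm (restr y))\<^sup>2)"
      by (simp add: ennreal_of_nat_eq_real_of_nat ennreal_mult'')
    finally show "(\<integral>\<^sup>+ X. ennreal (\<Sum>i<n. (restr ((X(a := y)) a) \<bullet> (X(a := y)) i)\<^sup>2) \<partial>Pi\<^sub>M ({..<n} - {a}) (\<lambda>_. G))
      \<le> ennreal ((norm (restr y)) ^ 4 + n * (norm (restr y))\<^sup>2)" .
  qed
  also have "\<dots> \<le> ennreal (3 * m\<^sup>2 + n * m)"
    using restr_norm_moments[OF k] by (intro nn_integral_le_of_integral) auto
  finally show ?thesis .
qed

text \<open>
  The entries of \<open>X\<^sub>U\<^sup>T X\<^sub>T X\<^sub>T\<^sup>T\<close>, of degree three
  in the design. Given row \<open>a\<close>, the terms with \<open>i \<noteq> a\<close> are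
  independent, so a mean and a variance suffice, and the term \<open>i = a\<close> is split off
  at the cost of a factor \<open>2\<close>.
\<close>
lemma gram_square_bound:
  assumes a: "a < n" and k: "k \<in> U"
  shows "(\<integral>\<^sup>+ X. ennreal ((\<Sum>i<n. X i $ k * (restr (X a) \<bullet> X i))\<^sup>2) \<partial>XX)
    \<le> ennreal (30 * m\<^sup>2 + 6 * n * m + 2 * (real n)\<^sup>2 * (if k \<in> T then 1 else 0))"
proof -
  let ?I = "{..<n} - {a}"
  interpret R: prob_space "Pi\<^sub>M ?I (\<lambda>_. G)" by (rule prob_space_PiM) (rule prob_G)
  let ?B = "\<lambda>y. 2 * ((y $ k)\<^sup>2 * (norm (restr y)) ^ 4) + 2 * (n * (3 * (norm (restr y))\<^sup>2) + (real n)\<^sup>2 * ((if k \<in> T then 1 else 0) * (y $ k)\<^sup>2))"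
  have "(\<integral>\<^sup>+ X. ennreal ((\<Sum>i<n. X i $ k * (restr (X a) \<bullet> X i))\<^sup>2) \<partial>XX)
     = (\<integral>\<^sup>+ y. \<integral>\<^sup>+ X. ennreal ((\<Sum>i<n. (X(a := y)) i $ k * (restr ((X(a := y)) a) \<bullet> (X(a := y)) i))\<^sup>2) \<partial>Pi\<^sub>M ?I (\<lambda>_. G) \<partial>G)"
    using a prob_G by (intro nn_integral_PiM_single_out) auto
  also have "\<dots> \<le> (\<integral>\<^sup>+ y. ennreal (?B y) \<partial>G)"
  proof (rule nn_integral_mono)
    fix y
    let ?c = "(norm (restr y))\<^sup>2"
    let ?s = "\<lambda>X. \<Sum>i\<in>?I. X i $ k * (restr y \<bullet> X i)"
    have sq: "(u + v)\<^sup>2 \<le> 2 * u\<^sup>2 + 2 * v\<^sup>2" for u v :: real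
      using sum_squares_bound[of u v] by (simp add: power2_sum)
    have "(\<integral>\<^sup>+ X. ennreal ((\<Sum>i<n. (X(a := y)) i $ k * (restr ((X(a := y)) a) \<bullet> (X(a := y)) i))\<^sup>2) \<partial>Pi\<^sub>M ?I (\<lambda>_. G))
       \<le> (\<integral>\<^sup>+ X. ennreal (2 * (y $ k * ?c)\<^sup>2) + 2 * ennreal ((?s X)\<^sup>2) \<partial>Pi\<^sub>M ?I (\<lambda>_. G))"
    proof (rule nn_integral_mono)
      fix X
      have "(\<Sum>i<n. (X(a := y)) i $ k * (restr ((X(a := y)) a) \<bullet> (X(a := y)) i)) = y $ k * ?c + ?s X"
        using sum_upd_split[OF a, of "\<lambda>x. x $ k * (restr y \<bullet> x)" X y] by (simp add: restr_self)
      then have "(\<Sum>i<n. (X(a := y)) i $ k * (restr ((X(a := y)) a) \<bullet> (X(a := y)) i))\<^sup>2 \<le> 2 * (y $ k * ?c)\<^sup>2 + 2 * (?s X)\<^sup>2"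
        using sq by simp
      then show "ennreal ((\<Sum>i<n. (X(a := y)) i $ k * (restr ((X(a := y)) a) \<bullet> (X(a := y)) i))\<^sup>2)
          \<le> ennreal (2 * (y $ k * ?c)\<^sup>2) + 2 * ennreal ((?s X)\<^sup>2)"
        by (simp flip: ennreal_plus ennreal_mult'' add: ennreal_leI flip: ennreal_numeral)
    qed
    also have "\<dots> = ennreal (2 * (y $ k * ?c)\<^sup>2) + 2 * (\<integral>\<^sup>+ X. ennreal ((?s X)\<^sup>2) \<partial>Pi\<^sub>M ?I (\<lambda>_. G))"
      by (simp add: nn_integral_add nn_integral_cmult R.emeasure_space_1)
    also have "\<dots> \<le> ennreal (2 * (y $ k * ?c)\<^sup>2) + 2 * ennreal (n * (3 * ?c) + (real n)\<^sup>2 * ((if k \<in> T then 1 else 0) * (y $ k)\<^sup>2))"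
      using coord_times_linear[OF k restr_outside, of y]
      by (intro add_left_mono mult_left_mono nn_second_moment_sum_le[where f="\<lambda>x. x $ k * (restr y \<bullet> x)"] prob_G)
        (auto simp: restr_nth card_Diff_singleton_if)
    also have "\<dots> = ennreal (?B y)"
      by (simp flip: ennreal_plus ennreal_mult'' ennreal_numeral add: power_mult_distrib flip: power_mult)
    finally show "(\<integral>\<^sup>+ X. ennreal ((\<Sum>i<n. (X(a := y)) i $ k * (restr ((X(a := y)) a) \<bullet> (X(a := y)) i))\<^sup>2) \<partial>Pi\<^sub>M ?I (\<lambda>_. G)) \<le> ennreal (?B y)" .
  qed
  also have "\<dots> \<le> ennreal (30 * m\<^sup>2 + 6 * n * m + 2 * (real n)\<^sup>2 * (if k \<in> T then 1 else 0))"
  proof (rule nn_integral_le_of_integral)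
    note r = restr_norm_moments[OF k] and c = coord_moments(1)[OF k, of 2]
    show "integrable G ?B" using r c by auto
    have "(\<integral>y. ?B y \<partial>G) = 2 * (\<integral>y. (y $ k)\<^sup>2 * (norm (restr y)) ^ 4 \<partial>G) + 2 * (n * (3 * m) + (real n)\<^sup>2 * (if k \<in> T then 1 else 0))"
      using r c by (simp add: coord_moments(3)[OF k])
    then show "(\<integral>y. ?B y \<partial>G) \<le> 30 * m\<^sup>2 + 6 * n * m + 2 * (real n)\<^sup>2 * (if k \<in> T then 1 else 0)"
      using r(6) by simp
  qed auto
  finally show ?thesis .
qed

end

section \<open>Typical samples\<close>

context gaussian_rows
begin

lemma prob_XX: "prob_space XX" and prob_ZZ: "prob_space ZZ"
  by (auto intro!: prob_space_PiM prob_G prob_space_std_normal)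

lemma score_sum_bound:
  "(\<integral>\<^sup>+ X. \<integral>\<^sup>+ Z. ennreal ((\<Sum>k\<in>T. \<Sum>i<n. Z i * X i $ k)\<^sup>2) \<partial>ZZ \<partial>XX) \<le> ennreal (m * n)"
proof -
  have "(\<Sum>k\<in>T. \<Sum>i<n. Z i * X i $ k) = (\<Sum>i<n. Z i * (oneT \<bullet> X i))" for X :: "nat \<Rightarrow> real^'p" and Z :: "nat \<Rightarrow> real"
    by (subst sum.swap) (simp add: oneT_inner sum_distrib_left)
  then show ?thesis
    using column_sums_bound by (simp add: nn_integral_noise_square)
qed

lemma score_regroup:
  "(\<Sum>l\<in>T. x $ l * (\<Sum>a<n. Z a * X a $ l)) = (\<Sum>a<n. Z a * (restr (X a) \<bullet> x))"
  unfolding restr_inner sum_distrib_left by (subst sum.swap) (simp add: ac_simps)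

text \<open>
  Averaging over the noise first replaces each squared linear form in the noise by the sum of
  its squared coefficients, which are entries of the Gram matrix.
\<close>
lemma fitted_score_bound:
  assumes U: "U \<noteq> {}" and m: "m \<le> 3 * n"
  shows "(\<integral>\<^sup>+ X. \<integral>\<^sup>+ Z. ennreal (\<Sum>i<n. (\<Sum>l\<in>T. X i $ l * (\<Sum>a<n. Z a * X a $ l))\<^sup>2) \<partial>ZZ \<partial>XX)
    \<le> ennreal (10 * m * (real n)\<^sup>2)"
proof -
  have "(\<integral>\<^sup>+ X. \<integral>\<^sup>+ Z. ennreal (\<Sum>i<n. (\<Sum>l\<in>T. X i $ l * (\<Sum>a<n. Z a * X a $ l))\<^sup>2) \<partial>ZZ \<partial>XX)
      = (\<integral>\<^sup>+ X. (\<Sum>i<n. \<integral>\<^sup>+ Z. ennreal ((\<Sum>a<n. Z a * (restr (X a) \<bullet> X i))\<^sup>2) \<partial>ZZ) \<partial>XX)"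
    unfolding score_regroup by (subst nn_integral_sum[symmetric]) auto
  also have "\<dots> = (\<integral>\<^sup>+ X. (\<Sum>a<n. ennreal (\<Sum>i<n. (restr (X a) \<bullet> X i)\<^sup>2)) \<partial>XX)"
    by (simp add: nn_integral_noise_square sum_nonneg) (subst sum.swap, simp)
  also have "\<dots> = (\<Sum>a<n. \<integral>\<^sup>+ X. ennreal (\<Sum>i<n. (restr (X a) \<bullet> X i)\<^sup>2) \<partial>XX)"
    by (rule nn_integral_sum) measurable
  also have "\<dots> \<le> (\<Sum>a<n. ennreal (3 * m\<^sup>2 + n * m))"
    by (intro sum_mono gram_row_bound U) auto
  also have "\<dots> = ennreal (n * (3 * m\<^sup>2 + n * m))"
    by (simp add: ennreal_of_nat_eq_real_of_nat ennreal_mult'')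
  also have "\<dots> \<le> ennreal (10 * m * (real n)\<^sup>2)"
  proof (rule ennreal_leI)
    have "m * (m * n) \<le> (3 * n) * (m * n)" using m by (intro mult_right_mono) auto
    then show "n * (3 * m\<^sup>2 + n * m) \<le> 10 * m * (real n)\<^sup>2" by (simp add: power2_eq_square algebra_simps)
  qed
  finally show ?thesis .
qed

text \<open>
  This second moment controls the interaction with an arbitrary error of the predictor, by
  Cauchy-Schwarz; it takes the place of a bound on the operator norm of the design.
\<close>
lemma correlated_score_bound:
  assumes U: "card U \<le> 3 * n" and m: "m \<le> 3 * n"
  shows "(\<integral>\<^sup>+ X. \<integral>\<^sup>+ Z. ennreal (\<Sum>k\<in>U. (\<Sum>i<n. X i $ k * (\<Sum>l\<in>T. X i $ l * (\<Sum>a<n. Z a * X a $ l)))\<^sup>2) \<partial>ZZ \<partial>XX)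
    \<le> ennreal (290 * m * (real n) ^ 3)"
proof -
  let ?\<psi> = "\<lambda>X k a. \<Sum>i<n. X i $ k * (restr (X a) \<bullet> X i)"
  have e: "(\<Sum>i<n. X i $ k * (\<Sum>a<n. Z a * (restr (X a) \<bullet> X i))) = (\<Sum>a<n. Z a * ?\<psi> X k a)" for X Z k
    unfolding sum_distrib_left by (subst sum.swap) (simp add: ac_simps)
  have "(\<integral>\<^sup>+ X. \<integral>\<^sup>+ Z. ennreal (\<Sum>k\<in>U. (\<Sum>i<n. X i $ k * (\<Sum>l\<in>T. X i $ l * (\<Sum>a<n. Z a * X a $ l)))\<^sup>2) \<partial>ZZ \<partial>XX)
     = (\<integral>\<^sup>+ X. (\<Sum>k\<in>U. \<integral>\<^sup>+ Z. ennreal ((\<Sum>a<n. Z a * ?\<psi> X k a)\<^sup>2) \<partial>ZZ) \<partial>XX)"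
    unfolding score_regroup e by (subst nn_integral_sum[symmetric]) auto
  also have "\<dots> = (\<integral>\<^sup>+ X. (\<Sum>k\<in>U. \<Sum>a<n. ennreal ((?\<psi> X k a)\<^sup>2)) \<partial>XX)"
    by (simp add: nn_integral_noise_square sum_nonneg)
  also have "\<dots> = (\<Sum>k\<in>U. \<integral>\<^sup>+ X. (\<Sum>a<n. ennreal ((?\<psi> X k a)\<^sup>2)) \<partial>XX)"
    by (rule nn_integral_sum) measurable
  also have "\<dots> = (\<Sum>k\<in>U. \<Sum>a<n. \<integral>\<^sup>+ X. ennreal ((?\<psi> X k a)\<^sup>2) \<partial>XX)"
    by (intro sum.cong refl nn_integral_sum) measurable
  also have "\<dots> \<le> (\<Sum>k\<in>U. \<Sum>a<n. ennreal (30 * m\<^sup>2 + 6 * n * m + 2 * (real n)\<^sup>2 * (if k \<in> T then 1 else 0)))"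
    by (intro sum_mono gram_square_bound) auto
  also have "\<dots> = ennreal (\<Sum>k\<in>U. n * (30 * m\<^sup>2 + 6 * n * m) + 2 * (real n) ^ 3 * (if k \<in> T then 1 else 0))"
    by (subst sum_ennreal[symmetric]) (auto intro!: sum.cong simp: ennreal_of_nat_eq_real_of_nat 
       power2_eq_square power3_eq_cube algebra_simps simp flip: ennreal_mult'')
  also have "(\<Sum>k\<in>U. n * (30 * m\<^sup>2 + 6 * n * m) + 2 * (real n) ^ 3 * (if k \<in> T then 1 else 0))
      = card U * (n * (30 * m\<^sup>2 + 6 * n * m)) + 2 * (real n) ^ 3 * m"
    using T_sub by (simp add: sum.distrib sum.If_cases Int_absorb1 flip: sum_distrib_left)
  also have "\<dots> \<le> (3 * n) * (n * (30 * (3 * n * m) + 6 * n * m)) + 2 * (real n) ^ 3 * m"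
    using U m by (intro add_right_mono mult_mono mult_left_mono add_mono) (auto simp: power2_eq_square intro!: mult_right_mono)
  also have "\<dots> = 290 * m * (real n) ^ 3" by (simp add: power3_eq_cube algebra_simps)
  finally show ?thesis by (simp add: ennreal_leI)
qed

lemma distr_weighted_sum:
  assumes v: "\<And>j. j \<notin> U \<Longrightarrow> v $ j = 0"
  shows "distr XX borel (\<lambda>X. \<Sum>i<n. Z i * (v \<bullet> X i)) = normal_measure 0 (sqrt (\<Sum>i<n. (Z i)\<^sup>2) * norm v)"
proof -
  have "distr XX borel (\<lambda>X. \<Sum>i<n. (Z i *\<^sub>R v) \<bullet> X i) = normal_measure 0 (sqrt (\<Sum>i<n. (norm (Z i *\<^sub>R v))\<^sup>2))"
  proof (rule distr_sum_normal)
    show "distr G borel (\<lambda>x. (Z i *\<^sub>R v) \<bullet> x) = normal_measure 0 (norm (Z i *\<^sub>R v))" for i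
      by (rule normal_G) (simp add: v)
  qed (auto simp: prob_G)
  then show ?thesis
    by (simp add: power_mult_distrib real_sqrt_mult flip: sum_distrib_right)
qed

text \<open>
  For fixed noise with \<open>S = |z|\<^sup>2\<close> the entries \<open>g\<^sub>k\<close>
  behave as independent normals of variance \<open>S\<close>, so \<open>|g|\<^sup>2\<close> has
  mean \<open>m S\<close> and variance \<open>2 m S\<^sup>2\<close>; the deviation of \<open>m
  S\<close> from \<open>m n\<close> is orthogonal to the rest.
\<close>
lemma score_norm_conditional:
  fixes Z :: "nat \<Rightarrow> real"
  defines "S \<equiv> \<Sum>i<n. (Z i)\<^sup>2"
  shows "(\<integral>\<^sup>+ X. ennreal (((\<Sum>k\<in>T. (\<Sum>i<n. Z i * X i $ k)\<^sup>2) - m * n)\<^sup>2) \<partial>XX) = ennreal (2 * m * S\<^sup>2 + m\<^sup>2 * (S - n)\<^sup>2)"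
proof -
  interpret X: prob_space XX by (rule prob_XX)
  define g where "g k X = (\<Sum>i<n. Z i * X i $ k)" for k and X :: "nat \<Rightarrow> real^'p"
  have gm[measurable]: "g k \<in> borel_measurable XX" for k unfolding g_def by measurable
  have S0: "0 \<le> S" unfolding S_def by (simp add: sum_nonneg)
  have g1: "distr XX borel (g k) = normal_measure 0 (sqrt S)" if "k \<in> U" for k
  proof -
    have "axis k 1 $ j = (0::real)" if "j \<notin> U" for j using that \<open>k \<in> U\<close> by (auto simp: axis_def)
    from distr_weighted_sum[OF this, of Z] show ?thesis
      unfolding g_def S_def by (simp add: inner_axis')
  qed
  have pq: "distr XX borel (\<lambda>X. g k X + g l X) = normal_measure 0 (sqrt 2 * sqrt S)"
    "distr XX borel (\<lambda>X. g k X - g l X) = normal_measure 0 (sqrt 2 * sqrt S)" if "k \<in> U" "l \<in> U" "k \<noteq> l" for k l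
  proof -
    have n: "norm (axis k 1 + axis l 1 :: real^'p) = sqrt 2" "norm (axis k 1 - axis l 1 :: real^'p) = sqrt 2"
      using that by (auto simp: norm_eq_sqrt_inner inner_add_left inner_add_right inner_diff_left inner_diff_right inner_axis_axis)
    have z: "(axis k 1 + axis l 1 :: real^'p) $ j = 0" "(axis k 1 - axis l 1 :: real^'p) $ j = 0" if "j \<notin> U" for j
      using that \<open>k \<in> U\<close> \<open>l \<in> U\<close> by (auto simp: axis_def)
    show "distr XX borel (\<lambda>X. g k X + g l X) = normal_measure 0 (sqrt 2 * sqrt S)"
      using distr_weighted_sum[of "axis k 1 + axis l 1" Z, OF z(1)] unfolding n g_def S_def
      by (simp add: inner_add_left inner_axis' distrib_left sum.distrib mult.commute)
    show "distr XX borel (\<lambda>X. g k X - g l X) = normal_measure 0 (sqrt 2 * sqrt S)"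
      using distr_weighted_sum[of "axis k 1 - axis l 1" Z, OF z(2)] unfolding n g_def S_def
      by (simp add: inner_diff_left inner_axis' right_diff_distrib sum_subtractf mult.commute)
  qed
  have TU: "k \<in> U" if "k \<in> T" for k using that T_sub by auto
  note mo = moments_of_normal[OF gm g1[OF TU]]
  have s4: "sqrt S ^ 4 = S\<^sup>2" "(sqrt S)\<^sup>2 = S"
    using S0 by (simp_all add: power4_eq_xxxx power2_eq_square)
  define D where "D k X = (g k X)\<^sup>2 - S" for k X
  have D1: "integrable XX (D k)" "(\<integral>X. D k X \<partial>XX) = 0" if "k \<in> T" for k
    unfolding D_def using mo(1)[OF that, of 2] mo(3)[OF that] S0 by (auto simp: X.prob_space)
  have De: "D k X * D l X = (g k X)\<^sup>2 * (g l X)\<^sup>2 - S * (g k X)\<^sup>2 - S * (g l X)\<^sup>2 + S\<^sup>2" for k l X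
    unfolding D_def by (simp add: power2_eq_square algebra_simps)
  have gg: "integrable XX (\<lambda>X. (g k X)\<^sup>2 * (g l X)\<^sup>2)" 
    "(\<integral>X. (g k X)\<^sup>2 * (g l X)\<^sup>2 \<partial>XX) = (if k = l then 3 else 1) * S\<^sup>2" if "k \<in> T" "l \<in> T" for k l
  proof -
    have "integrable XX (\<lambda>X. (g k X)\<^sup>2 * (g l X)\<^sup>2) \<and> (\<integral>X. (g k X)\<^sup>2 * (g l X)\<^sup>2 \<partial>XX) = (if k = l then 3 else 1) * S\<^sup>2"
    proof (cases "k = l")
      case True
      have "(g l X)\<^sup>2 * (g l X)\<^sup>2 = (g l X) ^ 4" for X by (simp add: power4_eq_xxxx power2_eq_square)
      then show ?thesis using True mo(1)[OF that(2), of 4] mo(4)[OF that(2)] s4 by simp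
    next
      case False
      then show ?thesis 
        using normal_pair_moments[OF prob_XX gm g1[OF TU] gm g1[OF TU] pq[OF TU TU], OF that that False that False] s4 by simp
    qed
    then show "integrable XX (\<lambda>X. (g k X)\<^sup>2 * (g l X)\<^sup>2)" 
      "(\<integral>X. (g k X)\<^sup>2 * (g l X)\<^sup>2 \<partial>XX) = (if k = l then 3 else 1) * S\<^sup>2" by auto
  qed
  have DD: "integrable XX (\<lambda>X. D k X * D l X)" "(\<integral>X. D k X * D l X \<partial>XX) = (if k = l then 2 * S\<^sup>2 else 0)"
    if "k \<in> T" "l \<in> T" for k l
    unfolding De using gg[OF that] mo(1)[OF that(1), of 2] mo(1)[OF that(2), of 2] mo(3)[OF that(1)] mo(3)[OF that(2)] S0
    by (auto simp: X.prob_space power2_eq_square)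
  have e: "((\<Sum>k\<in>T. (g k X)\<^sup>2) - m * n)\<^sup>2 = (\<Sum>k\<in>T. \<Sum>l\<in>T. D k X * D l X) + 2 * (m * (S - n)) * (\<Sum>k\<in>T. D k X) + (m * (S - n))\<^sup>2" for X
  proof -
    have "(\<Sum>k\<in>T. (g k X)\<^sup>2) - m * n = (\<Sum>k\<in>T. D k X) + m * (S - n)"
      by (simp add: D_def sum_subtractf algebra_simps)
    moreover have "(\<Sum>k\<in>T. \<Sum>l\<in>T. D k X * D l X) = (\<Sum>k\<in>T. D k X) * (\<Sum>k\<in>T. D k X)"
      by (simp add: sum_product)
    ultimately show ?thesis by (simp only:) (simp add: power2_eq_square algebra_simps)
  qed
  have I: "integrable XX (\<lambda>X. ((\<Sum>k\<in>T. (g k X)\<^sup>2) - m * n)\<^sup>2)"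
    unfolding e using DD(1) D1(1) by auto
  have "(\<integral>X. ((\<Sum>k\<in>T. (g k X)\<^sup>2) - m * n)\<^sup>2 \<partial>XX) = (\<Sum>k\<in>T. \<Sum>l\<in>T. if k = l then 2 * S\<^sup>2 else 0) + (m * (S - n))\<^sup>2"
    unfolding e using DD D1 by (simp add: Bochner_Integration.integral_sum X.prob_space)
  also have "\<dots> = 2 * m * S\<^sup>2 + m\<^sup>2 * (S - n)\<^sup>2"
    by (simp add: power_mult_distrib)
  finally show ?thesis
    using I unfolding g_def by (subst nn_integral_eq_integral) auto
qed

text \<open>
  The two terms are the fluctuation of \<open>|g|\<^sup>2\<close> given the noise and the
  fluctuation of \<open>|z|\<^sup>2\<close>. They are small compared with \<open>m\<^sup>2
  n\<^sup>2\<close> because both \<open>m\<close> and \<open>n\<close> are large.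
\<close>
lemma score_norm_bound:
  "(\<integral>\<^sup>+ X. \<integral>\<^sup>+ Z. ennreal (((\<Sum>k\<in>T. (\<Sum>i<n. Z i * X i $ k)\<^sup>2) - m * n)\<^sup>2) \<partial>ZZ \<partial>XX)
    \<le> ennreal (2 * m * ((real n)\<^sup>2 + 2 * n) + 2 * m\<^sup>2 * n)"
proof -
  interpret X: prob_space XX by (rule prob_XX)
  interpret Z: prob_space ZZ by (rule prob_ZZ)
  interpret XZ: pair_prob_space XX ZZ ..
  have "(\<integral>\<^sup>+ X. \<integral>\<^sup>+ Z. ennreal (((\<Sum>k\<in>T. (\<Sum>i<n. Z i * X i $ k)\<^sup>2) - m * n)\<^sup>2) \<partial>ZZ \<partial>XX)
      = (\<integral>\<^sup>+ Z. \<integral>\<^sup>+ X. ennreal (((\<Sum>k\<in>T. (\<Sum>i<n. Z i * X i $ k)\<^sup>2) - m * n)\<^sup>2) \<partial>XX \<partial>ZZ)"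
    by (rule XZ.Fubini'[symmetric]) measurable
  also have "\<dots> = (\<integral>\<^sup>+ Z. ennreal (2 * m * (\<Sum>i<n. (Z i)\<^sup>2)\<^sup>2 + m\<^sup>2 * ((\<Sum>i<n. (Z i)\<^sup>2 - 1))\<^sup>2) \<partial>ZZ)"
    by (simp add: score_norm_conditional sum_subtractf)
  also have "\<dots> \<le> ennreal (2 * m * ((real n)\<^sup>2 + 2 * n) + 2 * m\<^sup>2 * n)"
  proof (rule nn_integral_le_of_integral)
    have z4: "integrable std_normal (\<lambda>z. (z\<^sup>2)\<^sup>2)" "(\<integral>z. (z\<^sup>2)\<^sup>2 \<partial>std_normal) = 3"
      using std_normal_moments(1)[of 4] std_normal_moments(4) by (simp_all flip: power_mult)
    have z2: "integrable std_normal (\<lambda>z. z\<^sup>2)" using std_normal_moments(1) .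
    have e: "(z\<^sup>2 - 1)\<^sup>2 = (z\<^sup>2)\<^sup>2 - 2 * z\<^sup>2 + 1" for z :: real by (simp add: power2_diff)
    interpret N: prob_space std_normal by (rule prob_space_std_normal)
    have y4: "integrable std_normal (\<lambda>z. (z\<^sup>2 - 1)\<^sup>2)" "(\<integral>z. (z\<^sup>2 - 1)\<^sup>2 \<partial>std_normal) = 2"
      unfolding e using z4 z2 std_normal_moments(3) N.prob_space by (simp_all del: integral_density)
    have y2: "(\<integral>z. z\<^sup>2 - 1 \<partial>std_normal) = 0"
      using z2 std_normal_moments(3) N.prob_space by (simp del: integral_density)
    note a = second_moment_sum[of "{..<n}" std_normal "\<lambda>_ z. z\<^sup>2", OF _ prob_space_std_normal _ z4(1)]
    note b = second_moment_sum[of "{..<n}" std_normal "\<lambda>_ z. z\<^sup>2 - 1", OF _ prob_space_std_normal _ y4(1)]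
    show "integrable ZZ (\<lambda>Z. 2 * m * (\<Sum>i<n. (Z i)\<^sup>2)\<^sup>2 + m\<^sup>2 * ((\<Sum>i<n. (Z i)\<^sup>2 - 1))\<^sup>2)"
      using a(1) b(1) by auto
    show "(\<integral>Z. 2 * m * (\<Sum>i<n. (Z i)\<^sup>2)\<^sup>2 + m\<^sup>2 * ((\<Sum>i<n. (Z i)\<^sup>2 - 1))\<^sup>2 \<partial>ZZ) \<le> 2 * m * ((real n)\<^sup>2 + 2 * n) + 2 * m\<^sup>2 * n"
      using a b by (simp add: z4 y4 y2 std_normal_moments(3,4) algebra_simps del: integral_density)
  qed auto
  finally show ?thesis .
qed

lemma typical_measurable: "{w \<in> space (XX \<Otimes>\<^sub>M ZZ). typical n U T (fst w) (snd w)} \<in> sets (XX \<Otimes>\<^sub>M ZZ)"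
  unfolding typical_def Let_def by measurable

text \<open>
  Each statistic is divided by its admissible bound. The expectations of the quotients add up to
  less than \<open>1/2\<close>, so by Markov's inequality their sum stays below \<open>1\<close>
  with probability at least \<open>1/2\<close>, and then so does each of them.
\<close>
lemma typical_prob:
  assumes n: "30 \<le> n" and m: "90 \<le> card T" "card T \<le> 3 * n" and U: "card U \<le> 3 * n"
  shows "1 / 2 \<le> measure (XX \<Otimes>\<^sub>M ZZ) {w \<in> space (XX \<Otimes>\<^sub>M ZZ). typical n U T (fst w) (snd w)}"
proof -
  interpret X: prob_space XX by (rule prob_XX)
  interpret Z: prob_space ZZ by (rule prob_ZZ)
  interpret XZ: pair_prob_space XX ZZ ..
  have U0: "U \<noteq> {}" using m(1) T_sub by auto
  have mp: "m > 0" and np: "real n > 0" using m n by auto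
  define Q1 where "Q1 X Z = ((\<Sum>k\<in>T. (\<Sum>i<n. Z i * X i $ k)\<^sup>2) - m * n)\<^sup>2" for X :: "nat \<Rightarrow> real^'p" and Z :: "nat \<Rightarrow> real"
  define Q2 where "Q2 X Z = (\<Sum>k\<in>T. \<Sum>i<n. Z i * X i $ k)\<^sup>2" for X :: "nat \<Rightarrow> real^'p" and Z :: "nat \<Rightarrow> real"
  define Q3 where "Q3 X = (\<Sum>i<n. (oneT \<bullet> X i)\<^sup>2)" for X :: "nat \<Rightarrow> real^'p"
  define Q4 where "Q4 X = (\<Sum>k\<in>U. (\<Sum>i<n. X i $ k * (oneT \<bullet> X i))\<^sup>2)" for X :: "nat \<Rightarrow> real^'p"
  define Q5 where "Q5 X Z = (\<Sum>i<n. (\<Sum>l\<in>T. X i $ l * (\<Sum>a<n. Z a * X a $ l))\<^sup>2)" for X :: "nat \<Rightarrow> real^'p" and Z :: "nat \<Rightarrow> real"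
  define Q6 where "Q6 X Z = (\<Sum>k\<in>U. (\<Sum>i<n. X i $ k * (\<Sum>l\<in>T. X i $ l * (\<Sum>a<n. Z a * X a $ l)))\<^sup>2)" for X :: "nat \<Rightarrow> real^'p" and Z :: "nat \<Rightarrow> real"
  have [measurable]: "(\<lambda>w. Q1 (fst w) (snd w)) \<in> borel_measurable (XX \<Otimes>\<^sub>M ZZ)"
    "(\<lambda>w. Q2 (fst w) (snd w)) \<in> borel_measurable (XX \<Otimes>\<^sub>M ZZ)"
    "Q3 \<in> borel_measurable XX" "Q4 \<in> borel_measurable XX"
    "(\<lambda>w. Q5 (fst w) (snd w)) \<in> borel_measurable (XX \<Otimes>\<^sub>M ZZ)"
    "(\<lambda>w. Q6 (fst w) (snd w)) \<in> borel_measurable (XX \<Otimes>\<^sub>M ZZ)"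
    unfolding Q1_def Q2_def Q3_def Q4_def Q5_def Q6_def by measurable
  have nonneg: "0 \<le> Q1 X Z" "0 \<le> Q2 X Z" "0 \<le> Q3 X" "0 \<le> Q4 X" "0 \<le> Q5 X Z" "0 \<le> Q6 X Z" for X Z
    unfolding Q1_def Q2_def Q3_def Q4_def Q5_def Q6_def by (auto intro!: sum_nonneg)
  define t1 t2 t3 t4 t5 t6 where "t1 = (3/5 * m * n)\<^sup>2" and "t2 = 16 * m * n" and "t3 = 25 * m * n"
    and "t4 = 250 * m * (real n)\<^sup>2" and "t5 = 500 * m * (real n)\<^sup>2" and "t6 = 7250 * m * (real n) ^ 3"
  have tp: "t1 > 0" "t2 > 0" "t3 > 0" "t4 > 0" "t5 > 0" "t6 > 0"
    using mp np by (auto simp: t1_def t2_def t3_def t4_def t5_def t6_def)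
  define W where "W w = Q1 (fst w) (snd w) / t1 + Q2 (fst w) (snd w) / t2 + Q3 (fst w) / t3 + Q4 (fst w) / t4
      + Q5 (fst w) (snd w) / t5 + Q6 (fst w) (snd w) / t6" for w
  have [measurable]: "W \<in> borel_measurable (XX \<Otimes>\<^sub>M ZZ)" unfolding W_def by measurable
  have part: "(\<integral>\<^sup>+ w. ennreal (Q (fst w) (snd w) / t) \<partial>(XX \<Otimes>\<^sub>M ZZ)) \<le> ennreal (b / t)"
    if [measurable]: "(\<lambda>w. Q (fst w) (snd w)) \<in> borel_measurable (XX \<Otimes>\<^sub>M ZZ)" and nn: "\<And>X Z. 0 \<le> Q X Z" and "t > 0"
      and B: "(\<integral>\<^sup>+ X. \<integral>\<^sup>+ Z. ennreal (Q X Z) \<partial>ZZ \<partial>XX) \<le> ennreal b" for Q t b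
  proof -
    have "(\<integral>\<^sup>+ w. ennreal (Q (fst w) (snd w) / t) \<partial>(XX \<Otimes>\<^sub>M ZZ)) = (\<integral>\<^sup>+ w. ennreal (1 / t) * ennreal (Q (fst w) (snd w)) \<partial>(XX \<Otimes>\<^sub>M ZZ))"
      using \<open>t > 0\<close> nn by (intro nn_integral_cong) (simp flip: ennreal_mult'')
    also have "\<dots> = ennreal (1 / t) * (\<integral>\<^sup>+ w. ennreal (Q (fst w) (snd w)) \<partial>(XX \<Otimes>\<^sub>M ZZ))"
      by (rule nn_integral_cmult) measurable
    also have "(\<integral>\<^sup>+ w. ennreal (Q (fst w) (snd w)) \<partial>(XX \<Otimes>\<^sub>M ZZ)) = (\<integral>\<^sup>+ X. \<integral>\<^sup>+ Z. ennreal (Q X Z) \<partial>ZZ \<partial>XX)"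
      by (subst Z.nn_integral_fst[symmetric]) auto
    also have "ennreal (1 / t) * \<dots> \<le> ennreal (1 / t) * ennreal b" using B by (intro mult_left_mono) auto
    also have "\<dots> = ennreal (b / t)" using \<open>t > 0\<close> by (simp flip: ennreal_mult')
    finally show ?thesis .
  qed
  note p1 = part[OF _ nonneg(1) tp(1) score_norm_bound[folded Q1_def]]
  note p2 = part[OF _ nonneg(2) tp(2) score_sum_bound[folded Q2_def]]
  note p3 = part[of "\<lambda>X Z. Q3 X", OF _ nonneg(3) tp(3), of "m * n"]
  note p4 = part[of "\<lambda>X Z. Q4 X", OF _ nonneg(4) tp(4), of "10 * m * (real n)\<^sup>2"]
  note p5 = part[OF _ nonneg(5) tp(5) fitted_score_bound[folded Q5_def, OF U0]]
  note p6 = part[OF _ nonneg(6) tp(6) correlated_score_bound[folded Q6_def, OF U]]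
  define b1 where "b1 = 2 * m * ((real n)\<^sup>2 + 2 * n) + 2 * m\<^sup>2 * n"
  have "(\<integral>\<^sup>+ w. ennreal (W w) \<partial>(XX \<Otimes>\<^sub>M ZZ))
    \<le> ennreal (b1 / t1) + ennreal (m * n / t2) + ennreal (m * n / t3) + ennreal (10 * m * (real n)\<^sup>2 / t4)
      + ennreal (10 * m * (real n)\<^sup>2 / t5) + ennreal (290 * m * (real n) ^ 3 / t6)"
  proof -
    have "(\<integral>\<^sup>+ w. ennreal (W w) \<partial>(XX \<Otimes>\<^sub>M ZZ)) = (\<integral>\<^sup>+ w. ennreal (Q1 (fst w) (snd w) / t1) + ennreal (Q2 (fst w) (snd w) / t2)
        + ennreal (Q3 (fst w) / t3) + ennreal (Q4 (fst w) / t4) + ennreal (Q5 (fst w) (snd w) / t5) + ennreal (Q6 (fst w) (snd w) / t6) \<partial>(XX \<Otimes>\<^sub>M ZZ))"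
      unfolding W_def using nonneg tp by (intro nn_integral_cong) (simp add: ennreal_plus)
    also have "\<dots> = (\<integral>\<^sup>+ w. ennreal (Q1 (fst w) (snd w) / t1) \<partial>(XX \<Otimes>\<^sub>M ZZ)) + (\<integral>\<^sup>+ w. ennreal (Q2 (fst w) (snd w) / t2) \<partial>(XX \<Otimes>\<^sub>M ZZ))
        + (\<integral>\<^sup>+ w. ennreal (Q3 (fst w) / t3) \<partial>(XX \<Otimes>\<^sub>M ZZ)) + (\<integral>\<^sup>+ w. ennreal (Q4 (fst w) / t4) \<partial>(XX \<Otimes>\<^sub>M ZZ))
        + (\<integral>\<^sup>+ w. ennreal (Q5 (fst w) (snd w) / t5) \<partial>(XX \<Otimes>\<^sub>M ZZ)) + (\<integral>\<^sup>+ w. ennreal (Q6 (fst w) (snd w) / t6) \<partial>(XX \<Otimes>\<^sub>M ZZ))"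
      by (simp add: nn_integral_add)
    also have "\<dots> \<le> ennreal (b1 / t1) + ennreal (m * n / t2) + ennreal (m * n / t3) + ennreal (10 * m * (real n)\<^sup>2 / t4)
      + ennreal (10 * m * (real n)\<^sup>2 / t5) + ennreal (290 * m * (real n) ^ 3 / t6)"
      unfolding b1_def
      by (intro add_mono p1 p2 p3 p4 p5 p6)
        (use m column_sums_bound gram_column_bound[OF U U0] n in \<open>auto simp: Q3_def Q4_def Z.emeasure_space_1\<close>)
    finally show ?thesis .
  qed
  also have "\<dots> \<le> ennreal (1 / 2)"
  proof -
    \<comment> \<open>dividing by \<open>m n\<close>, the claim is a bound on \<open>2/m + 2/n + 4/(m n)\<close>; the constant \<open>117/1250\<close> is \<open>0.26\<close> times \<open>(3/5)\<^sup>2\<close>\<close>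
    have "90 * real n \<le> m * n" "m * 30 \<le> m * n" "90 * 30 \<le> m * n"
      using m n by (intro mult_mono; simp)+
    then have "2 * (real n + 2) + 2 * m \<le> 117 / 1250 * (m * n)" by simp
    then have "m * n * (2 * (real n + 2) + 2 * m) \<le> m * n * (117 / 1250 * (m * n))"
      using mp np by (intro mult_left_mono) auto
    then have "b1 \<le> 26 / 100 * t1"
      unfolding b1_def t1_def by (simp add: power2_eq_square algebra_simps)
    then have "b1 / t1 \<le> 26 / 100" using tp by (simp add: pos_divide_le_eq)
    moreover have "m * n / t2 = 1 / 16" "m * n / t3 = 1 / 25" "10 * m * (real n)\<^sup>2 / t4 = 1 / 25"
      "10 * m * (real n)\<^sup>2 / t5 = 1 / 50" "290 * m * (real n) ^ 3 / t6 = 1 / 25"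
      using mp np by (auto simp: t2_def t3_def t4_def t5_def t6_def)
    moreover have "0 \<le> b1 / t1" using tp mp np by (auto simp: b1_def)
    ultimately have le: "b1 / t1 + m * n / t2 + m * n / t3 + 10 * m * (real n)\<^sup>2 / t4
        + 10 * m * (real n)\<^sup>2 / t5 + 290 * m * (real n) ^ 3 / t6 \<le> 1 / 2"
      and nn: "0 \<le> b1 / t1" by linarith+
    have "ennreal (b1 / t1) + ennreal (m * n / t2) + ennreal (m * n / t3) + ennreal (10 * m * (real n)\<^sup>2 / t4)
      + ennreal (10 * m * (real n)\<^sup>2 / t5) + ennreal (290 * m * (real n) ^ 3 / t6)
      = ennreal (b1 / t1 + m * n / t2 + m * n / t3 + 10 * m * (real n)\<^sup>2 / t4
        + 10 * m * (real n)\<^sup>2 / t5 + 290 * m * (real n) ^ 3 / t6)"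
      using nn mp np tp by (simp add: ennreal_plus[symmetric] del: ennreal_plus)
    then show ?thesis using ennreal_leI[OF le] by simp
  qed
  finally have EW: "(\<integral>\<^sup>+ w. ennreal (W w) \<partial>(XX \<Otimes>\<^sub>M ZZ)) \<le> ennreal (1 / 2)" .
  let ?A = "{w \<in> space (XX \<Otimes>\<^sub>M ZZ). typical n U T (fst w) (snd w)}"
  let ?B = "{w \<in> space (XX \<Otimes>\<^sub>M ZZ). 1 \<le> W w}"
  have AB: "space (XX \<Otimes>\<^sub>M ZZ) - ?B \<subseteq> ?A"
  proof
    fix w assume w: "w \<in> space (XX \<Otimes>\<^sub>M ZZ) - ?B"
    obtain X Z where wX: "w = (X, Z)" by (cases w)
    have "W w < 1" using w by auto
    then have l: "Q1 X Z / t1 + Q2 X Z / t2 + Q3 X / t3 + Q4 X / t4 + Q5 X Z / t5 + Q6 X Z / t6 < 1"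
      by (simp add: W_def wX)
    have nn: "0 \<le> Q1 X Z / t1" "0 \<le> Q2 X Z / t2" "0 \<le> Q3 X / t3" "0 \<le> Q4 X / t4" "0 \<le> Q5 X Z / t5" "0 \<le> Q6 X Z / t6"
      using nonneg tp by auto
    have "Q1 X Z / t1 \<le> 1" "Q2 X Z / t2 \<le> 1" "Q3 X / t3 \<le> 1" "Q4 X / t4 \<le> 1" "Q5 X Z / t5 \<le> 1" "Q6 X Z / t6 \<le> 1"
      using l nn by linarith+
    then have "Q1 X Z \<le> t1" "Q2 X Z \<le> t2" "Q3 X \<le> t3" "Q4 X \<le> t4" "Q5 X Z \<le> t5" "Q6 X Z \<le> t6"
      using tp by (auto simp: pos_divide_le_eq)
    then have "typical n U T X Z"
      unfolding typical_def Let_def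
      by (simp add: Q1_def Q2_def Q3_def Q4_def Q5_def Q6_def t1_def t2_def t3_def t4_def t5_def t6_def oneT_inner)
    then show "w \<in> ?A" using w wX by auto
  qed
  have "emeasure (XX \<Otimes>\<^sub>M ZZ) ?B \<le> (\<integral>\<^sup>+ w. ennreal (W w) \<partial>(XX \<Otimes>\<^sub>M ZZ))"
  proof -
    have "emeasure (XX \<Otimes>\<^sub>M ZZ) ?B = (\<integral>\<^sup>+ w. indicator ?B w \<partial>(XX \<Otimes>\<^sub>M ZZ))"
      by (rule nn_integral_indicator[symmetric]) measurable
    also have "\<dots> \<le> (\<integral>\<^sup>+ w. ennreal (W w) \<partial>(XX \<Otimes>\<^sub>M ZZ))"
      by (intro nn_integral_mono) (auto simp: indicator_def ennreal_ge_1)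
    finally show ?thesis .
  qed
  then have "emeasure (XX \<Otimes>\<^sub>M ZZ) ?B \<le> ennreal (1 / 2)"
    using EW by (rule order_trans)
  then have B: "measure (XX \<Otimes>\<^sub>M ZZ) ?B \<le> 1 / 2"
    unfolding XZ.emeasure_eq_measure by (subst (asm) ennreal_le_iff) auto
  have "1 / 2 \<le> measure (XX \<Otimes>\<^sub>M ZZ) (space (XX \<Otimes>\<^sub>M ZZ) - ?B)"
    using B by (subst XZ.prob_compl) auto
  also have "\<dots> \<le> measure (XX \<Otimes>\<^sub>M ZZ) ?A"
    using AB typical_measurable by (intro XZ.finite_measure_mono) auto
  finally show ?thesis .
qed

end

section \<open>Constrained least squares\<close>

lemma norm_le_l1_norm: "norm \<beta> \<le> l1_norm \<beta>"
  unfolding l1_norm_def by (rule norm_le_l1_cart)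

lemma norm_vec_squared: "(norm (x :: real^'p))\<^sup>2 = (\<Sum>k\<in>UNIV. (x $ k)\<^sup>2)"
  by (simp add: norm_vec_def L2_set_def sum_nonneg)

lemma continuous_l1_norm: "continuous_on A l1_norm"
  unfolding l1_norm_def by (intro continuous_intros)

lemma continuous_rss: "continuous_on A (rss n s)"
  unfolding rss_def by (intro continuous_intros)

lemma lasso_minimizers_iff:
  "\<beta> \<in> lasso_minimizers n s B \<longleftrightarrow> l1_norm \<beta> \<le> B \<and> (\<forall>\<beta>'. l1_norm \<beta>' \<le> B \<longrightarrow> rss n s \<beta> \<le> rss n s \<beta>')"
  unfolding lasso_minimizers_def is_arg_min_linorder by auto

text \<open>
  As long as no sign changes, the \<open>\<ell>\<^sub>1\<close> norm is linear.
\<close>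
lemma abs_add_sgn:
  fixes x y :: real
  assumes "\<bar>y\<bar> \<le> \<bar>x\<bar>"
  shows "\<bar>x + y\<bar> = \<bar>x\<bar> + sgn x * y"
  using assms by (cases x "0 :: real" rule: linorder_cases) auto

text \<open>
  The minimizers form a compact set. Taking an extremal one replaces the construction of a bad
  minimizer by an argument by contradiction.
\<close>
lemma exists_extremal_minimizer:
  fixes f :: "real^'p \<Rightarrow> real"
  assumes B: "0 \<le> B" and f: "continuous_on UNIV f"
  shows "\<exists>\<beta>\<in>lasso_minimizers n s B. \<forall>\<beta>'\<in>lasso_minimizers n s B. f \<beta>' \<le> f \<beta>"
proof -
  let ?C = "{\<beta> :: real^'p. l1_norm \<beta> \<le> B}"
  have "closed ?C"
    by (intro closed_Collect_le continuous_l1_norm continuous_intros)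
  moreover have "bounded ?C"
    using norm_le_l1_norm by (auto simp: bounded_iff intro: order_trans)
  ultimately have C: "compact ?C" by (simp add: compact_eq_bounded_closed)
  have "0 \<in> ?C" using B by (simp add: l1_norm_def)
  then obtain \<beta>0 where b0: "\<beta>0 \<in> ?C" "\<forall>\<beta>\<in>?C. rss n s \<beta>0 \<le> rss n s \<beta>"
    using continuous_attains_inf[OF C _ continuous_rss] by blast
  have e: "lasso_minimizers n s B = ?C \<inter> {\<beta>. rss n s \<beta> \<le> rss n s \<beta>0}"
    using b0 by (force simp: lasso_minimizers_iff)
  have "compact (lasso_minimizers n s B)"
    unfolding e using C by (intro compact_Int_closed closed_Collect_le continuous_rss continuous_intros)
  moreover have "\<beta>0 \<in> lasso_minimizers n s B" using b0 by (simp add: lasso_minimizers_iff)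
  ultimately show ?thesis
    using continuous_attains_sup[of "lasso_minimizers n s B" f] continuous_on_subset[OF f] by blast
qed

text \<open>
  Fewer linear conditions than free coordinates: project the conditions to the coordinate
  subspace of \<open>A\<close> and compare dimensions.
\<close>
lemma exists_orthogonal_supported:
  fixes C :: "(real^'p) set" and A :: "'p set"
  assumes "finite C" "card C < card A"
  shows "\<exists>v. v \<noteq> 0 \<and> (\<forall>j. j \<notin> A \<longrightarrow> v $ j = 0) \<and> (\<forall>x\<in>C. x \<bullet> v = 0)"
proof -
  define P :: "real^'p \<Rightarrow> real^'p" where "P x = (\<chi> j. if j \<in> A then x $ j else 0)" for x
  define E where "E = (\<lambda>j. axis j (1::real)) ` A"
  have inj: "inj_on (\<lambda>j. axis j (1::real)) A" by (auto simp: inj_on_def axis_eq_axis)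
  have PE: "P x \<in> span E" for x
  proof -
    have "P x = (\<Sum>j\<in>A. x $ j *\<^sub>R axis j 1)"
      by (auto simp: P_def vec_eq_iff axis_def if_distrib[where f="\<lambda>y. _ * y"] cong: if_cong)
    also have "\<dots> \<in> span E" unfolding E_def by (intro span_sum span_scale span_base) auto
    finally show ?thesis .
  qed
  have indep: "independent E" unfolding E_def
    by (rule independent_mono[OF independent_Basis]) (auto simp: Basis_vec_def)
  have "dim (span (P ` C)) \<le> card (P ` C)"
    using assms(1) by (simp add: dim_le_card')
  also have "\<dots> \<le> card C" using assms(1) by (rule card_image_le)
  also have "\<dots> < card A" by fact
  also have "\<dots> = dim (span E)"
    using indep by (simp add: dim_eq_card_independent E_def card_image[OF inj])
  finally have "dim (span (P ` C)) < dim (span E)" .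
  moreover have "span (P ` C) \<subseteq> span E" by (rule span_minimal) (use PE in auto)
  ultimately have "span (P ` C) \<subset> span E" by (metis less_irrefl psubsetI)
  then obtain v where v: "v \<noteq> 0" "v \<in> span E" "\<And>y. y \<in> span (P ` C) \<Longrightarrow> orthogonal v y"
    by (rule orthogonal_to_subspace_exists_gen) auto
  have vA: "v $ j = 0" if "j \<notin> A" for j
  proof -
    have "span E \<subseteq> {v. v $ j = 0}"
      by (rule span_minimal) (use that in \<open>auto simp: E_def axis_def subspace_def\<close>)
    then show ?thesis using v(2) by auto
  qed
  have "x \<bullet> v = 0" if "x \<in> C" for x
  proof -
    have "x \<bullet> v = P x \<bullet> v"
      unfolding inner_vec_def by (intro sum.cong) (auto simp: P_def vA)
    also have "\<dots> = 0" using v(3)[of "P x"] that by (auto simp: orthogonal_def inner_commute intro: span_base)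
    finally show ?thesis .
  qed
  then show ?thesis using v(1) vA by blast
qed

section \<open>The design with a composite feature\<close>

text \<open>
  Features \<open>j1\<close> and \<open>j2\<close> carry the signal, \<open>j3\<close> is the
  composite and \<open>K\<close> holds the features that correct it. The bound on
  \<open>\<Sum>c\<close> makes the composite no more expensive than the features it replaces,
  and the bound on \<open>\<Sum>c\<^sup>2\<close> keeps its variance at most \<open>1\<close>,
  whence the spectral norm at most \<open>2\<close>.
\<close>
locale lasso_design =
  fixes j1 j2 j3 :: "'p::finite" and K :: "'p set" and c :: "'p \<Rightarrow> real"
  assumes distinct: "j1 \<noteq> j2" "j1 \<noteq> j3" "j2 \<noteq> j3" "j1 \<notin> K" "j2 \<notin> K" "j3 \<notin> K"
    and c_nonneg: "\<And>k. 0 \<le> c k" and c_outside: "\<And>k. k \<notin> K \<Longrightarrow> c k = 0"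
    and c_sum: "(\<Sum>k\<in>K. c k) \<le> 2 / 5" and c_square_sum: "(\<Sum>k\<in>K. (c k)\<^sup>2) \<le> 1 / 50"
begin

definition U where "U = insert j1 (insert j2 K)"

definition composite :: "real^'p" where
  "composite = (\<chi> k. if k = j1 \<or> k = j2 then 7 / 10 else - c k)"

text \<open>
  The rows are the latent coordinates of the features, so that \<open>V V\<^sup>T\<close> is the
  covariance. Features outside \<open>U\<close> other than \<open>j3\<close> vanish identically.
\<close>
definition V :: "real^'p^'p" where
  "V = (\<chi> i j. if i = j3 then composite $ j else if i \<in> U \<and> i = j then 1 else 0)"

text \<open>
  The predictor expressed in the latent independent coordinates: two coefficient vectors predict
  the same values almost surely if and only if they have the same image.
\<close>
definition latent :: "real^'p \<Rightarrow> real^'p" where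
  "latent \<beta> = transpose V *v \<beta>"

definition truth :: "real^'p" where
  "truth = (\<chi> k. if k = j1 \<or> k = j2 then 1 / 2 else 0)"

text \<open>
  A null vector of \<open>latent\<close>: adding it moves weight from \<open>j1\<close> and
  \<open>j2\<close> to the composite without changing predictions.
\<close>
definition \<nu> :: "real^'p" where "\<nu> = axis j3 1 - composite"

text \<open>
  The linear relations among the features that hold almost surely.
\<close>
definition consistent :: "real^'p \<Rightarrow> bool" where
  "consistent x \<longleftrightarrow> \<nu> \<bullet> x = 0 \<and> (\<forall>k. k \<notin> U \<longrightarrow> k \<noteq> j3 \<longrightarrow> x $ k = 0)"

lemma j3_U: "j3 \<notin> U" and K_U: "K \<subseteq> U" using distinct by (auto simp: U_def)

lemma composite_nth: "composite $ j1 = 7/10" "composite $ j2 = 7/10" "composite $ j3 = 0"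
  "k \<in> K \<Longrightarrow> composite $ k = - c k" "k \<notin> U \<Longrightarrow> composite $ k = 0"
  using distinct c_outside by (auto simp: composite_def U_def)

lemma latent_nth: "latent \<beta> $ k = (if k \<in> U then \<beta> $ k else 0) + \<beta> $ j3 * composite $ k"
proof -
  have "latent \<beta> $ k = (\<Sum>i\<in>UNIV. V $ i $ k * \<beta> $ i)"
    by (simp add: latent_def matrix_vector_mult_def transpose_def)
  also have "\<dots> = (\<Sum>i\<in>UNIV. (if i = j3 then composite $ k * \<beta> $ i else 0) + (if i = k then if k \<in> U then \<beta> $ k else 0 else 0))"
    using j3_U by (intro sum.cong) (auto simp: V_def)
  finally show ?thesis by (simp add: sum.distrib mult.commute)
qed

lemma latent_linear: "linear latent" unfolding latent_def by (rule matrix_vector_mul_linear)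

lemma latent_null: "latent \<nu> = 0"
  using j3_U composite_nth by (auto simp: vec_eq_iff latent_nth \<nu>_def axis_def)

lemma latent_axis_outside: "k \<notin> U \<Longrightarrow> k \<noteq> j3 \<Longrightarrow> latent (axis k 1) = 0"
  by (auto simp: vec_eq_iff latent_nth axis_def)

lemma latent_supported:
  assumes "\<And>k. k \<notin> U \<Longrightarrow> \<eta> $ k = 0" shows "latent \<eta> = \<eta>"
  using assms j3_U by (auto simp: vec_eq_iff latent_nth)

lemma consistent_inner:
  assumes "consistent x"
  shows "x \<bullet> \<beta> = x \<bullet> latent \<beta>"
proof -
  have x3: "x $ j3 = (\<Sum>k\<in>UNIV. composite $ k * x $ k)"
  proof -
    have "\<nu> \<bullet> x = x $ j3 - composite \<bullet> x" by (simp add: \<nu>_def inner_diff_left inner_axis')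
    then show ?thesis using assms by (simp add: consistent_def inner_vec_def)
  qed
  have "x \<bullet> latent \<beta> = (\<Sum>k\<in>UNIV. (if k \<in> U then x $ k * \<beta> $ k else 0) + \<beta> $ j3 * (composite $ k * x $ k))"
    unfolding inner_vec_def latent_nth by (intro sum.cong) (auto simp: algebra_simps)
  also have "\<dots> = (\<Sum>k\<in>UNIV. (if k \<in> U then x $ k * \<beta> $ k else 0)) + \<beta> $ j3 * (\<Sum>k\<in>UNIV. composite $ k * x $ k)"
    by (simp add: sum.distrib sum_distrib_left)
  also have "\<dots> = (\<Sum>k\<in>UNIV. (if k \<in> U then x $ k * \<beta> $ k else 0) + (if k = j3 then x $ k * \<beta> $ k else 0))"
    unfolding x3[symmetric] by (simp add: sum.distrib mult.commute)
  also have "\<dots> = x \<bullet> \<beta>"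
    unfolding inner_vec_def using assms j3_U by (intro sum.cong) (auto simp: consistent_def)
  finally show ?thesis ..
qed

lemma rss_latent:
  assumes "\<And>i. i < n \<Longrightarrow> consistent (fst (s i))"
  shows "rss n s \<beta> = (\<Sum>i<n. (snd (s i) - fst (s i) \<bullet> latent \<beta>)\<^sup>2)"
  unfolding rss_def
proof (rule sum.cong)
  fix i assume "i \<in> {..<n}"
  then show "(snd (s i) - fst (s i) \<bullet> \<beta>)\<^sup>2 = (snd (s i) - fst (s i) \<bullet> latent \<beta>)\<^sup>2"
    using consistent_inner[OF assms, of i \<beta>] by simp
qed simp

lemma l1_split: "l1_norm \<beta> = \<bar>\<beta> $ j1\<bar> + \<bar>\<beta> $ j2\<bar> + \<bar>\<beta> $ j3\<bar> + (\<Sum>k\<in>UNIV - {j1, j2, j3}. \<bar>\<beta> $ k\<bar>)"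
proof -
  have "l1_norm \<beta> = (\<Sum>k\<in>{j1, j2, j3}. \<bar>\<beta> $ k\<bar>) + (\<Sum>k\<in>UNIV - {j1, j2, j3}. \<bar>\<beta> $ k\<bar>)"
    unfolding l1_norm_def by (subst sum.subset_diff[of "{j1,j2,j3}"]) auto
  then show ?thesis using distinct by simp
qed

lemma sum_c_rest: "(\<Sum>k\<in>UNIV - {j1, j2, j3}. c k) = (\<Sum>k\<in>K. c k)"
  using distinct c_outside by (intro sum.mono_neutral_right) auto

text \<open>
  Adding \<open>\<zeta> \<nu>\<close> saves \<open>7/10 \<zeta>\<close> on each of
  \<open>j1\<close> and \<open>j2\<close> and costs at most \<open>\<zeta> + \<zeta> \<Sum>c
  \<le> 7/5 \<zeta>\<close>. The saving is genuine because closeness to the truth keeps both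
  coefficients nonnegative until the composite weight reaches \<open>1/2\<close>.
\<close>
lemma shift_weight_to_composite:
  assumes close: "norm (latent (\<beta> - truth)) \<le> 1 / 10"
  shows "\<exists>\<beta>'. latent \<beta>' = latent \<beta> \<and> l1_norm \<beta>' \<le> l1_norm \<beta> \<and> 1 / 2 \<le> \<beta>' $ j3"
proof (cases "1 / 2 \<le> \<beta> $ j3")
  case False
  define \<zeta> where "\<zeta> = 1 / 2 - \<beta> $ j3"
  define \<beta>' where "\<beta>' = \<beta> + \<zeta> *\<^sub>R \<nu>"
  have z: "\<zeta> > 0" using False by (simp add: \<zeta>_def)
  have n: "\<beta>' $ j1 = \<beta> $ j1 - 7/10 * \<zeta>" "\<beta>' $ j2 = \<beta> $ j2 - 7/10 * \<zeta>" "\<beta>' $ j3 = 1 / 2"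
    using distinct by (auto simp: \<beta>'_def \<nu>_def composite_nth axis_def \<zeta>_def)
  have r: "\<beta>' $ k = \<beta> $ k + \<zeta> * c k" if "k \<in> UNIV - {j1, j2, j3}" for k
    using that by (auto simp: \<beta>'_def \<nu>_def composite_def axis_def)
  have pos: "0 \<le> \<beta>' $ j1" "0 \<le> \<beta>' $ j2"
  proof -
    have "latent (\<beta> - truth) $ j1 = \<beta> $ j1 + 7 / 10 * \<beta> $ j3 - 1 / 2"
      "latent (\<beta> - truth) $ j2 = \<beta> $ j2 + 7 / 10 * \<beta> $ j3 - 1 / 2"
      using distinct by (auto simp: latent_nth composite_nth truth_def U_def algebra_simps)
    moreover have "- latent (\<beta> - truth) $ j \<le> 1 / 10" for j
      by (rule abs_le_D2[OF order_trans[OF component_le_norm_cart close]])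
    from this[of j1] this[of j2]
    have "- (1 / 10) \<le> latent (\<beta> - truth) $ j1" "- (1 / 10) \<le> latent (\<beta> - truth) $ j2" by linarith+
    ultimately show "0 \<le> \<beta>' $ j1" "0 \<le> \<beta>' $ j2" unfolding n \<zeta>_def by (simp_all add: right_diff_distrib)
  qed
  have "(\<Sum>k\<in>UNIV - {j1, j2, j3}. \<bar>\<beta>' $ k\<bar>) \<le> (\<Sum>k\<in>UNIV - {j1, j2, j3}. \<bar>\<beta> $ k\<bar> + \<zeta> * c k)"
  proof (rule sum_mono)
    fix k assume "k \<in> UNIV - {j1, j2, j3}"
    moreover have "0 \<le> \<zeta> * c k" using z c_nonneg[of k] by simp
    ultimately show "\<bar>\<beta>' $ k\<bar> \<le> \<bar>\<beta> $ k\<bar> + \<zeta> * c k" unfolding r[OF \<open>k \<in> _\<close>] by linarith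
  qed
  also have "\<dots> = (\<Sum>k\<in>UNIV - {j1, j2, j3}. \<bar>\<beta> $ k\<bar>) + \<zeta> * (\<Sum>k\<in>K. c k)"
    by (simp add: sum.distrib sum_c_rest flip: sum_distrib_left)
  also have "\<dots> \<le> (\<Sum>k\<in>UNIV - {j1, j2, j3}. \<bar>\<beta> $ k\<bar>) + \<zeta> * (2 / 5)"
    using z c_sum by (intro add_left_mono mult_left_mono) auto
  finally have "(\<Sum>k\<in>UNIV - {j1, j2, j3}. \<bar>\<beta>' $ k\<bar>) \<le> (\<Sum>k\<in>UNIV - {j1, j2, j3}. \<bar>\<beta> $ k\<bar>) + \<zeta> * (2 / 5)" .
  moreover have "\<bar>\<beta>' $ j3\<bar> \<le> \<bar>\<beta> $ j3\<bar> + \<zeta>" unfolding n \<zeta>_def by linarith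
  moreover have "\<bar>\<beta>' $ j1\<bar> \<le> \<bar>\<beta> $ j1\<bar> - 7/10 * \<zeta>" "\<bar>\<beta>' $ j2\<bar> \<le> \<bar>\<beta> $ j2\<bar> - 7/10 * \<zeta>"
    using pos n by linarith+
  ultimately have "l1_norm \<beta>' \<le> l1_norm \<beta>" unfolding l1_split by linarith
  moreover have "latent \<beta>' = latent \<beta>"
    using latent_null by (simp add: \<beta>'_def linear_add[OF latent_linear] linear_cmul[OF latent_linear])
  ultimately show ?thesis using n(3) by (intro exI[of _ \<beta>']) auto
qed auto

section \<open>Minimizers of maximal risk are far from the truth\<close>

text \<open>
  If the composite has weight \<open>w\<close>, a small error forces the coefficient on \<open>k
  \<in> K\<close> to be close to \<open>w c\<^sub>k\<close>.
\<close>
lemma latent_error_nth: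
  assumes "k \<in> K"
  shows "latent (\<beta> - truth) $ k = \<beta> $ k - \<beta> $ j3 * c k"
  using assms distinct K_U by (auto simp: latent_nth composite_nth truth_def)

text \<open>
  The risk is a strictly convex function of the latent coordinates, so a minimizer of maximal
  risk cannot be the midpoint of two other minimizers with different latent coordinates. A
  minimizer close to the truth is such a midpoint, by the count of nonzero coefficients in
  \<open>K\<close> against the \<open>n\<close> samples and the one condition that keeps the
  \<open>\<ell>\<^sub>1\<close> norm.
\<close>
lemma extremal_minimizer_is_far:
  fixes s :: "nat \<Rightarrow> (real^'p) \<times> real"
  assumes s: "\<And>i. i < n \<Longrightarrow> consistent (fst (s i))"
    and n: "n \<ge> 30" and K: "card K = 3 * n - 3" and c_large: "\<And>k. k \<in> K \<Longrightarrow> 1 / (10 * n) \<le> c k"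
    and \<beta>: "\<beta> \<in> lasso_minimizers n s B"
    and ext: "\<And>\<beta>'. \<beta>' \<in> lasso_minimizers n s B \<Longrightarrow> norm (latent (\<beta>' - truth)) \<le> norm (latent (\<beta> - truth))"
  shows "1 / (4608 * n) \<le> (norm (latent (\<beta> - truth)))\<^sup>2"
proof (rule ccontr)
  assume "\<not> ?thesis"
  then have small: "(norm (latent (\<beta> - truth)))\<^sup>2 < 1 / (4608 * n)" by simp
  also have "\<dots> \<le> (1 / 10)\<^sup>2" using n by (simp add: field_simps power2_eq_square)
  finally have "norm (latent (\<beta> - truth)) < 1 / 10"
    by (rule power2_less_imp_less) simp
  then have "norm (latent (\<beta> - truth)) \<le> 1 / 10" by simp
  then obtain b where b: "latent b = latent \<beta>" "l1_norm b \<le> l1_norm \<beta>" "1 / 2 \<le> b $ j3"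
    using shift_weight_to_composite by blast
  have sub: "latent (v - w) = latent v - latent w" for v w by (rule linear_diff[OF latent_linear])
  have rb: "rss n s b = rss n s \<beta>"
    using rss_latent[of n s b, OF s] rss_latent[of n s \<beta>, OF s] b(1) by simp
  let ?d = "latent (b - truth)"
  have db: "?d = latent (\<beta> - truth)" by (simp add: sub b)
  define A where "A = {k\<in>K. b $ k \<noteq> 0}"
  define Z where "Z = {k\<in>K. b $ k = 0}"
  \<comment> \<open>a vanishing coefficient in \<open>K\<close> costs at least \<open>(1/2 c\<^sub>k)\<^sup>2 \<ge> 1/(20n)\<^sup>2\<close> of squared error, so there are few of them\<close>
  have "card Z * (1 / (400 * (real n)\<^sup>2)) = (\<Sum>k\<in>Z. 1 / (400 * (real n)\<^sup>2))" by simp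
  also have "\<dots> \<le> (\<Sum>k\<in>Z. (?d $ k)\<^sup>2)"
  proof (rule sum_mono)
    fix k assume k: "k \<in> Z"
    have "1 / (20 * real n) = 1 / 2 * (1 / (10 * n))" by simp
    also have "\<dots> \<le> b $ j3 * c k" using b(3) c_large[of k] k by (intro mult_mono) (auto simp: Z_def)
    finally have "(1 / (20 * real n))\<^sup>2 \<le> (b $ j3 * c k)\<^sup>2" by (intro power_mono) auto
    also have "(b $ j3 * c k)\<^sup>2 = (?d $ k)\<^sup>2" using k latent_error_nth[of k b] by (simp add: Z_def)
    finally show "1 / (400 * (real n)\<^sup>2) \<le> (?d $ k)\<^sup>2" by (simp add: power_divide power_mult_distrib)
  qed
  also have "\<dots> \<le> (\<Sum>k\<in>UNIV. (?d $ k)\<^sup>2)" by (intro sum_mono2) auto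
  also have "\<dots> = (norm ?d)\<^sup>2" by (simp add: norm_vec_squared)
  also have "\<dots> < 1 / (4608 * n)" using small db by simp
  finally have "real (card Z) < n * (400 / 4608)" using n by (simp add: field_simps power2_eq_square)
  moreover have "real n * (400 / 4608) \<le> n * (1 / 11)" by (intro mult_left_mono) auto
  ultimately have cZ: "11 * card Z < n" by linarith
  have "card K = card A + card Z"
    unfolding A_def Z_def by (subst card_Un_disjoint[symmetric]) (auto intro: arg_cong[where f=card])
  then have cA: "n + 2 \<le> card A" using K cZ n by linarith
  \<comment> \<open>one condition for each sample, and one that keeps the \<open>\<ell>\<^sub>1\<close> norm constant\<close>
  let ?C = "insert (\<chi> k. sgn (b $ k)) ((\<lambda>i. fst (s i)) ` {..<n})"
  have "card ?C \<le> Suc n"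
    using card_image_le[of "{..<n}" "\<lambda>i. fst (s i)"] by (simp add: card_insert_if)
  then obtain \<eta> where e: "\<eta> \<noteq> 0" "\<And>j. j \<notin> A \<Longrightarrow> \<eta> $ j = 0" "\<And>x. x \<in> ?C \<Longrightarrow> x \<bullet> \<eta> = 0"
    using exists_orthogonal_supported[of ?C A] cA by auto
  have sg: "(\<Sum>k\<in>UNIV. sgn (b $ k) * \<eta> $ k) = 0"
    using e(3)[of "\<chi> k. sgn (b $ k)"] by (simp add: inner_vec_def)
  \<comment> \<open>the largest step that changes no sign\<close>
  define t where "t = Min ((\<lambda>k. \<bar>b $ k\<bar>) ` A) / norm \<eta>"
  have A0: "A \<noteq> {}" using cA by auto
  have t: "t > 0" unfolding t_def using e(1) A0 by (auto simp: A_def)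
  have tb: "\<bar>t * \<eta> $ k\<bar> \<le> \<bar>b $ k\<bar>" for k
  proof (cases "k \<in> A")
    case True
    have "\<bar>t * \<eta> $ k\<bar> \<le> t * norm \<eta>" using t component_le_norm_cart[of \<eta> k] by (simp add: abs_mult)
    also have "\<dots> = Min ((\<lambda>k. \<bar>b $ k\<bar>) ` A)" using e(1) by (simp add: t_def)
    also have "\<dots> \<le> \<bar>b $ k\<bar>" using True by auto
    finally show ?thesis .
  qed (simp add: e(2))
  have min: "b + r *\<^sub>R \<eta> \<in> lasso_minimizers n s B" and dist: "latent (b + r *\<^sub>R \<eta> - truth) = ?d + r *\<^sub>R \<eta>"
    if r: "r = t \<or> r = - t" for r
  proof -
    have le: "latent \<eta> = \<eta>" using e(2) K_U by (intro latent_supported) (auto simp: A_def)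
    have lb: "latent (b + r *\<^sub>R \<eta>) = latent b + r *\<^sub>R \<eta>"
      by (simp add: linear_add[OF latent_linear] linear_cmul[OF latent_linear] le)
    then show "latent (b + r *\<^sub>R \<eta> - truth) = ?d + r *\<^sub>R \<eta>" by (simp add: sub)
    have "\<bar>(b + r *\<^sub>R \<eta>) $ k\<bar> = \<bar>b $ k\<bar> + r * (sgn (b $ k) * \<eta> $ k)" for k
    proof -
      have "\<bar>r * \<eta> $ k\<bar> \<le> \<bar>b $ k\<bar>" using tb[of k] r by (elim disjE) (simp_all add: abs_mult)
      from abs_add_sgn[OF this] show ?thesis by (simp add: mult.left_commute)
    qed
    then have "l1_norm (b + r *\<^sub>R \<eta>) = l1_norm b"
      unfolding l1_norm_def using sg by (simp add: sum.distrib flip: sum_distrib_left)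
    moreover have "rss n s (b + r *\<^sub>R \<eta>) = rss n s b"
      using rss_latent[of n s b, OF s] rss_latent[of n s "b + r *\<^sub>R \<eta>", OF s] e(3) lb
      by (simp add: inner_add_right)
    ultimately show "b + r *\<^sub>R \<eta> \<in> lasso_minimizers n s B"
      using \<beta> b rb by (auto simp: lasso_minimizers_iff)
  qed
  have parallelogram: "(norm (u + v))\<^sup>2 + (norm (u - v))\<^sup>2 = 2 * (norm u)\<^sup>2 + 2 * (norm v)\<^sup>2" for u v :: "real^'p"
    unfolding power2_norm_eq_inner by (simp add: inner_add_left inner_add_right inner_diff_left inner_diff_right)
  have "(norm (?d + r *\<^sub>R \<eta>))\<^sup>2 \<le> (norm ?d)\<^sup>2" if "r = t \<or> r = - t" for r
    using ext[OF min[OF that]] unfolding dist[OF that] db by (intro power_mono) auto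
  then have "(norm (?d + t *\<^sub>R \<eta>))\<^sup>2 \<le> (norm ?d)\<^sup>2" "(norm (?d + (- t) *\<^sub>R \<eta>))\<^sup>2 \<le> (norm ?d)\<^sup>2"
    by blast+
  then have "(norm (?d + t *\<^sub>R \<eta>))\<^sup>2 + (norm (?d - t *\<^sub>R \<eta>))\<^sup>2 \<le> 2 * (norm ?d)\<^sup>2"
    unfolding scaleR_minus_left add_uminus_conv_diff by linarith
  moreover have "(norm (t *\<^sub>R \<eta>))\<^sup>2 > 0" using t e(1) by simp
  ultimately show False using parallelogram[of ?d "t *\<^sub>R \<eta>"] by linarith
qed

end

section \<open>Minimizers fit the noise\<close>

text \<open>
  The function \<open>|y|\<close> deviates from \<open>y\<close> only where \<open>y\<close> is
  negative. Since \<open>a > 0\<close>, the point \<open>a + d + g\<close> is negative only if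
  \<open>d + g\<close> is large compared with \<open>a\<close>, which the quadratic term pays
  for. This form needs no case distinction between coordinates that keep their sign and those
  that change it.
\<close>
lemma abs_perturb_le:
  fixes a d g :: real
  assumes "0 < a0" "a0 \<le> a"
  shows "\<bar>a + d + g\<bar> \<le> \<bar>a + d\<bar> + g + (d\<^sup>2 + g\<^sup>2) / a0"
proof -
  have a: "0 < a" using assms by simp
  have "0 \<le> (d + g + 2 * a)\<^sup>2 + (d - g)\<^sup>2" by simp
  then have "- 2 * (a + d + g) * (2 * a) \<le> 2 * (d\<^sup>2 + g\<^sup>2)"
    by (simp add: power2_eq_square algebra_simps)
  then have "- 2 * (a + d + g) \<le> (d\<^sup>2 + g\<^sup>2) / a"
    unfolding pos_le_divide_eq[OF a] by (simp add: algebra_simps)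
  also have "\<dots> \<le> (d\<^sup>2 + g\<^sup>2) / a0" using assms a by (intro divide_left_mono) auto
  finally have 1: "- 2 * (a + d + g) \<le> (d\<^sup>2 + g\<^sup>2) / a0" .
  have 2: "0 \<le> (d\<^sup>2 + g\<^sup>2) / a0" using assms by simp
  show ?thesis
  proof (cases "0 \<le> a + d + g")
    case True
    then show ?thesis using 2 abs_ge_self[of "a + d"] by simp
  next
    case False
    then have "\<bar>a + d + g\<bar> = - (a + d + g)" by simp
    then show ?thesis using 1 abs_ge_self[of "a + d"] by simp
  qed
qed

lemma sum_two_squares_le: "((u :: real) - v)\<^sup>2 \<le> 2 * u\<^sup>2 + 2 * v\<^sup>2"
proof -
  have "0 \<le> (u + v)\<^sup>2" by simp
  then show ?thesis by (simp add: power2_eq_square algebra_simps)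
qed

lemma abs_le_of_square_le:
  assumes "(x :: real)\<^sup>2 \<le> y\<^sup>2" "0 \<le> y"
  shows "x \<le> y" "- y \<le> x"
  using abs_le_square_iff[of x y] assms by auto

context lasso_design
begin

lemma latent_outside: "k \<notin> U \<Longrightarrow> latent \<beta> $ k = 0"
  by (simp add: latent_nth composite_nth)

text \<open>
  The competitor adds \<open>\<gamma> = \<tau> \<sigma>/n g - \<tau>/(2m) 1\<close> on
  \<open>T\<close>, a small multiple of the correlations \<open>X\<^sub>T\<^sup>T (\<sigma>
  z)\<close> of the features with the noise, shifted by a constant. Since
  \<open>\<sigma>\<^sup>2 \<approx> n/m\<^sup>2\<close>, its entries are of order
  \<open>\<tau>/m\<close>, which is small compared with the weights \<open>b\<^sub>j\<^sub>3
  c\<^sub>k \<ge> 1/(20m)\<close> of the minimizer. The training error drops by order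
  \<open>\<tau> n/m\<close> to first order; the quadratic loss is of order \<open>\<tau>\<^sup>2
  n/m\<close>; the interaction with the error \<open>d\<close> of the minimizer is of order
  \<open>\<tau> n/\<surd>m |d|\<close>, which is harmless exactly because \<open>|d|\<close> is
  below a small multiple of \<open>1/\<surd>m\<close>.
\<close>
lemma minimizer_is_far_if_typical:
  fixes s :: "nat \<Rightarrow> (real^'p) \<times> real" and T :: "'p set" and \<sigma> :: real
  defines "m \<equiv> real (card T)"
  assumes s: "\<And>i. i < n \<Longrightarrow> consistent (fst (s i))"
    and n: "n > 0" and m90: "90 \<le> card T" and T: "T \<subseteq> K"
    and c_large: "\<And>k. k \<in> T \<Longrightarrow> 1 / (10 * m) \<le> c k"
    and \<sigma>: "0 < \<sigma>" "9 / 10 * n \<le> \<sigma>\<^sup>2 * m\<^sup>2" "\<sigma>\<^sup>2 * m\<^sup>2 \<le> n"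
    and good: "typical n U T (\<lambda>i. fst (s i)) (\<lambda>i. (snd (s i) - fst (s i) \<bullet> truth) / \<sigma>)"
    and \<beta>: "\<beta> \<in> lasso_minimizers n s B"
  shows "1 / (6000000 * m) \<le> (norm (latent (\<beta> - truth)))\<^sup>2"
proof (rule ccontr)
  assume "\<not> ?thesis"
  then have small: "(norm (latent (\<beta> - truth)))\<^sup>2 < 1 / (6000000 * m)" by simp
  have m: "90 \<le> m" "0 < m" using m90 by (auto simp: m_def)
  have N: "0 < real n" using n by simp
  have "1 / (6000000 * m) \<le> (1 / 10)\<^sup>2" using m by (simp add: field_simps power2_eq_square)
  with small have "(norm (latent (\<beta> - truth)))\<^sup>2 < (1 / 10)\<^sup>2" by (rule less_le_trans)
  then have "norm (latent (\<beta> - truth)) < 1 / 10" by (rule power2_less_imp_less) simp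
  then have "norm (latent (\<beta> - truth)) \<le> 1 / 10" by simp
  then obtain b where b: "latent b = latent \<beta>" "l1_norm b \<le> l1_norm \<beta>" "1 / 2 \<le> b $ j3"
    using shift_weight_to_composite by blast
  define d where "d = latent (b - truth)"
  have sub: "latent (v - w) = latent v - latent w" for v w by (rule linear_diff[OF latent_linear])
  have d2: "(norm d)\<^sup>2 < 1 / (6000000 * m)" using small by (simp add: d_def sub b)
  have TU: "T \<subseteq> U" using T K_U by auto
  define x where "x i = fst (s i)" for i
  define z where "z i = (snd (s i) - fst (s i) \<bullet> truth) / \<sigma>" for i
  define g where "g k = (\<Sum>i<n. z i * x i $ k)" for k
  define P where "P i = (\<Sum>l\<in>T. x i $ l * g l)" for i
  define t where "t i = (\<Sum>l\<in>T. x i $ l)" for i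
  have Q1: "((\<Sum>k\<in>T. (g k)\<^sup>2) - m * n)\<^sup>2 \<le> (3 / 5 * m * n)\<^sup>2"
    and Q2: "(\<Sum>k\<in>T. g k)\<^sup>2 \<le> 16 * m * n"
    and Q3: "(\<Sum>i<n. (t i)\<^sup>2) \<le> 25 * m * n"
    and Q4: "(\<Sum>k\<in>U. (\<Sum>i<n. x i $ k * t i)\<^sup>2) \<le> 250 * m * (real n)\<^sup>2"
    and Q5: "(\<Sum>i<n. (P i)\<^sup>2) \<le> 500 * m * (real n)\<^sup>2"
    and Q6: "(\<Sum>k\<in>U. (\<Sum>i<n. x i $ k * P i)\<^sup>2) \<le> 7250 * m * (real n) ^ 3"
    using good unfolding typical_def Let_def m_def g_def P_def t_def x_def z_def by blast+
  \<comment> \<open>small enough for the quadratic loss, of order \<open>\<tau>\<^sup>2\<close>, to be dominated, and large enough for the decrease \<open>78/1000 \<tau>\<close> of the \<open>\<ell>\<^sub>1\<close> norm to outweigh the contribution \<open>20 m |d|\<^sup>2 < 1/300000\<close> of the error\<close>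
  define \<tau> :: real where "\<tau> = 1 / 10000"
  define \<gamma> :: "real^'p" where "\<gamma> = (\<chi> k. if k \<in> T then \<tau> * \<sigma> / n * g k - \<tau> / (2 * m) else 0)"
  have lg: "latent \<gamma> = \<gamma>" using TU by (intro latent_supported) (auto simp: \<gamma>_def)
  define h where "h i = x i \<bullet> \<gamma>" for i
  have h: "h i = \<tau> * \<sigma> / n * P i - \<tau> / (2 * m) * t i" for i
  proof -
    have "h i = (\<Sum>k\<in>T. x i $ k * (\<tau> * \<sigma> / n * g k - \<tau> / (2 * m)))"
      by (simp add: h_def inner_vec_def \<gamma>_def if_distrib[where f="\<lambda>y. _ * y"] sum.If_cases cong: if_cong)
    then show ?thesis
      unfolding P_def t_def sum_distrib_left sum_subtractf[symmetric]
      by (auto intro!: sum.cong simp: algebra_simps)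
  qed
  have G2: "2 / 5 * m * n \<le> (\<Sum>k\<in>T. (g k)\<^sup>2)" "(\<Sum>k\<in>T. (g k)\<^sup>2) \<le> 8 / 5 * m * n"
    using abs_le_of_square_le[OF Q1] m N by simp_all
  have "(\<sigma> * (\<Sum>k\<in>T. g k))\<^sup>2 \<le> \<sigma>\<^sup>2 * (16 * m * n)"
    using Q2 by (simp add: power_mult_distrib mult_left_mono)
  also have "\<dots> = 16 * n / m * (\<sigma>\<^sup>2 * m\<^sup>2)" using m by (simp add: power2_eq_square)
  also have "\<dots> \<le> 16 * n / m * n" using \<sigma> m N by (intro mult_left_mono) auto
  also have "\<dots> \<le> 16 * n / 90 * n" using m N by (intro mult_right_mono divide_left_mono) auto
  also have "\<dots> \<le> (422 / 1000 * n)\<^sup>2" by (simp add: power2_eq_square)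
  finally have "(\<sigma> * (\<Sum>k\<in>T. g k))\<^sup>2 \<le> (422 / 1000 * n)\<^sup>2" .
  from abs_le_of_square_le(1)[OF this]
  have G1: "\<sigma> * (\<Sum>k\<in>T. g k) \<le> 422 / 1000 * n" by simp
  have sm: "\<sigma>\<^sup>2 * m \<le> n / m" "9 / 10 * (n / m) \<le> \<sigma>\<^sup>2 * m"
    using \<sigma> m by (simp_all add: field_simps power2_eq_square)
  \<comment> \<open>the constant shift outweighs the fluctuation of the sum of the correlations, since \<open>4/\<surd>90 < 1/2\<close>\<close>
  have \<gamma>sum: "(\<Sum>k\<in>T. \<gamma> $ k) \<le> - (78 / 1000) * \<tau>"
  proof -
    have "(\<Sum>k\<in>T. \<gamma> $ k) = (\<Sum>k\<in>T. \<tau> / n * (\<sigma> * g k)) - m * (\<tau> / (2 * m))"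
      by (simp add: \<gamma>_def sum_subtractf m_def mult.assoc)
    also have "\<dots> = \<tau> / n * (\<sigma> * (\<Sum>k\<in>T. g k)) - \<tau> / 2"
      unfolding sum_distrib_left using m by simp
    also have "\<dots> \<le> \<tau> / n * (422 / 1000 * n) - \<tau> / 2"
      using G1 N by (intro diff_right_mono mult_left_mono) (auto simp: \<tau>_def)
    also have "\<dots> = - (78 / 1000) * \<tau>" using N by (simp add: \<tau>_def)
    finally show ?thesis .
  qed
  have \<gamma>2: "(\<Sum>k\<in>T. (\<gamma> $ k)\<^sup>2) \<le> 37 / 10 * \<tau>\<^sup>2 / m"
  proof -
    have "(\<Sum>k\<in>T. (\<gamma> $ k)\<^sup>2) \<le> (\<Sum>k\<in>T. 2 * (\<tau> * \<sigma> / n * g k)\<^sup>2 + 2 * (\<tau> / (2 * m))\<^sup>2)"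
      by (intro sum_mono) (simp add: \<gamma>_def sum_two_squares_le)
    also have "\<dots> = 2 * (\<tau> * \<sigma> / n)\<^sup>2 * (\<Sum>k\<in>T. (g k)\<^sup>2) + m * (2 * (\<tau> / (2 * m))\<^sup>2)"
      unfolding power_mult_distrib[of "\<tau> * \<sigma> / n" "g _"]
      by (simp add: sum.distrib sum_distrib_left m_def mult.assoc)
    also have "\<dots> \<le> 2 * (\<tau> * \<sigma> / n)\<^sup>2 * (8 / 5 * m * n) + m * (2 * (\<tau> / (2 * m))\<^sup>2)"
      using G2 by (intro add_right_mono mult_left_mono) auto
    also have "\<dots> = 16 / 5 * \<tau>\<^sup>2 / n * (\<sigma>\<^sup>2 * m) + 1 / 2 * \<tau>\<^sup>2 / m"
      using m N by (simp add: field_simps power2_eq_square)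
    also have "\<dots> \<le> 16 / 5 * \<tau>\<^sup>2 / n * (n / m) + 1 / 2 * \<tau>\<^sup>2 / m"
      using sm N by (intro add_right_mono mult_left_mono) auto
    also have "\<dots> = 37 / 10 * \<tau>\<^sup>2 / m" using N m by (simp add: field_simps)
    finally show ?thesis .
  qed
  have "l1_norm (b + \<gamma>) \<le> l1_norm b"
  proof -
    have "l1_norm (b + \<gamma>) \<le> (\<Sum>k\<in>UNIV. \<bar>b $ k\<bar> + (if k \<in> T then \<gamma> $ k + 20 * m * ((d $ k)\<^sup>2 + (\<gamma> $ k)\<^sup>2) else 0))"
      unfolding l1_norm_def
    proof (rule sum_mono)
      fix k
      show "\<bar>(b + \<gamma>) $ k\<bar> \<le> \<bar>b $ k\<bar> + (if k \<in> T then \<gamma> $ k + 20 * m * ((d $ k)\<^sup>2 + (\<gamma> $ k)\<^sup>2) else 0)"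
      proof (cases "k \<in> T")
        case True
        have "1 / (20 * m) = 1 / 2 * (1 / (10 * m))" by simp
        also have "\<dots> \<le> b $ j3 * c k" using b(3) c_large[OF True] m by (intro mult_mono) auto
        finally have "1 / (20 * m) \<le> b $ j3 * c k" .
        moreover have "b $ k = b $ j3 * c k + d $ k"
          using latent_error_nth[of k b] True T by (auto simp: d_def)
        ultimately show ?thesis
          using abs_perturb_le[of "1 / (20 * m)" "b $ j3 * c k" "d $ k" "\<gamma> $ k"] True m
          by (simp add: algebra_simps)
      qed (simp add: \<gamma>_def)
    qed
    also have "\<dots> = l1_norm b + (\<Sum>k\<in>T. \<gamma> $ k) + 20 * m * ((\<Sum>k\<in>T. (d $ k)\<^sup>2) + (\<Sum>k\<in>T. (\<gamma> $ k)\<^sup>2))"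
      by (simp add: sum.distrib sum.If_cases l1_norm_def sum_distrib_left algebra_simps)
    also have "\<dots> \<le> l1_norm b + (- (78 / 1000) * \<tau>) + 20 * m * (1 / (6000000 * m) + 37 / 10 * \<tau>\<^sup>2 / m)"
    proof -
      have "(\<Sum>k\<in>T. (d $ k)\<^sup>2) \<le> (norm d)\<^sup>2" unfolding norm_vec_squared by (intro sum_mono2) auto
      then show ?thesis using \<gamma>sum \<gamma>2 d2 m by (intro add_mono mult_left_mono) auto
    qed
    also have "\<dots> \<le> l1_norm b" using m by (simp add: \<tau>_def field_simps power2_eq_square)
    finally show ?thesis .
  qed
  then have feas: "l1_norm (b + \<gamma>) \<le> B" using b \<beta> by (auto simp: lasso_minimizers_iff)
  have gain: "149 / 1000 * \<tau> * (n / m) \<le> \<sigma> * (\<Sum>i<n. z i * h i)"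
  proof -
    have zP: "(\<Sum>i<n. z i * P i) = (\<Sum>k\<in>T. (g k)\<^sup>2)"
      unfolding P_def sum_distrib_left by (subst sum.swap) (simp add: g_def power2_eq_square sum_distrib_right ac_simps)
    have zt: "(\<Sum>i<n. z i * t i) = (\<Sum>k\<in>T. g k)"
      unfolding t_def sum_distrib_left by (subst sum.swap) (simp add: g_def)
    have split: "\<sigma> * (\<Sum>i<n. z i * h i) = \<tau> * \<sigma>\<^sup>2 / n * (\<Sum>i<n. z i * P i) - \<tau> / (2 * m) * (\<sigma> * (\<Sum>i<n. z i * t i))"
      unfolding h sum_distrib_left sum_subtractf[symmetric]
      by (intro sum.cong) (auto simp: power2_eq_square algebra_simps)
    have "149 / 1000 * \<tau> * (n / m) = 2 / 5 * \<tau> * (9 / 10 * (n / m)) - \<tau> / (2 * m) * (422 / 1000 * n)"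
      using m by (simp add: field_simps)
    also have "\<dots> \<le> 2 / 5 * \<tau> * (\<sigma>\<^sup>2 * m) - \<tau> / (2 * m) * (422 / 1000 * n)"
      using sm by (intro diff_right_mono mult_left_mono) (auto simp: \<tau>_def)
    also have "\<dots> = \<tau> * \<sigma>\<^sup>2 / n * (2 / 5 * m * n) - \<tau> / (2 * m) * (422 / 1000 * n)"
      using N by simp
    also have "\<dots> \<le> \<sigma> * (\<Sum>i<n. z i * h i)"
      unfolding split zP zt using G1 G2 m N by (intro diff_mono mult_left_mono) (auto simp: \<tau>_def)
    finally show ?thesis .
  qed
  have quad: "(\<Sum>i<n. (h i)\<^sup>2) \<le> 10125 / 100000 * \<tau> * (n / m)"
  proof -
    have "(\<Sum>i<n. (h i)\<^sup>2) \<le> (\<Sum>i<n. 2 * (\<tau> * \<sigma> / n * P i)\<^sup>2 + 2 * (\<tau> / (2 * m) * t i)\<^sup>2)"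
      unfolding h by (intro sum_mono sum_two_squares_le)
    also have "\<dots> = 2 * (\<tau> * \<sigma> / n)\<^sup>2 * (\<Sum>i<n. (P i)\<^sup>2) + 2 * (\<tau> / (2 * m))\<^sup>2 * (\<Sum>i<n. (t i)\<^sup>2)"
      unfolding power_mult_distrib[of "\<tau> * \<sigma> / n" "P _"] power_mult_distrib[of "\<tau> / (2 * m)" "t _"]
      by (simp add: sum.distrib sum_distrib_left mult.assoc)
    also have "\<dots> \<le> 2 * (\<tau> * \<sigma> / n)\<^sup>2 * (500 * m * (real n)\<^sup>2) + 2 * (\<tau> / (2 * m))\<^sup>2 * (25 * m * n)"
      using Q3 Q5 by (intro add_mono mult_left_mono) auto
    also have "\<dots> = 1000 * \<tau>\<^sup>2 * (\<sigma>\<^sup>2 * m) + 25 / 2 * \<tau>\<^sup>2 * (n / m)"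
      using m N by (simp add: field_simps power2_eq_square)
    also have "\<dots> \<le> 1000 * \<tau>\<^sup>2 * (n / m) + 25 / 2 * \<tau>\<^sup>2 * (n / m)"
      using sm by (intro add_right_mono mult_left_mono) auto
    also have "\<dots> = 10125 / 100000 * \<tau> * (n / m)" by (simp add: \<tau>_def power2_eq_square)
    finally show ?thesis .
  qed
  have cross: "(\<Sum>i<n. h i * (x i \<bullet> d)) \<le> 495 / 10000 * \<tau> * (n / m)"
  proof -
    define r where "r k = (\<Sum>i<n. x i $ k * h i)" for k
    have "(\<Sum>i<n. h i * (x i \<bullet> d)) = (\<Sum>i<n. \<Sum>k\<in>U. d $ k * (x i $ k * h i))"
    proof (rule sum.cong)
      fix i
      have "x i \<bullet> d = (\<Sum>k\<in>U. x i $ k * d $ k)"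
        unfolding inner_vec_def by (simp, rule sum.mono_neutral_right) (auto simp: d_def latent_outside)
      then show "h i * (x i \<bullet> d) = (\<Sum>k\<in>U. d $ k * (x i $ k * h i))"
        by (simp add: sum_distrib_left ac_simps)
    qed simp
    also have "\<dots> = (\<Sum>k\<in>U. d $ k * r k)"
      by (subst sum.swap) (simp add: r_def sum_distrib_left)
    finally have e: "(\<Sum>i<n. h i * (x i \<bullet> d)) = (\<Sum>k\<in>U. d $ k * r k)" .
    have "(\<Sum>k\<in>U. d $ k * r k)\<^sup>2 \<le> (\<Sum>k\<in>U. (d $ k)\<^sup>2) * (\<Sum>k\<in>U. (r k)\<^sup>2)"
      by (rule Cauchy_Schwarz_ineq_sum)
    also have "\<dots> \<le> (1 / (6000000 * m)) * (14625 * \<tau>\<^sup>2 * ((real n)\<^sup>2 / m))"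
    proof (rule mult_mono)
      have "(\<Sum>k\<in>U. (d $ k)\<^sup>2) \<le> (norm d)\<^sup>2" unfolding norm_vec_squared by (intro sum_mono2) auto
      then show "(\<Sum>k\<in>U. (d $ k)\<^sup>2) \<le> 1 / (6000000 * m)" using d2 by simp
      have "(\<Sum>k\<in>U. (r k)\<^sup>2) \<le> (\<Sum>k\<in>U. 2 * (\<tau> * \<sigma> / n * (\<Sum>i<n. x i $ k * P i))\<^sup>2 + 2 * (\<tau> / (2 * m) * (\<Sum>i<n. x i $ k * t i))\<^sup>2)"
      proof (rule sum_mono)
        fix k
        have "r k = \<tau> * \<sigma> / n * (\<Sum>i<n. x i $ k * P i) - \<tau> / (2 * m) * (\<Sum>i<n. x i $ k * t i)"
          unfolding r_def h by (simp add: sum_distrib_left sum_subtractf[symmetric] algebra_simps)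
        then show "(r k)\<^sup>2 \<le> 2 * (\<tau> * \<sigma> / n * (\<Sum>i<n. x i $ k * P i))\<^sup>2 + 2 * (\<tau> / (2 * m) * (\<Sum>i<n. x i $ k * t i))\<^sup>2"
          by (simp only: sum_two_squares_le)
      qed
      also have "\<dots> = 2 * (\<tau> * \<sigma> / n)\<^sup>2 * (\<Sum>k\<in>U. (\<Sum>i<n. x i $ k * P i)\<^sup>2) + 2 * (\<tau> / (2 * m))\<^sup>2 * (\<Sum>k\<in>U. (\<Sum>i<n. x i $ k * t i)\<^sup>2)"
        unfolding power_mult_distrib[of "\<tau> * \<sigma> / n" "\<Sum>i<n. _ i"] power_mult_distrib[of "\<tau> / (2 * m)" "\<Sum>i<n. _ i"]
        by (simp add: sum.distrib sum_distrib_left mult.assoc)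
      also have "\<dots> \<le> 2 * (\<tau> * \<sigma> / n)\<^sup>2 * (7250 * m * (real n) ^ 3) + 2 * (\<tau> / (2 * m))\<^sup>2 * (250 * m * (real n)\<^sup>2)"
        using Q4 Q6 by (intro add_mono mult_left_mono) auto
      also have "\<dots> = 14500 * \<tau>\<^sup>2 * n * (\<sigma>\<^sup>2 * m) + 125 * \<tau>\<^sup>2 * ((real n)\<^sup>2 / m)"
        using m N by (simp add: field_simps power2_eq_square power3_eq_cube)
      also have "\<dots> \<le> 14500 * \<tau>\<^sup>2 * n * (n / m) + 125 * \<tau>\<^sup>2 * ((real n)\<^sup>2 / m)"
        using sm by (intro add_right_mono mult_left_mono) auto
      also have "\<dots> = 14625 * \<tau>\<^sup>2 * ((real n)\<^sup>2 / m)" by (simp add: power2_eq_square)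
      finally show "(\<Sum>k\<in>U. (r k)\<^sup>2) \<le> 14625 * \<tau>\<^sup>2 * ((real n)\<^sup>2 / m)" .
    qed (use m in \<open>auto intro: sum_nonneg\<close>)
    also have "\<dots> = 14625 / 6000000 * (\<tau> * (n / m))\<^sup>2"
      using m by (simp add: field_simps power2_eq_square)
    also have "\<dots> \<le> (495 / 10000)\<^sup>2 * (\<tau> * (n / m))\<^sup>2"
      by (intro mult_right_mono) (auto simp: power2_eq_square)
    also have "\<dots> = (495 / 10000 * \<tau> * (n / m))\<^sup>2" by (simp add: power_mult_distrib power_divide)
    finally have "(\<Sum>k\<in>U. d $ k * r k)\<^sup>2 \<le> (495 / 10000 * \<tau> * (n / m))\<^sup>2" .
    from abs_le_of_square_le(1)[OF this] show ?thesis
      unfolding e using m N by (simp add: \<tau>_def)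
  qed
  have res: "snd (s i) - fst (s i) \<bullet> latent b = \<sigma> * z i - x i \<bullet> d" if "i < n" for i
    using \<sigma>(1) consistent_inner[OF s[OF that], of truth] by (simp add: z_def x_def d_def sub inner_diff_right)
  have rb: "rss n s b = (\<Sum>i<n. (\<sigma> * z i - x i \<bullet> d)\<^sup>2)"
    using rss_latent[of n s b, OF s] res by simp
  have "rss n s (b + \<gamma>) = (\<Sum>i<n. (\<sigma> * z i - x i \<bullet> d - h i)\<^sup>2)"
  proof -
    have "snd (s i) - fst (s i) \<bullet> latent (b + \<gamma>) = \<sigma> * z i - x i \<bullet> d - h i" if "i < n" for i
      using res[OF that] by (simp add: linear_add[OF latent_linear] lg inner_add_right h_def x_def)
    then show ?thesis using rss_latent[of n s "b + \<gamma>", OF s] by simp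
  qed
  also have "\<dots> = rss n s b - 2 * (\<sigma> * (\<Sum>i<n. z i * h i)) + 2 * (\<Sum>i<n. h i * (x i \<bullet> d)) + (\<Sum>i<n. (h i)\<^sup>2)"
    unfolding rb sum_distrib_left sum_subtractf[symmetric] sum.distrib[symmetric]
    by (intro sum.cong) (auto simp: power2_eq_square algebra_simps)
  also have "\<dots> < rss n s b"
  proof -
    have "\<tau> * (n / m) > 0" using m N by (simp add: \<tau>_def)
    then show ?thesis using gain quad cross by simp
  qed
  also have "rss n s b = rss n s \<beta>"
    using rss_latent[of n s b, OF s] rss_latent[of n s \<beta>, OF s] b(1) by simp
  finally show False using \<beta> feas by (auto simp: lasso_minimizers_iff not_le[symmetric])
qed

end

section \<open>Properties of the covariance and the two sample events\<close>

text \<open>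
  The logarithms enter the bounds only through this estimate.
\<close>
lemma four_le_ln:
  assumes "90 \<le> (x :: real)"
  shows "4 \<le> ln x"
proof -
  have "exp 4 = (exp 1 :: real) ^ 4" by (simp flip: exp_of_nat_mult)
  also have "\<dots> \<le> (272 / 100) ^ 4" using e_less_272 by (intro power_mono) auto
  also have "\<dots> \<le> x" using assms by (simp add: power4_eq_xxxx)
  finally show ?thesis using assms by (subst ln_ge_iff) auto
qed

lemma typical_cong:
  assumes "\<And>i. i < n \<Longrightarrow> x i = x' i" "\<And>i. i < n \<Longrightarrow> z i = z' i"
  shows "typical n U T x z = typical n U T x' z'"
  unfolding typical_def Let_def using assms by simp

context lasso_design
begin

lemma Support_truth: "Support truth = {j1, j2}"
  by (auto simp: Support_def truth_def)

lemma truth_norms: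
  "card (Support truth) \<le> 2" "1 / 2 \<le> norm truth" "l1_norm truth = 1"
proof -
  show "card (Support truth) \<le> 2" by (simp add: Support_truth card_insert_if)
  show "1 / 2 \<le> norm truth"
    using component_le_norm_cart[of truth j1] by (simp add: truth_def)
  have "l1_norm truth = (\<Sum>j\<in>{j1, j2}. 1 / 2)"
    unfolding l1_norm_def by (rule sum.mono_neutral_cong_right) (auto simp: truth_def)
  then show "l1_norm truth = 1" using distinct by simp
qed

lemma norm_composite: "(norm composite)\<^sup>2 \<le> 1"
proof -
  have "(norm composite)\<^sup>2 = (\<Sum>k\<in>U. (composite $ k)\<^sup>2)"
    unfolding norm_vec_squared by (rule sum.mono_neutral_right) (auto simp: composite_nth)
  also have "\<dots> = 98 / 100 + (\<Sum>k\<in>K. (c k)\<^sup>2)"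
    using distinct unfolding U_def by (simp add: composite_nth power2_eq_square)
  finally show ?thesis using c_square_sum by simp
qed

text \<open>
  \<open>V\<^sup>T\<close> is a coordinate projection plus a rank-one map of norm at most
  \<open>1\<close> acting on a coordinate that the projection kills.
\<close>
lemma norm_latent: "norm (latent v) \<le> sqrt 2 * norm v"
proof -
  have "(norm (latent v))\<^sup>2 \<le> (\<Sum>k\<in>UNIV. 2 * ((if k \<in> U then v $ k else 0))\<^sup>2 + 2 * (v $ j3)\<^sup>2 * (composite $ k)\<^sup>2)"
    unfolding norm_vec_squared
  proof (rule sum_mono)
    fix k
    show "(latent v $ k)\<^sup>2 \<le> 2 * ((if k \<in> U then v $ k else 0))\<^sup>2 + 2 * (v $ j3)\<^sup>2 * (composite $ k)\<^sup>2"
      using sum_two_squares_le[of "if k \<in> U then v $ k else 0" "- (v $ j3 * composite $ k)"]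
      by (simp add: latent_nth power_mult_distrib mult.assoc)
  qed
  also have "\<dots> = (\<Sum>k\<in>UNIV. 2 * ((if k \<in> U then v $ k else 0))\<^sup>2) + 2 * (v $ j3)\<^sup>2 * (norm composite)\<^sup>2"
    by (simp add: sum.distrib norm_vec_squared sum_distrib_left)
  also have "\<dots> \<le> (\<Sum>k\<in>UNIV. 2 * ((if k \<in> U then v $ k else 0))\<^sup>2) + 2 * (v $ j3)\<^sup>2 * 1"
    using norm_composite by (intro add_left_mono mult_left_mono) auto
  also have "\<dots> = (\<Sum>k\<in>UNIV. 2 * ((if k \<in> U then v $ k else 0))\<^sup>2 + (if k = j3 then 2 * (v $ k)\<^sup>2 else 0))"
    by (simp add: sum.distrib)
  also have "\<dots> \<le> (\<Sum>k\<in>UNIV. 2 * (v $ k)\<^sup>2)"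
    using j3_U by (intro sum_mono) auto
  also have "\<dots> = (sqrt 2 * norm v)\<^sup>2"
    by (simp add: norm_vec_squared power_mult_distrib sum_distrib_left)
  finally show ?thesis by (rule power2_le_imp_le) simp
qed

text \<open>
  The spectral norm is at most \<open>\<surd>2 \<sqdot> \<surd>2\<close>, as \<open>V\<close>
  and its transpose have the same norm.
\<close>
lemma covariance_properties:
  "pos_semidef (V ** transpose V)" "onorm ((*v) (V ** transpose V)) \<le> 2"
  "\<forall>i\<in>Support truth. \<forall>j\<in>Support truth. (V ** transpose V) $ i $ j = (mat 1 :: real^'p^'p) $ i $ j"
proof -
  have adj: "v \<bullet> (V *v w) = latent v \<bullet> w" for v w
    by (simp add: latent_def dot_lmul_matrix)
  have cov: "(V ** transpose V) *v v = V *v latent v" for v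
    by (simp add: latent_def matrix_vector_mul_assoc del: transpose_matrix_vector)
  show "pos_semidef (V ** transpose V)"
    unfolding pos_semidef_def cov adj by (simp add: matrix_transpose_mul)
  have nV: "norm (V *v w) \<le> sqrt 2 * norm w" for w
  proof (cases "V *v w = 0")
    case False
    have "norm (V *v w) * norm (V *v w) = latent (V *v w) \<bullet> w"
      by (simp add: adj[symmetric] power2_norm_eq_inner[symmetric] power2_eq_square)
    also have "\<dots> \<le> norm (latent (V *v w)) * norm w" by (rule norm_cauchy_schwarz)
    also have "\<dots> \<le> norm (V *v w) * (sqrt 2 * norm w)"
      using mult_right_mono[OF norm_latent[of "V *v w"] norm_ge_zero[of w]] by (simp add: ac_simps)
    finally show ?thesis using False by simp
  qed simp
  show "onorm ((*v) (V ** transpose V)) \<le> 2"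
  proof (rule onorm_bound)
    fix v
    have "norm ((V ** transpose V) *v v) \<le> sqrt 2 * norm (latent v)" unfolding cov by (rule nV)
    also have "\<dots> \<le> sqrt 2 * (sqrt 2 * norm v)" by (intro mult_left_mono norm_latent) simp
    also have "\<dots> = 2 * norm v" by (simp flip: mult.assoc)
    finally show "norm ((V ** transpose V) *v v) \<le> 2 * norm v" .
  qed simp
  show "\<forall>i\<in>Support truth. \<forall>j\<in>Support truth. (V ** transpose V) $ i $ j = (mat 1 :: real^'p^'p) $ i $ j"
  proof (intro ballI)
    fix i j assume ij: "i \<in> Support truth" "j \<in> Support truth"
    have "V $ l $ k = (if l = k then 1 else 0)" if "l \<in> Support truth" for l k
      using that distinct by (auto simp: Support_truth V_def U_def)
    then have "(V ** transpose V) $ i $ j = (\<Sum>k\<in>UNIV. (if i = k then 1 else 0) * (if j = k then 1 else 0))"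
      using ij by (simp add: matrix_matrix_mult_def transpose_def)
    then show "(V ** transpose V) $ i $ j = (mat 1 :: real^'p^'p) $ i $ j"
      by (simp add: mat_def if_distrib[where f="\<lambda>x. _ * x"] cong: if_cong)
  qed
qed

abbreviation D where "D \<sigma> \<equiv> regression_measure (V ** transpose V) truth \<sigma>"

text \<open>
  The link from samples in the support, of which part (a) speaks, to the deterministic argument,
  which starts from the linear relations.
\<close>
lemma consistent_support:
  assumes "z \<in> measure_support (D \<sigma>)" shows "consistent (fst z)"
  unfolding consistent_def
  using measure_support_regression[OF _ assms, of \<nu>] measure_support_regression[OF _ assms, of "axis _ 1"]
    latent_null latent_axis_outside by (simp add: latent_def inner_axis')

lemma consistent_AE: "AE z in D \<sigma>. consistent (fst z)"
proof -
  have "AE z in D \<sigma>. \<nu> \<bullet> fst z = 0"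
    using latent_null unfolding latent_def by (rule AE_regression_null)
  moreover have "AE z in D \<sigma>. \<forall>k\<in>- insert j3 U. axis k 1 \<bullet> fst z = 0"
    using latent_axis_outside unfolding latent_def
    by (intro AE_finite_allI AE_regression_null) auto
  ultimately show ?thesis
    by eventually_elim (auto simp: consistent_def inner_axis')
qed

lemma risk_latent: "prediction_risk (D \<sigma>) \<beta> = \<sigma>\<^sup>2 + (norm (latent (\<beta> - truth)))\<^sup>2"
  unfolding latent_def by (rule prediction_risk_eq)

lemma consistent_sample_lower_bound:
  assumes "30 \<le> n" "card K = 3 * n - 3" "\<And>k. k \<in> K \<Longrightarrow> 1 / (10 * n) \<le> c k"
    and "\<And>i. i < n \<Longrightarrow> consistent (fst (s i))" and "0 \<le> B"
  shows "\<exists>\<beta>\<in>lasso_minimizers n s B. \<sigma>\<^sup>2 + 1 / (4608 * n) \<le> prediction_risk (D \<sigma>) \<beta>"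
proof -
  have "continuous_on UNIV (\<lambda>\<beta>. norm (latent (\<beta> - truth)))"
    unfolding latent_def by (intro continuous_intros linear_continuous_on_compose[OF _ matrix_vector_mul_linear])
  from exists_extremal_minimizer[OF \<open>0 \<le> B\<close> this, of n s]
  obtain \<beta> where "\<beta> \<in> lasso_minimizers n s B"
    "\<forall>\<beta>'\<in>lasso_minimizers n s B. norm (latent (\<beta>' - truth)) \<le> norm (latent (\<beta> - truth))" by blast
  then show ?thesis
    using extremal_minimizer_is_far[of n s \<beta> B] assms by (intro bexI[of _ \<beta>]) (auto simp: risk_latent)
qed

text \<open>
  The noise is recovered from a sample as \<open>z = (y - x \<bullet>
  \<beta>\<^sup>*)/\<sigma>\<close>, so typicality is an event of the sample; pulled back to
  independent rows and noise it is the event whose probability was bounded before.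
\<close>
lemma typical_event:
  fixes T :: "'p set" and \<sigma> :: real
  assumes n: "30 \<le> n" and T: "T \<subseteq> K" "90 \<le> card T" "card T \<le> 3 * n" and K: "card K = 3 * n - 3" and \<sigma>: "0 < \<sigma>"
  defines "PD \<equiv> Pi\<^sub>M {..<n} (\<lambda>_. D \<sigma>)"
  defines "z \<equiv> \<lambda>s i. (snd (s i) - fst (s i) \<bullet> truth) / \<sigma>"
  shows "{s \<in> space PD. typical n U T (\<lambda>i. fst (s i)) (z s)} \<in> sets PD"
    and "1 / 2 \<le> measure PD {s \<in> space PD. typical n U T (\<lambda>i. fst (s i)) (z s)}"
proof -
  let ?G = "centered_gaussian (V ** transpose V)"
  interpret gaussian_rows ?G U T n
  proof (rule gaussian_rows.intro)
    show "distr ?G borel (\<lambda>x. v \<bullet> x) = normal_measure 0 (norm v)" if "\<And>j. j \<notin> U \<Longrightarrow> v $ j = 0" for v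
    proof -
      have "latent v = v" by (rule latent_supported) (rule that)
      then have e: "transpose V *v v = v" unfolding latent_def .
      show ?thesis using distr_centered_gaussian_inner[of V v] unfolding e .
    qed
    show "T \<subseteq> U" using T(1) K_U by (rule subset_trans)
  qed (rule prob_space_centered_gaussian sets_centered_gaussian)+
  let ?\<phi> = "\<lambda>(x, z). (x, x \<bullet> truth + \<sigma> * z)"
  have \<phi>: "?\<phi> \<in> ?G \<Otimes>\<^sub>M std_normal \<rightarrow>\<^sub>M borel"
    unfolding borel_prod[symmetric] by measurable
  let ?zip = "\<lambda>(X, Z). \<lambda>i\<in>{..<n}. ?\<phi> (X i, Z i)"
  have PD: "PD = distr (XX \<Otimes>\<^sub>M ZZ) (Pi\<^sub>M {..<n} (\<lambda>_. borel)) ?zip"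
    unfolding PD_def regression_measure_eq_distr
    by (rule distr_PiM_pair[OF _ prob_G prob_space_std_normal \<phi>, symmetric]) simp
  have zip: "?zip \<in> XX \<Otimes>\<^sub>M ZZ \<rightarrow>\<^sub>M Pi\<^sub>M {..<n} (\<lambda>_. borel)"
  proof -
    have "(\<lambda>w. ?\<phi> (fst w i, snd w i)) \<in> XX \<Otimes>\<^sub>M ZZ \<rightarrow>\<^sub>M borel" if "i \<in> {..<n}" for i
      by (rule measurable_compose[OF _ \<phi>]) (use that in measurable)
    then show ?thesis unfolding split_beta' by (intro measurable_restrict) (simp add: split_beta')
  qed
  have [measurable]: "fst \<in> borel_measurable (borel :: ((real^'p) \<times> real) measure)"
    "snd \<in> borel_measurable (borel :: ((real^'p) \<times> real) measure)"
    by (intro borel_measurable_continuous_onI continuous_intros)+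
  let ?E = "{s \<in> space PD. typical n U T (\<lambda>i. fst (s i)) (z s)}"
  show E: "?E \<in> sets PD"
    unfolding PD_def typical_def Let_def z_def by measurable
  have "?zip -` ?E \<inter> space (XX \<Otimes>\<^sub>M ZZ) = {w \<in> space (XX \<Otimes>\<^sub>M ZZ). typical n U T (fst w) (snd w)}"
  proof -
    have "?zip w \<in> ?E \<longleftrightarrow> typical n U T (fst w) (snd w)" if w: "w \<in> space (XX \<Otimes>\<^sub>M ZZ)" for w
    proof -
      have "?zip w \<in> space PD" using measurable_space[OF zip w] by (simp add: PD)
      moreover have "typical n U T (\<lambda>i. fst (?zip w i)) (z (?zip w)) = typical n U T (fst w) (snd w)"
        using \<sigma> by (intro typical_cong) (auto simp: split_beta' z_def)
      ultimately show ?thesis by simp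
    qed
    then show ?thesis by blast
  qed
  then have "measure PD ?E = measure (XX \<Otimes>\<^sub>M ZZ) {w \<in> space (XX \<Otimes>\<^sub>M ZZ). typical n U T (fst w) (snd w)}"
    using E unfolding PD by (subst measure_distr[OF zip]) auto
  also have "\<dots> \<ge> 1 / 2"
  proof (rule typical_prob[OF n T(2,3)])
    show "card U \<le> 3 * n" using K n distinct by (simp add: U_def card_insert_if)
  qed
  finally show "1 / 2 \<le> measure PD ?E" .
qed

text \<open>
  The linear relations hold almost surely, so they may be added to any event.
\<close>
lemma consistent_event:
  fixes \<sigma> :: real and n :: nat
  assumes E: "E \<in> sets (Pi\<^sub>M {..<n} (\<lambda>_. D \<sigma>))"
  defines "E' \<equiv> {s \<in> E. \<forall>i<n. consistent (fst (s i))}"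
  shows "E' \<in> sets (Pi\<^sub>M {..<n} (\<lambda>_. D \<sigma>))"
    and "measure (Pi\<^sub>M {..<n} (\<lambda>_. D \<sigma>)) E' = measure (Pi\<^sub>M {..<n} (\<lambda>_. D \<sigma>)) E"
proof -
  note P = prob_space_regression[of "V ** transpose V" truth \<sigma>]
  interpret PD: prob_space "Pi\<^sub>M {..<n} (\<lambda>_. D \<sigma>)" by (rule prob_space_PiM) (rule P)
  have fst_m[measurable]: "fst \<in> borel_measurable (borel :: ((real^'p) \<times> real) measure)"
    by (intro borel_measurable_continuous_onI continuous_intros)
  have "{x. consistent x} = {x. \<nu> \<bullet> x = 0} \<inter> (\<Inter>k\<in>- insert j3 U. {x. x $ k = 0})"
    by (auto simp: consistent_def)
  moreover have "closed \<dots>"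
    by (intro closed_Int closed_INT ballI closed_Collect_eq continuous_intros)
  ultimately have [measurable]: "Measurable.pred borel consistent"
    by (simp add: pred_def borel_closed)
  have "{s \<in> space (Pi\<^sub>M {..<n} (\<lambda>_. D \<sigma>)). \<forall>i\<in>{..<n}. consistent (fst (s i))} \<in> sets (Pi\<^sub>M {..<n} (\<lambda>_. D \<sigma>))"
    by measurable
  moreover have "E' = E \<inter> {s \<in> space (Pi\<^sub>M {..<n} (\<lambda>_. D \<sigma>)). \<forall>i\<in>{..<n}. consistent (fst (s i))}"
    using sets.sets_into_space[OF E] by (auto simp: E'_def)
  ultimately show E': "E' \<in> sets (Pi\<^sub>M {..<n} (\<lambda>_. D \<sigma>))" using E by auto
  have "AE s in Pi\<^sub>M {..<n} (\<lambda>_. D \<sigma>). \<forall>i\<in>{..<n}. consistent (fst (s i))"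
    using P consistent_AE by (intro AE_finite_allI AE_PiM_component) auto
  then show "measure (Pi\<^sub>M {..<n} (\<lambda>_. D \<sigma>)) E' = measure (Pi\<^sub>M {..<n} (\<lambda>_. D \<sigma>)) E"
    using E E' by (intro PD.finite_measure_eq_AE) (auto simp: E'_def elim!: eventually_mono)
qed

end

section \<open>The lower bounds\<close>

text \<open>
  The weights of scale \<open>1/n\<close> on all of \<open>K\<close> serve part (a), and those
  of scale \<open>1/|T|\<close> serve part (b). The former contribute at most
  \<open>3/10\<close> to the sum and the latter at most \<open>1/10\<close>. An empty
  \<open>T\<close> is allowed: then there is no second scale.
\<close>
lemma lasso_design_two_scales:
  fixes K T :: "'p::finite set" and n :: nat
  assumes n: "30 \<le> n" and K: "card K = 3 * n - 3" "j1 \<notin> K" "j2 \<notin> K" "j3 \<notin> K"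
    and j: "j1 \<noteq> j2" "j1 \<noteq> j3" "j2 \<noteq> j3"
    and T: "T \<subseteq> K" "T = {} \<or> 90 \<le> card T"
  defines "c \<equiv> \<lambda>k. if k \<in> K then 1 / (10 * real n) + (if k \<in> T then 1 / (10 * real (card T)) else 0) else 0"
  shows "lasso_design j1 j2 j3 K c"
    and "k \<in> K \<Longrightarrow> 1 / (10 * real n) \<le> c k" and "k \<in> T \<Longrightarrow> 1 / (10 * real (card T)) \<le> c k"
proof -
  have c0: "0 \<le> c k" for k by (simp add: c_def)
  have sum: "(\<Sum>k\<in>K. c k) \<le> 2 / 5"
  proof -
    have "(\<Sum>k\<in>K. c k) = card K * (1 / (10 * real n)) + card T * (1 / (10 * real (card T)))"
      using T by (simp add: c_def sum.distrib sum.If_cases Int_absorb1)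
    moreover have "card K * (1 / (10 * real n)) \<le> 3 * n * (1 / (10 * real n))"
      using K by (intro mult_right_mono) auto
    moreover have "3 * real n * (1 / (10 * real n)) = 3 / 10" using n by simp
    moreover have "card T * (1 / (10 * real (card T))) \<le> 1 / (10 :: real)" by simp
    ultimately show ?thesis by simp
  qed
  have c_max: "c k \<le> 1 / 20" for k
  proof -
    have "1 / (10 * real n) \<le> 1 / (10 * 30)" using n by (intro divide_left_mono) auto
    moreover have "1 / (10 * real (card T)) \<le> 1 / (10 * 90)" if "k \<in> T"
      using T that by (intro divide_left_mono) auto
    ultimately show ?thesis by (auto simp: c_def)
  qed
  have "(\<Sum>k\<in>K. (c k)\<^sup>2) \<le> (\<Sum>k\<in>K. 1 / 20 * c k)"
    unfolding power2_eq_square using c_max c0 by (intro sum_mono mult_right_mono)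
  also have "\<dots> = 1 / 20 * (\<Sum>k\<in>K. c k)" by (simp add: sum_distrib_left)
  also have "\<dots> \<le> 1 / 20 * (2 / 5)" using sum by (intro mult_left_mono) auto
  finally have "(\<Sum>k\<in>K. (c k)\<^sup>2) \<le> 1 / 50" by simp
  with sum show "lasso_design j1 j2 j3 K c"
    by unfold_locales (use K j c0 in \<open>auto simp: c_def\<close>)
  show "k \<in> K \<Longrightarrow> 1 / (10 * real n) \<le> c k" by (simp add: c_def)
  show "k \<in> T \<Longrightarrow> 1 / (10 * real (card T)) \<le> c k" using T(1) by (auto simp: c_def)
qed

theorem theorem2:
  fixes n :: nat and \<sigma> :: real
  assumes "30 \<le> n" and "3 * n \<le> CARD('p::finite)" and "0 \<le> \<sigma>"
  shows "\<exists>(\<beta>s :: real ^ 'p) (\<Sigma> :: real ^ 'p ^ 'p).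
    card (Support \<beta>s) \<le> 2 \<and>
    1 / 2 \<le> norm \<beta>s \<and> norm \<beta>s \<le> l1_norm \<beta>s \<and> l1_norm \<beta>s \<le> 1 \<and>
    pos_semidef \<Sigma> \<and> onorm ((*v) \<Sigma>) \<le> 2 \<and>
    (\<forall>i\<in>Support \<beta>s. \<forall>j\<in>Support \<beta>s. \<Sigma> $ i $ j = (mat 1 :: real ^ 'p ^ 'p) $ i $ j) \<and>
    (let D = regression_measure \<Sigma> \<beta>s \<sigma> in
      (\<forall>s. (\<forall>i<n. s i \<in> measure_support D) \<longrightarrow>
        (\<forall>B\<ge>0. \<exists>\<beta>\<in>lasso_minimizers n s B.
          prediction_risk D \<beta> \<ge> \<sigma>\<^sup>2 + 1 / (288 * real n * (ln (3 * real n))\<^sup>2))) \<and>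
      (0 < \<sigma> \<and> 100 \<le> sqrt (real n) / \<sigma> \<and> sqrt (real n) / \<sigma> \<le> real CARD('p) - 3 \<longrightarrow>
        (\<exists>E\<in>sets (Pi\<^sub>M {..<n} (\<lambda>_. D)).
          measure (Pi\<^sub>M {..<n} (\<lambda>_. D)) E \<ge> 1 / 2 \<and>
          (\<forall>s\<in>E. \<forall>B\<ge>0. \<exists>\<beta>\<in>lasso_minimizers n s B.
            prediction_risk D \<beta> \<ge> \<sigma>\<^sup>2 + \<sigma> / (409600 * sqrt (real n) *
              (ln (max (3 * real n) (real_of_int \<lceil>sqrt (real n) / \<sigma>\<rceil>)))\<^sup>2)))))"
proof -
  define M where "M = sqrt (real n) / \<sigma>"
  define L where "L = ln (3 * real n)"
  define L' where "L' = ln (max (3 * real n) (real_of_int \<lceil>M\<rceil>))"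
  define noisy where "noisy \<longleftrightarrow> 0 < \<sigma> \<and> 100 \<le> M \<and> M \<le> 3 * real n"
  have n: "30 \<le> n" by fact
  have L: "4 \<le> L" unfolding L_def using n by (intro four_le_ln) simp
  have "L \<le> L'" unfolding L_def L'_def using n by (subst ln_le_cancel_iff) auto
  then have L': "4 \<le> L'" using L by simp
  have L2: "16 \<le> L\<^sup>2" "16 \<le> L'\<^sup>2"
    using power_mono[of 4 L 2] power_mono[of 4 L' 2] L L' by auto

  obtain A :: "'p set" where A: "card A = 3"
    using assms obtain_subset_with_card_n[of 3 "UNIV :: 'p set"] by auto
  then obtain j1 j2 j3 where j: "A = {j1, j2, j3}" "j1 \<noteq> j2" "j1 \<noteq> j3" "j2 \<noteq> j3"
    by (auto simp: card_3_iff)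
  have "3 * n - 3 \<le> card (UNIV - A)" using A assms by (simp add: card_Diff_subset)
  then obtain K where K: "K \<subseteq> UNIV - A" "card K = 3 * n - 3"
    by (rule obtain_subset_with_card_n)
  \<comment> \<open>slightly below \<open>M\<close>, so that \<open>T\<close> fits into \<open>K\<close> even if \<open>M = 3n\<close>\<close>
  define m where "m = (if noisy then nat \<lfloor>M\<rfloor> - 3 else 0)"
  have m_bounds: "90 \<le> m" "real m \<le> M" "96 / 100 * M \<le> m" "m \<le> 3 * n - 3" if noisy
  proof -
    have M: "100 \<le> M" "M \<le> 3 * real n" using that by (auto simp: noisy_def)
    have fl: "100 \<le> \<lfloor>M\<rfloor>" "\<lfloor>M\<rfloor> \<le> 3 * int n" using M by linarith+
    have nfl: "100 \<le> nat \<lfloor>M\<rfloor>" "nat \<lfloor>M\<rfloor> \<le> 3 * n" using fl by linarith+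
    then have m: "real m = real_of_int \<lfloor>M\<rfloor> - 3" using that fl nfl by (simp add: m_def of_nat_diff)
    show "90 \<le> m" using nfl that by (simp add: m_def)
    show "real m \<le> M" using m by linarith
    show "96 / 100 * M \<le> m" using m M by linarith
    show "m \<le> 3 * n - 3" using nfl that by (simp add: m_def)
  qed
  have "m \<le> card K" using K m_bounds(4) by (cases noisy) (auto simp: m_def)
  then obtain T where T: "T \<subseteq> K" "card T = m" by (rule obtain_subset_with_card_n)
  have T': "T = {} \<or> 90 \<le> card T"
    using T m_bounds(1) finite[of T] by (cases noisy) (auto simp: m_def)
  define c where "c k = (if k \<in> K then 1 / (10 * real n) + (if k \<in> T then 1 / (10 * real (card T)) else 0) else 0)" for k
  have jK: "j1 \<notin> K" "j2 \<notin> K" "j3 \<notin> K" using K j by auto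
  note two_scales = lasso_design_two_scales[OF n K(2) jK j(2-4) T(1) T', folded c_def]
  interpret lasso_design j1 j2 j3 K c by (rule two_scales)
  let ?\<Sigma> = "V ** transpose V"

  \<comment> \<open>\<open>4608 = 288 \<sqdot> 4\<^sup>2\<close>\<close>
  have small_risk: "1 / (288 * real n * L\<^sup>2) \<le> 1 / (4608 * real n)"
    using n L L2 by (intro divide_left_mono mult_pos_pos) auto
  have part_a: "\<exists>\<beta>\<in>lasso_minimizers n s B. prediction_risk (D \<sigma>) \<beta> \<ge> \<sigma>\<^sup>2 + 1 / (288 * real n * L\<^sup>2)"
    if "\<And>i. i < n \<Longrightarrow> consistent (fst (s i))" "0 \<le> B" for s B
    using consistent_sample_lower_bound[OF n K(2) two_scales(2), of s B \<sigma>] that small_risk by fastforce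

  have part_b: "\<exists>E\<in>sets (Pi\<^sub>M {..<n} (\<lambda>_. D \<sigma>)). measure (Pi\<^sub>M {..<n} (\<lambda>_. D \<sigma>)) E \<ge> 1 / 2 \<and>
      (\<forall>s\<in>E. \<forall>B\<ge>0. \<exists>\<beta>\<in>lasso_minimizers n s B.
        prediction_risk (D \<sigma>) \<beta> \<ge> \<sigma>\<^sup>2 + \<sigma> / (409600 * sqrt (real n) * L'\<^sup>2))"
    if \<sigma>: "0 < \<sigma>" and M100: "100 \<le> M"
  proof -
    \<comment> \<open>\<open>6553600 = 409600 \<sqdot> 4\<^sup>2\<close>, which leaves room over the constant \<open>6000000\<close> of the noise-fitting argument\<close>
    have target: "\<sigma> / (409600 * sqrt (real n) * L'\<^sup>2) = 1 / (409600 * M * L'\<^sup>2)"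
      using \<sigma> n by (simp add: M_def)
    have "409600 * M * 16 \<le> 409600 * M * L'\<^sup>2" using L2 M100 by (intro mult_left_mono) auto
    then have "1 / (409600 * M * L'\<^sup>2) \<le> 1 / (409600 * M * 16)"
      using M100 by (intro divide_left_mono mult_pos_pos) auto
    then have target_le: "\<sigma> / (409600 * sqrt (real n) * L'\<^sup>2) \<le> 1 / (6553600 * M)"
      unfolding target by simp
    show ?thesis
    proof (cases noisy)
      case True
      note m = m_bounds[OF True]
      have \<sigma>M: "\<sigma>\<^sup>2 * M\<^sup>2 = n" using \<sigma> by (simp add: M_def power_divide)
      have s1: "9 / 10 * n \<le> \<sigma>\<^sup>2 * (real m)\<^sup>2"
      proof -
        have "9 / 10 * (\<sigma>\<^sup>2 * M\<^sup>2) \<le> 9216 / 10000 * (\<sigma>\<^sup>2 * M\<^sup>2)" by (intro mult_right_mono) auto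
        also have "\<dots> = \<sigma>\<^sup>2 * (96 / 100 * M)\<^sup>2" by (simp add: power2_eq_square)
        also have "\<dots> \<le> \<sigma>\<^sup>2 * (real m)\<^sup>2" using m M100 by (intro mult_left_mono power_mono) auto
        finally show ?thesis by (simp add: \<sigma>M)
      qed
      have s2: "\<sigma>\<^sup>2 * (real m)\<^sup>2 \<le> n"
        unfolding \<sigma>M[symmetric] using m by (intro mult_left_mono power_mono) auto
      let ?z = "\<lambda>s i. (snd (s i) - fst (s i) \<bullet> truth) / \<sigma>"
      let ?P = "Pi\<^sub>M {..<n} (\<lambda>_. D \<sigma>)"
      let ?F = "{s \<in> space ?P. typical n U T (\<lambda>i. fst (s i)) (?z s)}"
      let ?E = "{s \<in> ?F. \<forall>i<n. consistent (fst (s i))}"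
      have cT: "90 \<le> card T" "card T \<le> 3 * n" using T m by auto
      note F = typical_event[OF n T(1) cT K(2) \<sigma>]
      note E = consistent_event[OF F(1)]
      have "\<exists>\<beta>\<in>lasso_minimizers n s B. prediction_risk (D \<sigma>) \<beta> \<ge> \<sigma>\<^sup>2 + \<sigma> / (409600 * sqrt (real n) * L'\<^sup>2)"
        if s: "s \<in> ?E" and B: "0 \<le> B" for s B
      proof -
        obtain \<beta> where \<beta>: "\<beta> \<in> lasso_minimizers n s B"
          using part_a[of s B] s B by auto
        have "1 / (6000000 * real m) \<le> (norm (latent (\<beta> - truth)))\<^sup>2"
          using minimizer_is_far_if_typical[of n s T \<sigma> \<beta> B] s n T cT two_scales(3) \<sigma> s1 s2 \<beta> by auto
        moreover have "1 / (6553600 * M) \<le> 1 / (6000000 * real m)"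
          using m M100 by (intro divide_left_mono mult_mono) auto
        ultimately show ?thesis
          using target_le \<beta> by (intro bexI[of _ \<beta>]) (auto simp: risk_latent)
      qed
      then have "\<forall>s\<in>?E. \<forall>B\<ge>0. \<exists>\<beta>\<in>lasso_minimizers n s B.
          prediction_risk (D \<sigma>) \<beta> \<ge> \<sigma>\<^sup>2 + \<sigma> / (409600 * sqrt (real n) * L'\<^sup>2)" by blast
      with E(2) F(2) show ?thesis by (intro bexI[OF _ E(1)] conjI) (simp_all only:)
    next
      case False
      then have "3 * real n < M" using \<sigma> M100 by (simp add: noisy_def)
      \<comment> \<open>as \<open>M > 3n\<close>, the target lies below the bound that holds for every consistent sample\<close>
      then have "1 / (6553600 * M) \<le> 1 / (4608 * real n)"
        using n by (intro divide_left_mono) auto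
      with target_le have le: "\<sigma> / (409600 * sqrt (real n) * L'\<^sup>2) \<le> 1 / (4608 * real n)" by simp
      let ?P = "Pi\<^sub>M {..<n} (\<lambda>_. D \<sigma>)"
      note E = consistent_event[OF sets.top, of n \<sigma>]
      have "\<exists>\<beta>\<in>lasso_minimizers n s B. prediction_risk (D \<sigma>) \<beta> \<ge> \<sigma>\<^sup>2 + \<sigma> / (409600 * sqrt (real n) * L'\<^sup>2)"
        if "\<And>i. i < n \<Longrightarrow> consistent (fst (s i))" "0 \<le> B" for s B
        using consistent_sample_lower_bound[OF n K(2) two_scales(2), of s B \<sigma>] that le by fastforce
      then have lower: "\<forall>s\<in>{s \<in> space ?P. \<forall>i<n. consistent (fst (s i))}. \<forall>B\<ge>0. \<exists>\<beta>\<in>lasso_minimizers n s B.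
          prediction_risk (D \<sigma>) \<beta> \<ge> \<sigma>\<^sup>2 + \<sigma> / (409600 * sqrt (real n) * L'\<^sup>2)" by blast
      have "measure ?P (space ?P) = 1"
        by (intro prob_space.prob_space prob_space_PiM prob_space_regression)
      then have "1 / 2 \<le> measure ?P {s \<in> space ?P. \<forall>i<n. consistent (fst (s i))}"
        unfolding E(2) by simp
      with lower show ?thesis by (intro bexI[OF _ E(1)] conjI)
    qed
  qed

  show ?thesis
  proof (intro exI conjI)
    show "card (Support truth) \<le> 2" "1 / 2 \<le> norm truth" by (rule truth_norms)+
    show "norm truth \<le> l1_norm truth" by (rule norm_le_l1_norm)
    show "l1_norm truth \<le> 1" by (simp add: truth_norms)
    show "pos_semidef ?\<Sigma>" "onorm ((*v) ?\<Sigma>) \<le> 2"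
      "\<forall>i\<in>Support truth. \<forall>j\<in>Support truth. ?\<Sigma> $ i $ j = (mat 1 :: real^'p^'p) $ i $ j"
      by (rule covariance_properties)+
    show "let D = D \<sigma> in
      (\<forall>s. (\<forall>i<n. s i \<in> measure_support D) \<longrightarrow>
        (\<forall>B\<ge>0. \<exists>\<beta>\<in>lasso_minimizers n s B.
          prediction_risk D \<beta> \<ge> \<sigma>\<^sup>2 + 1 / (288 * real n * (ln (3 * real n))\<^sup>2))) \<and>
      (0 < \<sigma> \<and> 100 \<le> sqrt (real n) / \<sigma> \<and> sqrt (real n) / \<sigma> \<le> real CARD('p) - 3 \<longrightarrow>
        (\<exists>E\<in>sets (Pi\<^sub>M {..<n} (\<lambda>_. D)).
          measure (Pi\<^sub>M {..<n} (\<lambda>_. D)) E \<ge> 1 / 2 \<and>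
          (\<forall>s\<in>E. \<forall>B\<ge>0. \<exists>\<beta>\<in>lasso_minimizers n s B.
            prediction_risk D \<beta> \<ge> \<sigma>\<^sup>2 + \<sigma> / (409600 * sqrt (real n) *
              (ln (max (3 * real n) (real_of_int \<lceil>sqrt (real n) / \<sigma>\<rceil>)))\<^sup>2))))"
      unfolding Let_def M_def[symmetric] L_def[symmetric] L'_def[symmetric]
    proof (intro conjI allI impI)
      fix s B assume "\<forall>i<n. s i \<in> measure_support (D \<sigma>)" "0 \<le> (B :: real)"
      then show "\<exists>\<beta>\<in>lasso_minimizers n s B. prediction_risk (D \<sigma>) \<beta> \<ge> \<sigma>\<^sup>2 + 1 / (288 * real n * L\<^sup>2)"
        by (intro part_a consistent_support[of _ \<sigma>]) blast+
    qed (rule part_b; simp)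
  qed
qed

end
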